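(* Let $\mathsf{D}$ be a Hom-finite, Krull-Schmidt, $\mathbf{k}$-linear triangulated category (with shift $\Sigma$) and let $w \geq 1$. Suppose $\mathsf{S}$ is a $w$-orthogonal collection in $\mathsf{D}$ whose extension closure $\langle \mathsf{S}\rangle$ is functorially finite in $\mathsf{D}$. Let $$\mathsf{Z} = \{ d \in \mathsf{D} \mid \mathrm{Hom}(\Sigma^i \mathsf{S}, d) = 0 \text{ and } \mathrm{Hom}(d, \Sigma^{-i}\mathsf{S}) = 0 \text{ for all } i = 0, \ldots, w-1 \}.$$ If $\mathsf{D}$ is $(-w)$-Calabi-Yau, then so is $\mathsf{Z}$ (with the triangulated structure $(\langle1\rangle,\Delta)$ described in the context).
   Context: $\mathbf{k}$ is an algebraically closed field. All subcategories are full and strict (closed under isomorphism). For subcategories $\mathsf{X},\mathsf{Y}$ of $\mathsf{D}$, $\mathsf{X}*\mathsf{Y}$ is the subcategory of those $d$ for which there is a triangle $x\to d\to y\to\Sigma x$ with $x\in\mathsf{X}$, $y\in\mathsf{Y}$; $\mathsf{X}$ is extension-closed if $\mathsf{X}*\mathsf{X}=\mathsf{X}$, and $\langle\mathsf{X}\rangle$ is the smallest extension-closed subcategory containing $\mathsf{X}$. $\mathrm{Hom}(\mathsf{X},d)=0$ means $\mathrm{Hom}(x,d)=0$ for all $x\in\mathsf{X}$, and similarly for $\mathrm{Hom}(d,\mathsf{X})=0$. A collection of objects $\mathsf{S}$ (closed under isomorphism) is $w$-orthogonal if (1) $\dim\mathrm{Hom}(x,y)=\delta_{xy}$ for all $x,y\in\mathsf{S}$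 (objects up to isomorphism), and (2) if $w\ge2$, $\mathrm{Hom}(\Sigma^k x,y)=0$ for $1\le k\le w-1$ and $x,y\in\mathsf{S}$. A Serre functor on a $\mathbf{k}$-linear Hom-finite category is an autoequivalence $\mathbb{S}$ with isomorphisms $\mathrm{Hom}(x,y)\simeq D\mathrm{Hom}(y,\mathbb{S}x)$ natural in $x,y$, where $D$ is vector space duality. For $m\in\mathbb{Z}$, a triangulated category with shift $\Sigma$ and Serre functor $\mathbb{S}$ is $m$-Calabi-Yau if there is a natural isomorphism $\mathbb{S}\simeq\Sigma^m$. A right $\mathsf{X}$-approximation of $d$ is a morphism $x\to d$ with $x\in\mathsf{X}$ through which every morphism from an object of $\mathsf{X}$ to $d$ factors; a morphism $f\colon x\to d$ is right minimal if every $g\colon x\to x$ with $fg=f$ is an automorphism. Left approximations and left minimality are dual. $\mathsf{X}$ is functorially finite if every object of $\mathsf{D}$ has a right and a left $\mathsf{X}$-approximation. Structure on $\mathsf{Z}$. For each $x\in\mathsf{Z}$ fix a triangle $s_x\xrightarrow{\alpha_x}\Sigma x\xrightarrow{\beta_x}x\langle1\rangle\to\Sigma s_x$ in $\mathsf{D}$ with $\alpha_x$ a minimal right $\langle\mathsf{S}\rangle$-approximation; here $x\langle1\rangle\in\mathsf{Z}$. For $f\colon x\to x'$ in $\mathsf{Z}$, $f\langle1\rangle\colon x\langle1\rangle\to x'\langle1\rangle$ is the unique morphism with $f\langle1\rangle\,\beta_x=\beta_{x'}\,(\Sigma f)$. This is an autoequivalence of $\mathsf{Z}$; its quasi-inverse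 $\langle-1\rangle$ is given on objects by triangles $y\langle-1\rangle\to\Sigma^{-1}y\xrightarrow{\alpha^y}s^y\to\Sigma (y\langle-1\rangle)$ with $\alpha^y$ a minimal left $\langle\mathsf{S}\rangle$-approximation. For $f\colon x\to y$ in $\mathsf{Z}$ take a triangle $x\xrightarrow{f}y\xrightarrow{g_1}c_f\xrightarrow{h_1}\Sigma x$ in $\mathsf{D}$ and a triangle $s_f\xrightarrow{\alpha_f}c_f\xrightarrow{\beta_f}z_f\to\Sigma s_f$ in $\mathsf{D}$ with $\alpha_f$ a minimal right $\langle\mathsf{S}\rangle$-approximation; here $z_f\in\mathsf{Z}$. Put $g=\beta_fg_1$ and let $h\colon z_f\to x\langle1\rangle$ be the unique morphism with $h\beta_f=\beta_xh_1$. The diagrams $x\xrightarrow{f}y\xrightarrow{g}z_f\xrightarrow{h}x\langle1\rangle$ are the standard triangles, and $\Delta$ is the class of all diagrams $x\to y\to z\to x\langle1\rangle$ in $\mathsf{Z}$ isomorphic to a standard triangle. With this structure $\mathsf{Z}$ is a triangulated category. *)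

theory Defs
  imports "HOL-Computational_Algebra.Computational_Algebra" "HOL-Library.FuncSet"
begin

section \<open>Linear categories\<close>

text \<open>
  The Hom-spaces are subspaces of one ambient vector space \<open>'m\<close>. This is no restriction: given any
  linear category, take for \<open>'m\<close> the direct sum of all its Hom-spaces. Different Hom-spaces are not
  required to be disjoint (they share at least the zero vector), so a morphism does not determine
  its source and target, and notions depending on these take them as arguments.
\<close>

record ('k, 'o, 'm) linear_cat =
  smul :: "'k \<Rightarrow> 'm \<Rightarrow> 'm"
  Obj :: "'o set"
  hom :: "'o \<Rightarrow> 'o \<Rightarrow> 'm set"
  cmp :: "'m \<Rightarrow> 'm \<Rightarrow> 'm" (infixl "\<cdot>\<index>" 70)
  ident :: "'o \<Rightarrow> 'm"

locale linear_category = vector_space "smul C"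
  for C :: "('k::field, 'o, 'm::ab_group_add, 'z) linear_cat_scheme" (structure) +
  assumes subspace_hom:
      "\<lbrakk>x \<in> Obj C; y \<in> Obj C\<rbrakk> \<Longrightarrow> module.subspace (smul C) (hom C x y)"
    and ident_hom: "x \<in> Obj C \<Longrightarrow> ident C x \<in> hom C x x"
    and cmp_hom:
      "\<lbrakk>x \<in> Obj C; y \<in> Obj C; z \<in> Obj C; f \<in> hom C x y; g \<in> hom C y z\<rbrakk> \<Longrightarrow> g \<cdot> f \<in> hom C x z"
    and cmp_ident: "\<lbrakk>x \<in> Obj C; y \<in> Obj C; f \<in> hom C x y\<rbrakk> \<Longrightarrow> f \<cdot> ident C x = f"
    and ident_cmp: "\<lbrakk>x \<in> Obj C; y \<in> Obj C; f \<in> hom C x y\<rbrakk> \<Longrightarrow> ident C y \<cdot> f = f"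
    and cmp_assoc:
      "\<lbrakk>x \<in> Obj C; y \<in> Obj C; z \<in> Obj C; u \<in> Obj C; f \<in> hom C x y; g \<in> hom C y z; h \<in> hom C z u\<rbrakk>
        \<Longrightarrow> (h \<cdot> g) \<cdot> f = h \<cdot> (g \<cdot> f)"
    and cmp_add_left:
      "\<lbrakk>x \<in> Obj C; y \<in> Obj C; z \<in> Obj C; f \<in> hom C x y; g \<in> hom C y z; g' \<in> hom C y z\<rbrakk>
        \<Longrightarrow> (g + g') \<cdot> f = g \<cdot> f + g' \<cdot> f"
    and cmp_add_right:
      "\<lbrakk>x \<in> Obj C; y \<in> Obj C; z \<in> Obj C; f \<in> hom C x y; f' \<in> hom C x y; g \<in> hom C y z\<rbrakk>
        \<Longrightarrow> g \<cdot> (f + f') = g \<cdot> f + g \<cdot> f'"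
    and cmp_smul_left:
      "\<lbrakk>x \<in> Obj C; y \<in> Obj C; z \<in> Obj C; f \<in> hom C x y; g \<in> hom C y z\<rbrakk>
        \<Longrightarrow> smul C a g \<cdot> f = smul C a (g \<cdot> f)"
    and cmp_smul_right:
      "\<lbrakk>x \<in> Obj C; y \<in> Obj C; z \<in> Obj C; f \<in> hom C x y; g \<in> hom C y z\<rbrakk>
        \<Longrightarrow> g \<cdot> smul C a f = smul C a (g \<cdot> f)"

definition hom_finite :: "('k::field, 'o, 'm::ab_group_add, 'z) linear_cat_scheme \<Rightarrow> bool" where
  "hom_finite C \<longleftrightarrow>
    (\<forall>x\<in>Obj C. \<forall>y\<in>Obj C. \<exists>B. finite B \<and> hom C x y = module.span (smul C) B)"

definition is_iso ::
  "('k, 'o, 'm, 'z) linear_cat_scheme \<Rightarrow> 'o \<Rightarrow> 'o \<Rightarrow> 'm \<Rightarrow> bool" where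
  "is_iso C x y f \<longleftrightarrow> f \<in> hom C x y \<and>
    (\<exists>g\<in>hom C y x. g \<cdot>\<^bsub>C\<^esub> f = ident C x \<and> f \<cdot>\<^bsub>C\<^esub> g = ident C y)"

definition isomorphic :: "('k, 'o, 'm, 'z) linear_cat_scheme \<Rightarrow> 'o \<Rightarrow> 'o \<Rightarrow> bool" where
  "isomorphic C x y \<longleftrightarrow> (\<exists>f. is_iso C x y f)"

definition zero_object :: "('k, 'o, 'm::zero, 'z) linear_cat_scheme \<Rightarrow> 'o \<Rightarrow> bool" where
  "zero_object C x \<longleftrightarrow> x \<in> Obj C \<and> ident C x = 0"

definition direct_sum ::
  "('k, 'o, 'm::ab_group_add, 'z) linear_cat_scheme \<Rightarrow> 'o list \<Rightarrow> 'o \<Rightarrow> bool" where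
  "direct_sum C xs d \<longleftrightarrow> (\<exists>i p.
    (\<forall>k<length xs. i k \<in> hom C (xs ! k) d \<and> p k \<in> hom C d (xs ! k)) \<and>
    (\<forall>k<length xs. \<forall>l<length xs. p l \<cdot>\<^bsub>C\<^esub> i k = (if k = l then ident C (xs ! k) else 0)) \<and>
    (\<Sum>k<length xs. i k \<cdot>\<^bsub>C\<^esub> p k) = ident C d)"

text \<open>The endomorphism ring of \<open>x\<close> is local: it is nonzero and its non-units are closed under sums.\<close>

definition local_end :: "('k, 'o, 'm::ab_group_add, 'z) linear_cat_scheme \<Rightarrow> 'o \<Rightarrow> bool" where
  "local_end C x \<longleftrightarrow> ident C x \<noteq> 0 \<and>
    (\<forall>f\<in>hom C x x. \<forall>g\<in>hom C x x.
      is_iso C x x (f + g) \<longrightarrow> is_iso C x x f \<or> is_iso C x x g)"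

definition krull_schmidt :: "('k, 'o, 'm::ab_group_add, 'z) linear_cat_scheme \<Rightarrow> bool" where
  "krull_schmidt C \<longleftrightarrow> (\<forall>d\<in>Obj C. \<exists>xs.
    set xs \<subseteq> Obj C \<and> (\<forall>x\<in>set xs. local_end C x) \<and> direct_sum C xs d)"


section \<open>Functors\<close>

text \<open>\<open>fmap F x y\<close> is the action of the functor on \<open>hom x y\<close>.\<close>

record ('o, 'm) endofun =
  fobj :: "'o \<Rightarrow> 'o"
  fmap :: "'o \<Rightarrow> 'o \<Rightarrow> 'm \<Rightarrow> 'm"

definition linear_functor ::
  "('k, 'o, 'm::ab_group_add, 'z) linear_cat_scheme \<Rightarrow> ('o, 'm) endofun \<Rightarrow> bool" where
  "linear_functor C F \<longleftrightarrow>
    (\<forall>x\<in>Obj C. fobj F x \<in> Obj C \<and> fmap F x x (ident C x) = ident C (fobj F x)) \<and>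
    (\<forall>x\<in>Obj C. \<forall>y\<in>Obj C. \<forall>f\<in>hom C x y.
      fmap F x y f \<in> hom C (fobj F x) (fobj F y) \<and>
      (\<forall>g\<in>hom C x y. fmap F x y (f + g) = fmap F x y f + fmap F x y g) \<and>
      (\<forall>a. fmap F x y (smul C a f) = smul C a (fmap F x y f))) \<and>
    (\<forall>x\<in>Obj C. \<forall>y\<in>Obj C. \<forall>z\<in>Obj C. \<forall>f\<in>hom C x y. \<forall>g\<in>hom C y z.
      fmap F x z (g \<cdot>\<^bsub>C\<^esub> f) = fmap F y z g \<cdot>\<^bsub>C\<^esub> fmap F x y f)"

definition naturally_isomorphic ::
  "('k, 'o, 'm, 'z) linear_cat_scheme \<Rightarrow> ('o, 'm) endofun \<Rightarrow> ('o, 'm) endofun \<Rightarrow> bool" where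
  "naturally_isomorphic C F G \<longleftrightarrow> (\<exists>\<eta>.
    (\<forall>x\<in>Obj C. is_iso C (fobj F x) (fobj G x) (\<eta> x)) \<and>
    (\<forall>x\<in>Obj C. \<forall>y\<in>Obj C. \<forall>f\<in>hom C x y. \<eta> y \<cdot>\<^bsub>C\<^esub> fmap F x y f = fmap G x y f \<cdot>\<^bsub>C\<^esub> \<eta> x))"

definition id_functor :: "('o, 'm) endofun" where
  "id_functor = \<lparr>fobj = \<lambda>x. x, fmap = \<lambda>x y f. f\<rparr>"

definition comp_functor ::
  "('o, 'm) endofun \<Rightarrow> ('o, 'm) endofun \<Rightarrow> ('o, 'm) endofun" where
  "comp_functor F G =
    \<lparr>fobj = \<lambda>x. fobj F (fobj G x), fmap = \<lambda>x y f. fmap F (fobj G x) (fobj G y) (fmap G x y f)\<rparr>"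

primrec functor_power :: "('o, 'm) endofun \<Rightarrow> nat \<Rightarrow> ('o, 'm) endofun" where
  "functor_power F 0 = id_functor"
| "functor_power F (Suc n) = comp_functor F (functor_power F n)"

definition quasi_inverse ::
  "('k, 'o, 'm::ab_group_add, 'z) linear_cat_scheme \<Rightarrow> ('o, 'm) endofun \<Rightarrow> ('o, 'm) endofun \<Rightarrow> bool"
  where
  "quasi_inverse C F G \<longleftrightarrow> linear_functor C G \<and>
    naturally_isomorphic C (comp_functor F G) id_functor \<and>
    naturally_isomorphic C (comp_functor G F) id_functor"

definition autoequivalence ::
  "('k, 'o, 'm::ab_group_add, 'z) linear_cat_scheme \<Rightarrow> ('o, 'm) endofun \<Rightarrow> bool" where
  "autoequivalence C F \<longleftrightarrow> linear_functor C F \<and> (\<exists>G. quasi_inverse C F G)"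

text \<open>
  Integral powers of an autoequivalence; negative ones use a chosen quasi-inverse, which is unique up
  to natural isomorphism.
\<close>

definition functor_int_power ::
  "('k, 'o, 'm::ab_group_add, 'z) linear_cat_scheme \<Rightarrow> ('o, 'm) endofun \<Rightarrow> int \<Rightarrow> ('o, 'm) endofun"
  where
  "functor_int_power C F m =
    (if 0 \<le> m then functor_power F (nat m)
     else functor_power (SOME G. quasi_inverse C F G) (nat (- m)))"


section \<open>Serre functors\<close>

definition dual_space ::
  "('k::field, 'o, 'm::ab_group_add, 'z) linear_cat_scheme \<Rightarrow> 'm set \<Rightarrow> ('m \<Rightarrow> 'k) set" where
  "dual_space C V = {\<phi> \<in> extensional V.
    (\<forall>u\<in>V. \<forall>v\<in>V. \<phi> (u + v) = \<phi> u + \<phi> v) \<and> (\<forall>a. \<forall>v\<in>V. \<phi> (smul C a v) = a * \<phi> v)}"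

text \<open>
  The last condition is naturality in both variables: along \<open>a : x' \<rightarrow> x\<close> and \<open>b : y \<rightarrow> y'\<close>, the map on
  \<open>Hom(x, y)\<close> is \<open>f \<mapsto> b f a\<close>, and the map on \<open>D Hom(y, S x)\<close> is precomposition with \<open>v \<mapsto> S(a) v b\<close>.
\<close>

definition serre_functor ::
  "('k::field, 'o, 'm::ab_group_add, 'z) linear_cat_scheme \<Rightarrow> ('o, 'm) endofun \<Rightarrow> bool" where
  "serre_functor C S \<longleftrightarrow> autoequivalence C S \<and> (\<exists>\<eta>.
    (\<forall>x\<in>Obj C. \<forall>y\<in>Obj C.
      bij_betw (\<eta> x y) (hom C x y) (dual_space C (hom C y (fobj S x))) \<and>
      (\<forall>f\<in>hom C x y. \<forall>v\<in>hom C y (fobj S x).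
        (\<forall>g\<in>hom C x y. \<eta> x y (f + g) v = \<eta> x y f v + \<eta> x y g v) \<and>
        (\<forall>a. \<eta> x y (smul C a f) v = a * \<eta> x y f v))) \<and>
    (\<forall>x\<in>Obj C. \<forall>x'\<in>Obj C. \<forall>y\<in>Obj C. \<forall>y'\<in>Obj C.
      \<forall>a\<in>hom C x' x. \<forall>f\<in>hom C x y. \<forall>b\<in>hom C y y'. \<forall>v\<in>hom C y' (fobj S x').
        \<eta> x' y' (b \<cdot>\<^bsub>C\<^esub> f \<cdot>\<^bsub>C\<^esub> a) v = \<eta> x y f (fmap S x' x a \<cdot>\<^bsub>C\<^esub> v \<cdot>\<^bsub>C\<^esub> b)))"


section \<open>Triangulated categories\<close>

text \<open>
  \<open>dtri C x y z f g h\<close>: the diagram \<open>x \<rightarrow> y \<rightarrow> z \<rightarrow> \<Sigma>x\<close> with morphisms \<open>f, g, h\<close> is a distinguished triangle.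
\<close>

record ('k, 'o, 'm) tri_cat = "('k, 'o, 'm) linear_cat" +
  shift :: "('o, 'm) endofun"
  dtri :: "'o \<Rightarrow> 'o \<Rightarrow> 'o \<Rightarrow> 'm \<Rightarrow> 'm \<Rightarrow> 'm \<Rightarrow> bool"

abbreviation shiftpow ::
  "('k, 'o, 'm::ab_group_add, 'z) tri_cat_scheme \<Rightarrow> int \<Rightarrow> ('o, 'm) endofun" where
  "shiftpow T m \<equiv> functor_int_power T (shift T) m"

text \<open>Isomorphism of diagrams \<open>x \<rightarrow> y \<rightarrow> z \<rightarrow> F x\<close>.\<close>

definition triangle_iso ::
  "('k, 'o, 'm, 'z) linear_cat_scheme \<Rightarrow> ('o, 'm) endofun \<Rightarrow>
    'o \<Rightarrow> 'o \<Rightarrow> 'o \<Rightarrow> 'm \<Rightarrow> 'm \<Rightarrow> 'm \<Rightarrow> 'o \<Rightarrow> 'o \<Rightarrow> 'o \<Rightarrow> 'm \<Rightarrow> 'm \<Rightarrow> 'm \<Rightarrow> bool" where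
  "triangle_iso C F x y z f g h x' y' z' f' g' h' \<longleftrightarrow> (\<exists>a b c.
    is_iso C x x' a \<and> is_iso C y y' b \<and> is_iso C z z' c \<and>
    b \<cdot>\<^bsub>C\<^esub> f = f' \<cdot>\<^bsub>C\<^esub> a \<and> c \<cdot>\<^bsub>C\<^esub> g = g' \<cdot>\<^bsub>C\<^esub> b \<and> fmap F x x' a \<cdot>\<^bsub>C\<^esub> h = h' \<cdot>\<^bsub>C\<^esub> c)"

locale triangulated_category = linear_category T
  for T :: "('k::field, 'o, 'm::ab_group_add, 'z) tri_cat_scheme" (structure) +
  assumes direct_sums: "set xs \<subseteq> Obj T \<Longrightarrow> \<exists>d\<in>Obj T. direct_sum T xs d"
    and shift_autoequivalence: "autoequivalence T (shift T)"
    and dtri_typed: "dtri T x y z f g h \<Longrightarrow>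
      x \<in> Obj T \<and> y \<in> Obj T \<and> z \<in> Obj T \<and>
      f \<in> hom T x y \<and> g \<in> hom T y z \<and> h \<in> hom T z (fobj (shift T) x)"
    and dtri_iso:
      "\<lbrakk>dtri T x y z f g h; x' \<in> Obj T; y' \<in> Obj T; z' \<in> Obj T;
        f' \<in> hom T x' y'; g' \<in> hom T y' z'; h' \<in> hom T z' (fobj (shift T) x');
        triangle_iso T (shift T) x y z f g h x' y' z' f' g' h'\<rbrakk>
        \<Longrightarrow> dtri T x' y' z' f' g' h'"
    and dtri_ident: "\<lbrakk>x \<in> Obj T; zero_object T z\<rbrakk> \<Longrightarrow> dtri T x x z (ident T x) 0 0"
    and dtri_complete:
      "\<lbrakk>x \<in> Obj T; y \<in> Obj T; f \<in> hom T x y\<rbrakk> \<Longrightarrow> \<exists>z g h. dtri T x y z f g h"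
    and dtri_rotate:
      "\<lbrakk>x \<in> Obj T; y \<in> Obj T; z \<in> Obj T;
        f \<in> hom T x y; g \<in> hom T y z; h \<in> hom T z (fobj (shift T) x)\<rbrakk>
        \<Longrightarrow> dtri T x y z f g h \<longleftrightarrow>
            dtri T y z (fobj (shift T) x) g h (- fmap (shift T) x y f)"
    and dtri_morphism:
      "\<lbrakk>dtri T x y z f g h; dtri T x' y' z' f' g' h';
        a \<in> hom T x x'; b \<in> hom T y y'; b \<cdot> f = f' \<cdot> a\<rbrakk>
        \<Longrightarrow> \<exists>c\<in>hom T z z'. c \<cdot> g = g' \<cdot> b \<and> fmap (shift T) x x' a \<cdot> h = h' \<cdot> c"
    and octahedral:
      "\<lbrakk>dtri T x y z' f i i'; dtri T y z x' g j j'; dtri T x z y' (g \<cdot> f) k k'\<rbrakk>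
        \<Longrightarrow> \<exists>u v. dtri T z' y' x' u v (fmap (shift T) y z' i \<cdot> j') \<and>
              u \<cdot> i = k \<cdot> g \<and> k' \<cdot> u = i' \<and> v \<cdot> k = j \<and> j' \<cdot> v = fmap (shift T) x y f \<cdot> k'"

text \<open>
  Being \<open>m\<close>-Calabi-Yau relates the Serre functor to \<open>\<Sigma>\<^sup>m\<close> as plain functors; it imposes no compatibility
  with the class of distinguished triangles. Requiring \<open>\<Sigma>\<close> to be an autoequivalence makes \<open>\<Sigma>\<^sup>m\<close>
  meaningful for negative \<open>m\<close>.
\<close>

definition calabi_yau ::
  "('k::field, 'o, 'm::ab_group_add, 'z) tri_cat_scheme \<Rightarrow> int \<Rightarrow> bool" where
  "calabi_yau T m \<longleftrightarrow>
    linear_category T \<and> hom_finite T \<and> autoequivalence T (shift T) \<and>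
    (\<exists>S. serre_functor T S \<and> naturally_isomorphic T S (shiftpow T m))"


section \<open>Extension closures and approximations\<close>

definition strict_subcat :: "('k, 'o, 'm, 'z) linear_cat_scheme \<Rightarrow> 'o set \<Rightarrow> bool" where
  "strict_subcat C X \<longleftrightarrow> X \<subseteq> Obj C \<and> (\<forall>x\<in>X. \<forall>y\<in>Obj C. isomorphic C x y \<longrightarrow> y \<in> X)"

definition star ::
  "('k, 'o, 'm, 'z) tri_cat_scheme \<Rightarrow> 'o set \<Rightarrow> 'o set \<Rightarrow> 'o set" where
  "star T X Y = {d \<in> Obj T. \<exists>x\<in>X. \<exists>y\<in>Y. \<exists>f g h. dtri T x d y f g h}"

text \<open>
  Extension-closed subcategories are understood to contain the zero objects. Without this, families
  satisfying \<open>X * X = X\<close> need not be closed under intersection, and a smallest one need not exist.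
\<close>

definition extension_closed ::
  "('k, 'o, 'm::zero, 'z) tri_cat_scheme \<Rightarrow> 'o set \<Rightarrow> bool" where
  "extension_closed T X \<longleftrightarrow>
    strict_subcat T X \<and> {x. zero_object T x} \<subseteq> X \<and> star T X X = X"

definition extension_closure ::
  "('k, 'o, 'm::zero, 'z) tri_cat_scheme \<Rightarrow> 'o set \<Rightarrow> 'o set" where
  "extension_closure T X = \<Inter>{Y. extension_closed T Y \<and> X \<subseteq> Y}"

definition right_approx ::
  "('k, 'o, 'm, 'z) linear_cat_scheme \<Rightarrow> 'o set \<Rightarrow> 'o \<Rightarrow> 'o \<Rightarrow> 'm \<Rightarrow> bool" where
  "right_approx C X x d f \<longleftrightarrow> x \<in> X \<and> f \<in> hom C x d \<and>
    (\<forall>x'\<in>X. \<forall>f'\<in>hom C x' d. \<exists>g\<in>hom C x' x. f \<cdot>\<^bsub>C\<^esub> g = f')"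

definition left_approx ::
  "('k, 'o, 'm, 'z) linear_cat_scheme \<Rightarrow> 'o set \<Rightarrow> 'o \<Rightarrow> 'o \<Rightarrow> 'm \<Rightarrow> bool" where
  "left_approx C X d x f \<longleftrightarrow> x \<in> X \<and> f \<in> hom C d x \<and>
    (\<forall>x'\<in>X. \<forall>f'\<in>hom C d x'. \<exists>g\<in>hom C x x'. g \<cdot>\<^bsub>C\<^esub> f = f')"

definition right_minimal ::
  "('k, 'o, 'm, 'z) linear_cat_scheme \<Rightarrow> 'o \<Rightarrow> 'm \<Rightarrow> bool" where
  "right_minimal C x f \<longleftrightarrow> (\<forall>g\<in>hom C x x. f \<cdot>\<^bsub>C\<^esub> g = f \<longrightarrow> is_iso C x x g)"

definition min_right_approx ::
  "('k, 'o, 'm, 'z) linear_cat_scheme \<Rightarrow> 'o set \<Rightarrow> 'o \<Rightarrow> 'o \<Rightarrow> 'm \<Rightarrow> bool" where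
  "min_right_approx C X x d f \<longleftrightarrow> right_approx C X x d f \<and> right_minimal C x f"

definition functorially_finite ::
  "('k, 'o, 'm, 'z) linear_cat_scheme \<Rightarrow> 'o set \<Rightarrow> bool" where
  "functorially_finite C X \<longleftrightarrow>
    (\<forall>d\<in>Obj C. (\<exists>x f. right_approx C X x d f) \<and> (\<exists>x f. left_approx C X d x f))"


section \<open>Orthogonal collections and the reduction\<close>

definition orthogonal_collection ::
  "('k::field, 'o, 'm::ab_group_add, 'z) tri_cat_scheme \<Rightarrow> nat \<Rightarrow> 'o set \<Rightarrow> bool" where
  "orthogonal_collection T w S \<longleftrightarrow> strict_subcat T S \<and>
    (\<forall>x\<in>S. \<forall>y\<in>S.
      vector_space.dim (smul T) (hom T x y) = (if isomorphic T x y then 1 else 0)) \<and>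
    (2 \<le> w \<longrightarrow> (\<forall>k\<in>{1..w - 1}. \<forall>x\<in>S. \<forall>y\<in>S. hom T (fobj (shiftpow T (int k)) x) y = {0}))"

definition perp_subcat ::
  "('k, 'o, 'm::ab_group_add, 'z) tri_cat_scheme \<Rightarrow> nat \<Rightarrow> 'o set \<Rightarrow> 'o set" where
  "perp_subcat T w S = {d \<in> Obj T. \<forall>i\<in>{0..w - 1}. \<forall>s\<in>S.
    hom T (fobj (shiftpow T (int i)) s) d = {0} \<and>
    hom T d (fobj (shiftpow T (- int i)) s) = {0}}"

text \<open>
  The chosen triangles \<open>s\<^sub>x \<rightarrow> \<Sigma>x \<rightarrow> x\<langle>1\<rangle> \<rightarrow> \<Sigma>s\<^sub>x\<close>, one for each \<open>x\<close>: \<open>apx x = s\<^sub>x\<close>, \<open>alp x\<close>, \<open>bet x\<close> and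
  \<open>gam x\<close> are the three morphisms, and \<open>ang x = x\<langle>1\<rangle>\<close>.
\<close>

record ('o, 'm) shift_choice =
  apx :: "'o \<Rightarrow> 'o"
  ang :: "'o \<Rightarrow> 'o"
  alp :: "'o \<Rightarrow> 'm"
  bet :: "'o \<Rightarrow> 'm"
  gam :: "'o \<Rightarrow> 'm"

definition valid_choice ::
  "('k, 'o, 'm::ab_group_add, 'z) tri_cat_scheme \<Rightarrow> nat \<Rightarrow> 'o set \<Rightarrow> ('o, 'm) shift_choice \<Rightarrow> bool"
  where
  "valid_choice T w S ch \<longleftrightarrow> (\<forall>x\<in>perp_subcat T w S.
    dtri T (apx ch x) (fobj (shift T) x) (ang ch x) (alp ch x) (bet ch x) (gam ch x) \<and>
    min_right_approx T (extension_closure T S) (apx ch x) (fobj (shift T) x) (alp ch x))"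

definition reduced_shift ::
  "('k, 'o, 'm, 'z) tri_cat_scheme \<Rightarrow> ('o, 'm) shift_choice \<Rightarrow> ('o, 'm) endofun" where
  "reduced_shift T ch =
    \<lparr>fobj = ang ch,
     fmap = \<lambda>x x' f. THE f1. f1 \<in> hom T (ang ch x) (ang ch x') \<and>
       f1 \<cdot>\<^bsub>T\<^esub> bet ch x = bet ch x' \<cdot>\<^bsub>T\<^esub> fmap (shift T) x x' f\<rparr>"

definition standard_triangle ::
  "('k, 'o, 'm::ab_group_add, 'z) tri_cat_scheme \<Rightarrow> nat \<Rightarrow> 'o set \<Rightarrow> ('o, 'm) shift_choice \<Rightarrow>
    'o \<Rightarrow> 'o \<Rightarrow> 'o \<Rightarrow> 'm \<Rightarrow> 'm \<Rightarrow> 'm \<Rightarrow> bool" where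
  "standard_triangle T w S ch x y z f g h \<longleftrightarrow>
    x \<in> perp_subcat T w S \<and> y \<in> perp_subcat T w S \<and> f \<in> hom T x y \<and>
    (\<exists>c g1 h1 s \<alpha> \<beta> \<gamma>.
      dtri T x y c f g1 h1 \<and>
      dtri T s c z \<alpha> \<beta> \<gamma> \<and> min_right_approx T (extension_closure T S) s c \<alpha> \<and>
      g = \<beta> \<cdot>\<^bsub>T\<^esub> g1 \<and>
      h \<in> hom T z (ang ch x) \<and> h \<cdot>\<^bsub>T\<^esub> \<beta> = bet ch x \<cdot>\<^bsub>T\<^esub> h1)"

definition reduced_dtri ::
  "('k, 'o, 'm::ab_group_add, 'z) tri_cat_scheme \<Rightarrow> nat \<Rightarrow> 'o set \<Rightarrow> ('o, 'm) shift_choice \<Rightarrow>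
    'o \<Rightarrow> 'o \<Rightarrow> 'o \<Rightarrow> 'm \<Rightarrow> 'm \<Rightarrow> 'm \<Rightarrow> bool" where
  "reduced_dtri T w S ch x y z f g h \<longleftrightarrow>
    x \<in> perp_subcat T w S \<and> y \<in> perp_subcat T w S \<and> z \<in> perp_subcat T w S \<and>
    f \<in> hom T x y \<and> g \<in> hom T y z \<and> h \<in> hom T z (ang ch x) \<and>
    (\<exists>x' y' z' f' g' h'. standard_triangle T w S ch x' y' z' f' g' h' \<and>
      triangle_iso T (reduced_shift T ch) x y z f g h x' y' z' f' g' h')"

text \<open>The full subcategory on \<open>perp_subcat T w S\<close> with shift \<open>\<langle>1\<rangle>\<close> and triangles \<open>\<Delta>\<close>.\<close>

definition reduction ::
  "('k, 'o, 'm::ab_group_add) tri_cat \<Rightarrow> nat \<Rightarrow> 'o set \<Rightarrow> ('o, 'm) shift_choice \<Rightarrow>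
    ('k, 'o, 'm) tri_cat" where
  "reduction T w S ch =
    T\<lparr>Obj := perp_subcat T w S, shift := reduced_shift T ch, dtri := reduced_dtri T w S ch\<rparr>"

end

theory Submission
  imports Defs
begin

text \<open>
  Write \<open>x\<langle>1\<rangle>\<close> for the reduced shift. By hypothesis \<open>\<Sigma>\<^sup>-\<^sup>w\<close> is a Serre functor of the ambient category; the
  point is to replace it by \<open>\<langle>-w\<rangle>\<close> as long as one only tests against objects of \<open>Z\<close>.

  Serre duality turns each vanishing condition \<open>Hom(z, s) = 0\<close> into \<open>Hom(\<Sigma>\<^sup>w s, z) = 0\<close>. So the range
  \<open>0, \<dots>, w - 1\<close> of shifts in the definition of \<open>Z\<close> extends to \<open>0, \<dots>, w\<close>, and either half of the
  definition implies the other (\<open>Z_vanish\<close>, \<open>Z_from\<close>, \<open>Z_to\<close>).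

  Rotate the triangle \<open>s \<rightarrow> \<Sigma>(y\<langle>-1\<rangle>) \<rightarrow> y \<rightarrow> \<Sigma>s\<close> that belongs to \<open>x = y\<langle>-1\<rangle>\<close>. It gives a natural map
  \<open>y\<langle>-1\<rangle> \<rightarrow> \<Sigma>\<^sup>-\<^sup>1y\<close> with cone \<open>s\<close> in the extension closure of \<open>S\<close>. By the extended vanishing range
  \<open>Hom(\<Sigma>\<^sup>jz, -)\<close> makes this map bijective for all \<open>z \<in> Z\<close> and \<open>0 \<le> j < w\<close> (\<open>comparison_exists\<close>), and \<open>w\<close>
  such maps compose to a natural map \<open>x\<langle>-w\<rangle> \<rightarrow> \<Sigma>\<^sup>-\<^sup>wx\<close> which \<open>Hom(z, -)\<close> makes bijective
  (\<open>power_comparison_exists\<close>). Hence the duality pairing of \<open>Hom(x, y)\<close> with \<open>Hom(y, \<Sigma>\<^sup>-\<^sup>wx)\<close> pulls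
  back to a perfect natural pairing with \<open>Hom(y, x\<langle>-w\<rangle>)\<close>, which is Serre duality for \<open>Z\<close>
  (\<open>serre_functor_reduction\<close>).

  It remains that \<open>\<langle>1\<rangle>\<close> is an autoequivalence of \<open>Z\<close>. It is a functor because \<open>\<Sigma>x \<rightarrow> x\<langle>1\<rangle>\<close> is
  universal among maps from \<open>\<Sigma>x\<close> to objects of \<open>Z\<close>, and fully faithful because moreover \<open>Hom(\<Sigma>x, -)\<close>
  makes \<open>\<Sigma>y \<rightarrow> y\<langle>1\<rangle>\<close> bijective. That it takes values in \<open>Z\<close> (\<open>ang_Z\<close>) and is
  essentially surjective (\<open>Z_is_cone\<close>) comes from a sharpening of the approximation property: the minimal
  right approximation \<open>s \<rightarrow> \<Sigma>x\<close> induces bijections on \<open>Hom(t, -)\<close>, and a left approximation \<open>\<Sigma>\<^sup>-\<^sup>1y \<rightarrow> s\<close> of minimal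
  length induces bijections on \<open>Hom(-, t)\<close>, for all \<open>t\<close> in the extension closure. Surjectivity is the
  definition. Injectivity holds because the objects of \<open>S\<close> behave like simple objects: a nonzero map
  from such an object to one of the extension closure has its cone in the extension closure, and a
  nonzero map in the other direction its cocone (\<open>nonzero_from_simple_cone\<close>,
  \<open>nonzero_to_simple_cocone\<close>). An approximation killed by such a map would factor through a smaller
  object, contradicting minimality.
\<close>


section \<open>Linear categories\<close>

text \<open>
  Since Hom-spaces may overlap, source and target have to accompany a morphism; this predicate bundles
  them, so that typing premises are discharged by composing rules.
\<close>

definition arrow :: "('k, 'o, 'm, 'z) linear_cat_scheme \<Rightarrow> 'm \<Rightarrow> 'o \<Rightarrow> 'o \<Rightarrow> bool"
  ("\<guillemotleft>_ : _ \<rightarrow> _\<guillemotright>\<index>") where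
  "arrow C f x y \<longleftrightarrow> x \<in> Obj C \<and> y \<in> Obj C \<and> f \<in> hom C x y"

context linear_category
begin

lemma arrI: "\<lbrakk>f \<in> hom C x y; x \<in> Obj C; y \<in> Obj C\<rbrakk> \<Longrightarrow> \<guillemotleft>f : x \<rightarrow> y\<guillemotright>"
  and arr_src: "\<guillemotleft>f : x \<rightarrow> y\<guillemotright> \<Longrightarrow> x \<in> Obj C"
  and arr_tgt: "\<guillemotleft>f : x \<rightarrow> y\<guillemotright> \<Longrightarrow> y \<in> Obj C"
  and arr_hom: "\<guillemotleft>f : x \<rightarrow> y\<guillemotright> \<Longrightarrow> f \<in> hom C x y"
  by (auto simp: arrow_def)

lemma arr_comp: "\<lbrakk>\<guillemotleft>g : y \<rightarrow> z\<guillemotright>; \<guillemotleft>f : x \<rightarrow> y\<guillemotright>\<rbrakk> \<Longrightarrow> \<guillemotleft>g \<cdot> f : x \<rightarrow> z\<guillemotright>"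
  using cmp_hom by (auto simp: arrow_def)

lemma arr_ident: "x \<in> Obj C \<Longrightarrow> \<guillemotleft>ident C x : x \<rightarrow> x\<guillemotright>"
  by (simp add: arrow_def ident_hom)

lemma comp_ident: "\<guillemotleft>f : x \<rightarrow> y\<guillemotright> \<Longrightarrow> f \<cdot> ident C x = f"
  and ident_comp: "\<guillemotleft>f : x \<rightarrow> y\<guillemotright> \<Longrightarrow> ident C y \<cdot> f = f"
  using cmp_ident ident_cmp by (auto simp: arrow_def)

lemma assoc:
  "\<lbrakk>\<guillemotleft>h : z \<rightarrow> u\<guillemotright>; \<guillemotleft>g : y \<rightarrow> z\<guillemotright>; \<guillemotleft>f : x \<rightarrow> y\<guillemotright>\<rbrakk> \<Longrightarrow> (h \<cdot> g) \<cdot> f = h \<cdot> (g \<cdot> f)"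
  using cmp_assoc by (auto simp: arrow_def)

lemma arr_zero: "\<lbrakk>x \<in> Obj C; y \<in> Obj C\<rbrakk> \<Longrightarrow> \<guillemotleft>0 : x \<rightarrow> y\<guillemotright>"
  using subspace_hom subspace_0 by (auto simp: arrow_def)

lemma arr_add: "\<lbrakk>\<guillemotleft>f : x \<rightarrow> y\<guillemotright>; \<guillemotleft>g : x \<rightarrow> y\<guillemotright>\<rbrakk> \<Longrightarrow> \<guillemotleft>f + g : x \<rightarrow> y\<guillemotright>"
  using subspace_hom subspace_add by (auto simp: arrow_def)

lemma arr_smul: "\<guillemotleft>f : x \<rightarrow> y\<guillemotright> \<Longrightarrow> \<guillemotleft>smul C a f : x \<rightarrow> y\<guillemotright>"
  using subspace_hom subspace_scale by (auto simp: arrow_def)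

lemma arr_neg: "\<guillemotleft>f : x \<rightarrow> y\<guillemotright> \<Longrightarrow> \<guillemotleft>- f : x \<rightarrow> y\<guillemotright>"
  using subspace_hom subspace_neg by (auto simp: arrow_def)

lemma arr_diff: "\<lbrakk>\<guillemotleft>f : x \<rightarrow> y\<guillemotright>; \<guillemotleft>g : x \<rightarrow> y\<guillemotright>\<rbrakk> \<Longrightarrow> \<guillemotleft>f - g : x \<rightarrow> y\<guillemotright>"
  using subspace_hom subspace_diff by (auto simp: arrow_def)

lemma add_comp:
  "\<lbrakk>\<guillemotleft>g : y \<rightarrow> z\<guillemotright>; \<guillemotleft>g' : y \<rightarrow> z\<guillemotright>; \<guillemotleft>f : x \<rightarrow> y\<guillemotright>\<rbrakk> \<Longrightarrow> (g + g') \<cdot> f = g \<cdot> f + g' \<cdot> f"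
  and comp_add:
  "\<lbrakk>\<guillemotleft>g : y \<rightarrow> z\<guillemotright>; \<guillemotleft>f : x \<rightarrow> y\<guillemotright>; \<guillemotleft>f' : x \<rightarrow> y\<guillemotright>\<rbrakk> \<Longrightarrow> g \<cdot> (f + f') = g \<cdot> f + g \<cdot> f'"
  using cmp_add_left cmp_add_right by (auto simp: arrow_def)

lemma smul_comp: "\<lbrakk>\<guillemotleft>g : y \<rightarrow> z\<guillemotright>; \<guillemotleft>f : x \<rightarrow> y\<guillemotright>\<rbrakk> \<Longrightarrow> smul C a g \<cdot> f = smul C a (g \<cdot> f)"
  and comp_smul: "\<lbrakk>\<guillemotleft>g : y \<rightarrow> z\<guillemotright>; \<guillemotleft>f : x \<rightarrow> y\<guillemotright>\<rbrakk> \<Longrightarrow> g \<cdot> smul C a f = smul C a (g \<cdot> f)"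
  using cmp_smul_left cmp_smul_right by (auto simp: arrow_def)

lemma zero_comp: "\<lbrakk>\<guillemotleft>f : x \<rightarrow> y\<guillemotright>; z \<in> Obj C\<rbrakk> \<Longrightarrow> 0 \<cdot> f = 0"
  using add_comp[of 0 y z 0 f x] arr_zero[of y z] arr_tgt[of f x y] by simp

lemma comp_zero: "\<lbrakk>\<guillemotleft>g : y \<rightarrow> z\<guillemotright>; x \<in> Obj C\<rbrakk> \<Longrightarrow> g \<cdot> 0 = 0"
  using comp_add[of g y z 0 x 0] arr_zero[of x y] arr_src[of g y z] by simp

lemma neg_comp: "\<lbrakk>\<guillemotleft>g : y \<rightarrow> z\<guillemotright>; \<guillemotleft>f : x \<rightarrow> y\<guillemotright>\<rbrakk> \<Longrightarrow> (- g) \<cdot> f = - (g \<cdot> f)"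
  using add_comp[of g y z "- g" f x] arr_neg[of g y z] zero_comp[of f x y z] arr_tgt[of g y z]
  by (simp add: eq_neg_iff_add_eq_0 add.commute)

lemma comp_neg: "\<lbrakk>\<guillemotleft>g : y \<rightarrow> z\<guillemotright>; \<guillemotleft>f : x \<rightarrow> y\<guillemotright>\<rbrakk> \<Longrightarrow> g \<cdot> (- f) = - (g \<cdot> f)"
  using comp_add[of g y z f x "- f"] arr_neg[of f x y] comp_zero[of g y z x] arr_src[of f x y]
  by (simp add: eq_neg_iff_add_eq_0 add.commute)

lemma diff_comp:
  "\<lbrakk>\<guillemotleft>g : y \<rightarrow> z\<guillemotright>; \<guillemotleft>g' : y \<rightarrow> z\<guillemotright>; \<guillemotleft>f : x \<rightarrow> y\<guillemotright>\<rbrakk> \<Longrightarrow> (g - g') \<cdot> f = g \<cdot> f - g' \<cdot> f"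
  using add_comp[of g y z "- g'" f x] arr_neg[of g' y z] neg_comp[of g' y z f x] by simp

lemma comp_diff:
  "\<lbrakk>\<guillemotleft>g : y \<rightarrow> z\<guillemotright>; \<guillemotleft>f : x \<rightarrow> y\<guillemotright>; \<guillemotleft>f' : x \<rightarrow> y\<guillemotright>\<rbrakk> \<Longrightarrow> g \<cdot> (f - f') = g \<cdot> f - g \<cdot> f'"
  using comp_add[of g y z f x "- f'"] arr_neg[of f' x y] comp_neg[of g y z f' x] by simp

lemma vanishI: "\<lbrakk>x \<in> Obj C; y \<in> Obj C; \<And>f. \<guillemotleft>f : x \<rightarrow> y\<guillemotright> \<Longrightarrow> f = 0\<rbrakk> \<Longrightarrow> hom C x y = {0}"
  using arr_zero[of x y] by (auto simp: arrow_def)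

lemma vanishD: "\<lbrakk>hom C x y = {0}; \<guillemotleft>f : x \<rightarrow> y\<guillemotright>\<rbrakk> \<Longrightarrow> f = 0"
  by (auto simp: arrow_def)

lemma isoI:
  "\<lbrakk>\<guillemotleft>f : x \<rightarrow> y\<guillemotright>; \<guillemotleft>g : y \<rightarrow> x\<guillemotright>; g \<cdot> f = ident C x; f \<cdot> g = ident C y\<rbrakk> \<Longrightarrow> is_iso C x y f"
  by (auto simp: arrow_def is_iso_def)

lemma isoE:
  assumes "is_iso C x y f" "x \<in> Obj C" "y \<in> Obj C"
  obtains g where "\<guillemotleft>f : x \<rightarrow> y\<guillemotright>" "\<guillemotleft>g : y \<rightarrow> x\<guillemotright>" "g \<cdot> f = ident C x" "f \<cdot> g = ident C y"
    "is_iso C y x g"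
  using assms by (auto simp: arrow_def is_iso_def)

lemma iso_arr: "\<lbrakk>is_iso C x y f; x \<in> Obj C; y \<in> Obj C\<rbrakk> \<Longrightarrow> \<guillemotleft>f : x \<rightarrow> y\<guillemotright>"
  by (simp add: arrow_def is_iso_def)

lemma iso_ident: "x \<in> Obj C \<Longrightarrow> is_iso C x x (ident C x)"
  using isoI arr_ident comp_ident by blast

lemma cancel_left:
  "\<lbrakk>\<guillemotleft>g : y \<rightarrow> x\<guillemotright>; \<guillemotleft>f : x \<rightarrow> y\<guillemotright>; g \<cdot> f = ident C x; \<guillemotleft>a : u \<rightarrow> x\<guillemotright>\<rbrakk> \<Longrightarrow> g \<cdot> (f \<cdot> a) = a"
  using assoc[of g y x f x a u] ident_comp[of a u x] by simp

lemma cancel_right: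
  "\<lbrakk>\<guillemotleft>g : y \<rightarrow> x\<guillemotright>; \<guillemotleft>f : x \<rightarrow> y\<guillemotright>; g \<cdot> f = ident C x; \<guillemotleft>a : x \<rightarrow> u\<guillemotright>\<rbrakk> \<Longrightarrow> (a \<cdot> g) \<cdot> f = a"
  using assoc[of a x u g y f x] comp_ident[of a x u] by simp

lemma iso_comp:
  assumes f: "is_iso C x y f" and g: "is_iso C y z g"
    and ob: "x \<in> Obj C" "y \<in> Obj C" "z \<in> Obj C"
  shows "is_iso C x z (g \<cdot> f)"
proof -
  obtain f' where f': "\<guillemotleft>f : x \<rightarrow> y\<guillemotright>" "\<guillemotleft>f' : y \<rightarrow> x\<guillemotright>" "f' \<cdot> f = ident C x" "f \<cdot> f' = ident C y"
    using isoE f ob by metis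
  obtain g' where g': "\<guillemotleft>g : y \<rightarrow> z\<guillemotright>" "\<guillemotleft>g' : z \<rightarrow> y\<guillemotright>" "g' \<cdot> g = ident C y" "g \<cdot> g' = ident C z"
    using isoE g ob by metis
  show ?thesis
  proof (rule isoI[of _ _ _ "f' \<cdot> g'"])
    show "(f' \<cdot> g') \<cdot> (g \<cdot> f) = ident C x"
      using assoc[OF f'(2) g'(2) arr_comp[OF g'(1) f'(1)]] cancel_left[OF g'(2,1,3) f'(1)] f'(3) by simp
    show "(g \<cdot> f) \<cdot> (f' \<cdot> g') = ident C z"
      using assoc[OF g'(1) f'(1) arr_comp[OF f'(2) g'(2)]] cancel_left[OF f'(1,2,4) g'(2)] g'(4) by simp
  qed (use f' g' arr_comp in auto)
qed

lemma zero_object_src: "\<lbrakk>zero_object C x; \<guillemotleft>f : x \<rightarrow> y\<guillemotright>\<rbrakk> \<Longrightarrow> f = 0"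
  using comp_ident[of f x y] comp_zero[of f x y x] arr_src[of f x y] by (simp add: zero_object_def)

lemma zero_object_tgt: "\<lbrakk>zero_object C y; \<guillemotleft>f : x \<rightarrow> y\<guillemotright>\<rbrakk> \<Longrightarrow> f = 0"
  using ident_comp[of f x y] zero_comp[of f x y y] arr_tgt[of f x y] by (simp add: zero_object_def)

lemma zero_object_iso:
  assumes "zero_object C x" "isomorphic C x y" "y \<in> Obj C"
  shows "zero_object C y"
proof -
  obtain f where "is_iso C x y f" using assms(2) by (auto simp: isomorphic_def)
  moreover have x: "x \<in> Obj C" using assms(1) by (simp add: zero_object_def)
  ultimately obtain g where g: "\<guillemotleft>f : x \<rightarrow> y\<guillemotright>" "\<guillemotleft>g : y \<rightarrow> x\<guillemotright>" "f \<cdot> g = ident C y"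
    using isoE assms(3) by metis
  have "f = 0" using zero_object_src assms(1) g(1) by blast
  then have "ident C y = 0" using g zero_comp[OF g(2) assms(3)] by simp
  then show ?thesis using assms(3) by (simp add: zero_object_def)
qed

end


section \<open>Linear equivalences\<close>

definition fully_faithful ::
  "('k, 'o, 'm, 'z) linear_cat_scheme \<Rightarrow> ('o, 'm) endofun \<Rightarrow> bool" where
  "fully_faithful C F \<longleftrightarrow> (\<forall>x\<in>Obj C. \<forall>y\<in>Obj C.
     bij_betw (fmap F x y) (hom C x y) (hom C (fobj F x) (fobj F y)))"

definition essentially_surjective ::
  "('k, 'o, 'm, 'z) linear_cat_scheme \<Rightarrow> ('o, 'm) endofun \<Rightarrow> bool" where
  "essentially_surjective C F \<longleftrightarrow> (\<forall>y\<in>Obj C. \<exists>x\<in>Obj C. isomorphic C (fobj F x) y)"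

context linear_category
begin

context
  fixes F :: "('o, 'm) endofun"
  assumes lin: "linear_functor C F"
begin

lemma functor_obj: "x \<in> Obj C \<Longrightarrow> fobj F x \<in> Obj C"
  and functor_arr: "\<guillemotleft>f : x \<rightarrow> y\<guillemotright> \<Longrightarrow> \<guillemotleft>fmap F x y f : fobj F x \<rightarrow> fobj F y\<guillemotright>"
  and functor_ident: "x \<in> Obj C \<Longrightarrow> fmap F x x (ident C x) = ident C (fobj F x)"
  and functor_comp: "\<lbrakk>\<guillemotleft>g : y \<rightarrow> z\<guillemotright>; \<guillemotleft>f : x \<rightarrow> y\<guillemotright>\<rbrakk> \<Longrightarrow> fmap F x z (g \<cdot> f) = fmap F y z g \<cdot> fmap F x y f"
  and functor_add: "\<lbrakk>\<guillemotleft>f : x \<rightarrow> y\<guillemotright>; \<guillemotleft>g : x \<rightarrow> y\<guillemotright>\<rbrakk> \<Longrightarrow> fmap F x y (f + g) = fmap F x y f + fmap F x y g"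
  and functor_smul: "\<guillemotleft>f : x \<rightarrow> y\<guillemotright> \<Longrightarrow> fmap F x y (smul C a f) = smul C a (fmap F x y f)"
  using lin by (simp_all add: linear_functor_def arrow_def)

lemma functor_zero: "\<lbrakk>x \<in> Obj C; y \<in> Obj C\<rbrakk> \<Longrightarrow> fmap F x y 0 = 0"
  using functor_add[of 0 x y 0] arr_zero[of x y] by simp

lemma functor_iso:
  assumes "is_iso C x y f" "x \<in> Obj C" "y \<in> Obj C"
  shows "is_iso C (fobj F x) (fobj F y) (fmap F x y f)"
proof -
  obtain g where g: "\<guillemotleft>f : x \<rightarrow> y\<guillemotright>" "\<guillemotleft>g : y \<rightarrow> x\<guillemotright>" "g \<cdot> f = ident C x" "f \<cdot> g = ident C y"
    using isoE assms by metis
  show ?thesis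
    by (rule isoI[of _ _ _ "fmap F y x g"])
       (use g assms functor_arr functor_comp[of g y x f x] functor_comp[of f x y g y] functor_ident in auto)
qed

end

lemma linear_functorI:
  assumes "\<And>x. x \<in> Obj C \<Longrightarrow> fobj F x \<in> Obj C"
    and "\<And>x. x \<in> Obj C \<Longrightarrow> fmap F x x (ident C x) = ident C (fobj F x)"
    and "\<And>x y f. \<guillemotleft>f : x \<rightarrow> y\<guillemotright> \<Longrightarrow> \<guillemotleft>fmap F x y f : fobj F x \<rightarrow> fobj F y\<guillemotright>"
    and "\<And>x y f g. \<lbrakk>\<guillemotleft>f : x \<rightarrow> y\<guillemotright>; \<guillemotleft>g : x \<rightarrow> y\<guillemotright>\<rbrakk> \<Longrightarrow> fmap F x y (f + g) = fmap F x y f + fmap F x y g"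
    and "\<And>x y f a. \<guillemotleft>f : x \<rightarrow> y\<guillemotright> \<Longrightarrow> fmap F x y (smul C a f) = smul C a (fmap F x y f)"
    and "\<And>x y z f g. \<lbrakk>\<guillemotleft>g : y \<rightarrow> z\<guillemotright>; \<guillemotleft>f : x \<rightarrow> y\<guillemotright>\<rbrakk> \<Longrightarrow> fmap F x z (g \<cdot> f) = fmap F y z g \<cdot> fmap F x y f"
  shows "linear_functor C F"
  unfolding linear_functor_def
  using assms(1,2) assms(3-5)[OF arrI] assms(6)[OF arrI arrI] by (simp add: arrow_def)

lemma full: "\<lbrakk>fully_faithful C F; x \<in> Obj C; y \<in> Obj C; \<guillemotleft>g : fobj F x \<rightarrow> fobj F y\<guillemotright>\<rbrakk>
    \<Longrightarrow> \<exists>f. \<guillemotleft>f : x \<rightarrow> y\<guillemotright> \<and> fmap F x y f = g"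
  unfolding fully_faithful_def arrow_def bij_betw_def by (metis imageE)

lemma faithful: "\<lbrakk>fully_faithful C F; \<guillemotleft>f : x \<rightarrow> y\<guillemotright>; \<guillemotleft>g : x \<rightarrow> y\<guillemotright>; fmap F x y f = fmap F x y g\<rbrakk> \<Longrightarrow> f = g"
  unfolding fully_faithful_def arrow_def bij_betw_def by (metis inj_onD)

lemma fully_faithfulI:
  assumes lin: "linear_functor C F"
    and inj: "\<And>x y f g. \<lbrakk>\<guillemotleft>f : x \<rightarrow> y\<guillemotright>; \<guillemotleft>g : x \<rightarrow> y\<guillemotright>; fmap F x y f = fmap F x y g\<rbrakk> \<Longrightarrow> f = g"
    and sur: "\<And>x y g. \<lbrakk>x \<in> Obj C; y \<in> Obj C; \<guillemotleft>g : fobj F x \<rightarrow> fobj F y\<guillemotright>\<rbrakk>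
      \<Longrightarrow> \<exists>f. \<guillemotleft>f : x \<rightarrow> y\<guillemotright> \<and> fmap F x y f = g"
  shows "fully_faithful C F"
  unfolding fully_faithful_def
proof (intro ballI bij_betw_imageI inj_onI set_eqI iffI)
  fix x y assume ob: "x \<in> Obj C" "y \<in> Obj C"
  show "f = g" if "f \<in> hom C x y" "g \<in> hom C x y" "fmap F x y f = fmap F x y g" for f g
    using inj[of f x y g] that ob by (simp add: arrow_def)
  show "g \<in> hom C (fobj F x) (fobj F y)" if "g \<in> fmap F x y ` hom C x y" for g
    using functor_arr[OF lin, of _ x y] that ob by (auto simp: arrow_def)
  show "g \<in> fmap F x y ` hom C x y" if "g \<in> hom C (fobj F x) (fobj F y)" for g
    using sur[of x y g] functor_obj[OF lin] that ob by (auto simp: arrow_def)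
qed

lemma nat_iso_idE:
  assumes "naturally_isomorphic C (comp_functor F G) id_functor"
  obtains \<epsilon> where "\<And>x. x \<in> Obj C \<Longrightarrow> is_iso C (fobj F (fobj G x)) x (\<epsilon> x)"
    "\<And>x y f. \<guillemotleft>f : x \<rightarrow> y\<guillemotright> \<Longrightarrow> \<epsilon> y \<cdot> fmap F (fobj G x) (fobj G y) (fmap G x y f) = f \<cdot> \<epsilon> x"
proof -
  obtain \<epsilon> where "\<forall>x\<in>Obj C. is_iso C (fobj F (fobj G x)) x (\<epsilon> x)"
    "\<forall>x\<in>Obj C. \<forall>y\<in>Obj C. \<forall>f\<in>hom C x y.
      \<epsilon> y \<cdot> fmap F (fobj G x) (fobj G y) (fmap G x y f) = f \<cdot> \<epsilon> x"
    using assms by (auto simp: naturally_isomorphic_def comp_functor_def id_functor_def)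
  then show thesis by (intro that[of \<epsilon>]) (simp_all add: arrow_def)
qed

lemma retract_faithful:
  assumes F: "linear_functor C F" and G: "linear_functor C G"
    and ni: "naturally_isomorphic C (comp_functor G F) id_functor"
    and f: "\<guillemotleft>f : x \<rightarrow> y\<guillemotright>" and g: "\<guillemotleft>g : x \<rightarrow> y\<guillemotright>" and eq: "fmap F x y f = fmap F x y g"
  shows "f = g"
proof -
  obtain \<epsilon> where iso: "\<And>x. x \<in> Obj C \<Longrightarrow> is_iso C (fobj G (fobj F x)) x (\<epsilon> x)"
    and nat: "\<And>x y f. \<guillemotleft>f : x \<rightarrow> y\<guillemotright> \<Longrightarrow> \<epsilon> y \<cdot> fmap G (fobj F x) (fobj F y) (fmap F x y f) = f \<cdot> \<epsilon> x"
    using nat_iso_idE[OF ni] by metis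
  have x: "x \<in> Obj C" using f arr_src by blast
  then obtain e where e: "\<guillemotleft>\<epsilon> x : fobj G (fobj F x) \<rightarrow> x\<guillemotright>" "\<guillemotleft>e : x \<rightarrow> fobj G (fobj F x)\<guillemotright>"
      "\<epsilon> x \<cdot> e = ident C x"
    using isoE[OF iso] functor_obj[OF F] functor_obj[OF G] by metis
  have "f \<cdot> \<epsilon> x = g \<cdot> \<epsilon> x" using nat[OF f] nat[OF g] eq by metis
  then show ?thesis
    using cancel_right[OF e(1,2,3) f] cancel_right[OF e(1,2,3) g] by metis
qed

text \<open>
  Both functors of an equivalence are faithful, because each is a retract of an identity functor. A
  candidate preimage of \<open>h\<close> is found by transporting \<open>G h\<close>, and faithfulness of \<open>G\<close> confirms it.
\<close>

lemma autoequivalence_fully_faithful: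
  assumes "autoequivalence C F"
  shows "fully_faithful C F"
proof -
  obtain G where F: "linear_functor C F" and G: "linear_functor C G"
    and FG: "naturally_isomorphic C (comp_functor F G) id_functor"
    and GF: "naturally_isomorphic C (comp_functor G F) id_functor"
    using assms by (auto simp: autoequivalence_def quasi_inverse_def)
  obtain \<epsilon> where iso: "\<And>x. x \<in> Obj C \<Longrightarrow> is_iso C (fobj G (fobj F x)) x (\<epsilon> x)"
    and nat: "\<And>x y f. \<guillemotleft>f : x \<rightarrow> y\<guillemotright> \<Longrightarrow> \<epsilon> y \<cdot> fmap G (fobj F x) (fobj F y) (fmap F x y f) = f \<cdot> \<epsilon> x"
    using nat_iso_idE[OF GF] by metis
  show ?thesis
  proof (rule fully_faithfulI[OF F])
    show "f = g" if "\<guillemotleft>f : x \<rightarrow> y\<guillemotright>" "\<guillemotleft>g : x \<rightarrow> y\<guillemotright>" "fmap F x y f = fmap F x y g" for x y f g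
      using retract_faithful[OF F G GF that] .
    fix x y h assume ob: "x \<in> Obj C" "y \<in> Obj C" and h: "\<guillemotleft>h : fobj F x \<rightarrow> fobj F y\<guillemotright>"
    obtain e where e: "\<guillemotleft>\<epsilon> x : fobj G (fobj F x) \<rightarrow> x\<guillemotright>" "\<guillemotleft>e : x \<rightarrow> fobj G (fobj F x)\<guillemotright>"
      "e \<cdot> \<epsilon> x = ident C (fobj G (fobj F x))"
      using isoE[OF iso] functor_obj[OF F] functor_obj[OF G] ob by metis
    obtain e' where e': "\<guillemotleft>\<epsilon> y : fobj G (fobj F y) \<rightarrow> y\<guillemotright>" "\<guillemotleft>e' : y \<rightarrow> fobj G (fobj F y)\<guillemotright>"
      "e' \<cdot> \<epsilon> y = ident C (fobj G (fobj F y))"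
      using isoE[OF iso] functor_obj[OF F] functor_obj[OF G] ob by metis
    let ?Gh = "fmap G (fobj F x) (fobj F y) h"
    have Gh: "\<guillemotleft>?Gh : fobj G (fobj F x) \<rightarrow> fobj G (fobj F y)\<guillemotright>" using functor_arr[OF G h] .
    define f where "f = (\<epsilon> y \<cdot> ?Gh) \<cdot> e"
    have f: "\<guillemotleft>f : x \<rightarrow> y\<guillemotright>" unfolding f_def using arr_comp e e' Gh by metis
    have "f \<cdot> \<epsilon> x = \<epsilon> y \<cdot> ?Gh"
      unfolding f_def using cancel_right[OF e(2,1,3) arr_comp[OF e'(1) Gh]] .
    then have *: "\<epsilon> y \<cdot> fmap G (fobj F x) (fobj F y) (fmap F x y f) = \<epsilon> y \<cdot> ?Gh"
      using nat[OF f] by simp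
    have "fmap G (fobj F x) (fobj F y) (fmap F x y f) = ?Gh"
      using arg_cong[OF *, of "\<lambda>u. e' \<cdot> u"] cancel_left[OF e'(2,1,3)] Gh
        functor_arr[OF G functor_arr[OF F f]] by simp
    then have "fmap F x y f = h"
      using retract_faithful[OF G F FG functor_arr[OF F f] h] by simp
    then show "\<exists>f. \<guillemotleft>f : x \<rightarrow> y\<guillemotright> \<and> fmap F x y f = h" using f by blast
  qed
qed

lemma autoequivalence_essentially_surjective:
  assumes "autoequivalence C F"
  shows "essentially_surjective C F"
proof -
  obtain G where G: "linear_functor C G"
    and FG: "naturally_isomorphic C (comp_functor F G) id_functor"
    using assms by (auto simp: autoequivalence_def quasi_inverse_def)
  obtain \<epsilon> where "\<And>x. x \<in> Obj C \<Longrightarrow> is_iso C (fobj F (fobj G x)) x (\<epsilon> x)"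
    using nat_iso_idE[OF FG] by metis
  then show ?thesis
    unfolding essentially_surjective_def isomorphic_def using functor_obj[OF G] by blast
qed

lemma quasi_inverse_sym:
  "\<lbrakk>linear_functor C F; quasi_inverse C F G\<rbrakk> \<Longrightarrow> quasi_inverse C G F"
  by (simp add: quasi_inverse_def)

text \<open>
  A fully faithful, essentially surjective functor has a quasi-inverse: choose preimages of objects
  and transport morphisms back along the chosen isomorphisms.
\<close>

lemma autoequivalenceI:
  assumes F: "linear_functor C F" and ff: "fully_faithful C F" and es: "essentially_surjective C F"
  shows "autoequivalence C F"
proof -
  have "\<exists>G0 \<epsilon>. \<forall>y\<in>Obj C. G0 y \<in> Obj C \<and> is_iso C (fobj F (G0 y)) y (\<epsilon> y)"
    using es unfolding essentially_surjective_def isomorphic_def by metis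
  then obtain G0 \<epsilon> where G0: "\<And>y. y \<in> Obj C \<Longrightarrow> G0 y \<in> Obj C"
    and iso: "\<And>y. y \<in> Obj C \<Longrightarrow> is_iso C (fobj F (G0 y)) y (\<epsilon> y)" by blast
  have FG0: "fobj F (G0 y) \<in> Obj C" if "y \<in> Obj C" for y using functor_obj[OF F] G0 that by blast
  have "\<exists>i. \<forall>y\<in>Obj C. \<guillemotleft>\<epsilon> y : fobj F (G0 y) \<rightarrow> y\<guillemotright> \<and> \<guillemotleft>i y : y \<rightarrow> fobj F (G0 y)\<guillemotright> \<and>
      i y \<cdot> \<epsilon> y = ident C (fobj F (G0 y)) \<and> \<epsilon> y \<cdot> i y = ident C y"
  proof (intro bchoice ballI)
    fix y assume y: "y \<in> Obj C"
    show "\<exists>i. \<guillemotleft>\<epsilon> y : fobj F (G0 y) \<rightarrow> y\<guillemotright> \<and> \<guillemotleft>i : y \<rightarrow> fobj F (G0 y)\<guillemotright> \<and>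
      i \<cdot> \<epsilon> y = ident C (fobj F (G0 y)) \<and> \<epsilon> y \<cdot> i = ident C y"
      using isoE[OF iso[OF y] FG0[OF y] y] by metis
  qed
  then obtain i where e: "\<And>y. y \<in> Obj C \<Longrightarrow> \<guillemotleft>\<epsilon> y : fobj F (G0 y) \<rightarrow> y\<guillemotright>"
    and i: "\<And>y. y \<in> Obj C \<Longrightarrow> \<guillemotleft>i y : y \<rightarrow> fobj F (G0 y)\<guillemotright>"
    and ie: "\<And>y. y \<in> Obj C \<Longrightarrow> i y \<cdot> \<epsilon> y = ident C (fobj F (G0 y))"
    and ei: "\<And>y. y \<in> Obj C \<Longrightarrow> \<epsilon> y \<cdot> i y = ident C y" by blast
  \<comment> \<open>The value of the quasi-inverse on \<open>f\<close> is determined by naturality of \<open>\<epsilon>\<close>, since \<open>\<epsilon>\<close> is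
    invertible and \<open>F\<close> is fully faithful.\<close>
  define Gm where "Gm = (\<lambda>x y f. SOME g. \<guillemotleft>g : G0 x \<rightarrow> G0 y\<guillemotright> \<and> \<epsilon> y \<cdot> fmap F (G0 x) (G0 y) g = f \<cdot> \<epsilon> x)"
  have ex: "\<exists>g. \<guillemotleft>g : G0 x \<rightarrow> G0 y\<guillemotright> \<and> \<epsilon> y \<cdot> fmap F (G0 x) (G0 y) g = f \<cdot> \<epsilon> x" if f: "\<guillemotleft>f : x \<rightarrow> y\<guillemotright>" for x y f
  proof -
    have ob: "x \<in> Obj C" "y \<in> Obj C" using f by (auto simp: arrow_def)
    have fe: "\<guillemotleft>f \<cdot> \<epsilon> x : fobj F (G0 x) \<rightarrow> y\<guillemotright>" using arr_comp f e ob by blast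
    obtain g where g: "\<guillemotleft>g : G0 x \<rightarrow> G0 y\<guillemotright>" "fmap F (G0 x) (G0 y) g = i y \<cdot> (f \<cdot> \<epsilon> x)"
      using full[OF ff G0 G0 arr_comp[OF i fe]] ob by blast
    then show ?thesis using cancel_left[OF e i ei fe] ob by auto
  qed
  have Gm: "\<guillemotleft>Gm x y f : G0 x \<rightarrow> G0 y\<guillemotright>" "\<epsilon> y \<cdot> fmap F (G0 x) (G0 y) (Gm x y f) = f \<cdot> \<epsilon> x"
    if "\<guillemotleft>f : x \<rightarrow> y\<guillemotright>" for x y f
    using someI_ex[OF ex[OF that]] unfolding Gm_def by auto
  have uniq: "g = Gm x y f" if f: "\<guillemotleft>f : x \<rightarrow> y\<guillemotright>" and g: "\<guillemotleft>g : G0 x \<rightarrow> G0 y\<guillemotright>"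
    and eq: "\<epsilon> y \<cdot> fmap F (G0 x) (G0 y) g = f \<cdot> \<epsilon> x" for x y f g
  proof (rule faithful[OF ff g Gm(1)[OF f]])
    have ob: "x \<in> Obj C" "y \<in> Obj C" using f by (auto simp: arrow_def)
    have "i y \<cdot> (\<epsilon> y \<cdot> fmap F (G0 x) (G0 y) g) = i y \<cdot> (\<epsilon> y \<cdot> fmap F (G0 x) (G0 y) (Gm x y f))"
      using eq Gm(2)[OF f] by simp
    then show "fmap F (G0 x) (G0 y) g = fmap F (G0 x) (G0 y) (Gm x y f)"
      using cancel_left[OF i e ie functor_arr[OF F g]] cancel_left[OF i e ie functor_arr[OF F Gm(1)[OF f]]]
        ob by simp
  qed
  define G where "G = \<lparr>fobj = G0, fmap = Gm\<rparr>"
  have Gs: "fobj G = G0" "fmap G = Gm" by (simp_all add: G_def)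
  have G_id: "Gm x x (ident C x) = ident C (G0 x)" if x: "x \<in> Obj C" for x
    using uniq[OF arr_ident[OF x] arr_ident[OF G0[OF x]]] functor_ident[OF F G0[OF x]]
      comp_ident[OF e[OF x]] ident_comp[OF e[OF x]] by simp
  have G_add: "Gm x y (f + g) = Gm x y f + Gm x y g" if f: "\<guillemotleft>f : x \<rightarrow> y\<guillemotright>" and g: "\<guillemotleft>g : x \<rightarrow> y\<guillemotright>" for x y f g
  proof -
    have ob: "x \<in> Obj C" "y \<in> Obj C" using f by (auto simp: arrow_def)
    show ?thesis
      using uniq[OF arr_add[OF f g] arr_add[OF Gm(1)[OF f] Gm(1)[OF g]]]
        functor_add[OF F Gm(1)[OF f] Gm(1)[OF g]]
        comp_add[OF e[OF ob(2)] functor_arr[OF F Gm(1)[OF f]] functor_arr[OF F Gm(1)[OF g]]]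
        add_comp[OF f g e[OF ob(1)]] Gm(2)[OF f] Gm(2)[OF g] by simp
  qed
  have G_smul: "Gm x y (smul C a f) = smul C a (Gm x y f)" if f: "\<guillemotleft>f : x \<rightarrow> y\<guillemotright>" for x y f a
  proof -
    have ob: "x \<in> Obj C" "y \<in> Obj C" using f by (auto simp: arrow_def)
    have "\<epsilon> y \<cdot> fmap F (G0 x) (G0 y) (smul C a (Gm x y f)) = smul C a f \<cdot> \<epsilon> x"
      by (simp add: functor_smul[OF F Gm(1)[OF f]] comp_smul[OF e[OF ob(2)] functor_arr[OF F Gm(1)[OF f]]]
        smul_comp[OF f e[OF ob(1)]] Gm(2)[OF f])
    then show ?thesis using uniq[OF arr_smul[OF f] arr_smul[OF Gm(1)[OF f]]] by metis
  qed
  have G_comp: "Gm x z (g \<cdot> f) = Gm y z g \<cdot> Gm x y f" if g: "\<guillemotleft>g : y \<rightarrow> z\<guillemotright>" and f: "\<guillemotleft>f : x \<rightarrow> y\<guillemotright>" for x y z f g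
  proof -
    have ob: "x \<in> Obj C" "y \<in> Obj C" "z \<in> Obj C" using f g by (auto simp: arrow_def)
    note Ff = functor_arr[OF F Gm(1)[OF f]] and Fg = functor_arr[OF F Gm(1)[OF g]]
    have "\<epsilon> z \<cdot> fmap F (G0 x) (G0 z) (Gm y z g \<cdot> Gm x y f) = (g \<cdot> f) \<cdot> \<epsilon> x"
      using functor_comp[OF F Gm(1)[OF g] Gm(1)[OF f]] assoc[OF e[OF ob(3)] Fg Ff]
        assoc[OF g e[OF ob(2)] Ff] assoc[OF g f e[OF ob(1)]] Gm(2)[OF f] Gm(2)[OF g] by simp
    then show ?thesis
      using uniq[OF arr_comp[OF g f] arr_comp[OF Gm(1)[OF g] Gm(1)[OF f]]] by simp
  qed
  have linG: "linear_functor C G"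
    by (rule linear_functorI; unfold Gs; fact G0 G_id Gm(1) G_add G_smul G_comp)
  have FG: "naturally_isomorphic C (comp_functor F G) id_functor"
    unfolding naturally_isomorphic_def
    by (rule exI[of _ \<epsilon>])
      (use iso Gm(2) in \<open>simp add: comp_functor_def id_functor_def Gs arrow_def\<close>)
  have FGF: "fobj F (G0 (fobj F x)) \<in> Obj C" if "x \<in> Obj C" for x
    using that FG0 functor_obj[OF F] by blast
  have "\<exists>\<delta>. \<forall>x\<in>Obj C. \<guillemotleft>\<delta> x : G0 (fobj F x) \<rightarrow> x\<guillemotright> \<and>
      fmap F (G0 (fobj F x)) x (\<delta> x) = \<epsilon> (fobj F x)"
  proof (intro bchoice ballI)
    fix x assume x: "x \<in> Obj C"
    show "\<exists>d. \<guillemotleft>d : G0 (fobj F x) \<rightarrow> x\<guillemotright> \<and> fmap F (G0 (fobj F x)) x d = \<epsilon> (fobj F x)"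
      using full[OF ff G0 x e] functor_obj[OF F x] by blast
  qed
  then obtain \<delta> where \<delta>: "\<And>x. x \<in> Obj C \<Longrightarrow> \<guillemotleft>\<delta> x : G0 (fobj F x) \<rightarrow> x\<guillemotright>"
    "\<And>x. x \<in> Obj C \<Longrightarrow> fmap F (G0 (fobj F x)) x (\<delta> x) = \<epsilon> (fobj F x)" by blast
  have \<delta>_iso: "is_iso C (G0 (fobj F x)) x (\<delta> x)" if x: "x \<in> Obj C" for x
  proof -
    have Fx: "fobj F x \<in> Obj C" using functor_obj[OF F x] .
    obtain d where d: "\<guillemotleft>d : x \<rightarrow> G0 (fobj F x)\<guillemotright>" "fmap F x (G0 (fobj F x)) d = i (fobj F x)"
      using full[OF ff x G0[OF Fx] i[OF Fx]] by blast
    have "d \<cdot> \<delta> x = ident C (G0 (fobj F x))"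
      using faithful[OF ff arr_comp[OF d(1) \<delta>(1)[OF x]] arr_ident[OF G0[OF Fx]]]
        functor_comp[OF F d(1) \<delta>(1)[OF x]] functor_ident[OF F G0[OF Fx]] d(2) \<delta>(2)[OF x] ie[OF Fx] by simp
    moreover have "\<delta> x \<cdot> d = ident C x"
      using faithful[OF ff arr_comp[OF \<delta>(1)[OF x] d(1)] arr_ident[OF x]]
        functor_comp[OF F \<delta>(1)[OF x] d(1)] functor_ident[OF F x] d(2) \<delta>(2)[OF x] ei[OF Fx] by simp
    ultimately show ?thesis using isoI[OF \<delta>(1)[OF x] d(1)] by simp
  qed
  have \<delta>_nat: "\<delta> y \<cdot> Gm (fobj F x) (fobj F y) (fmap F x y f) = f \<cdot> \<delta> x" if f: "\<guillemotleft>f : x \<rightarrow> y\<guillemotright>" for x y f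
  proof -
    have ob: "x \<in> Obj C" "y \<in> Obj C" using f by (auto simp: arrow_def)
    note Ff = functor_arr[OF F f]
    note a1 = arr_comp[OF \<delta>(1)[OF ob(2)] Gm(1)[OF Ff]]
    note a2 = arr_comp[OF f \<delta>(1)[OF ob(1)]]
    show ?thesis
      using faithful[OF ff a1 a2] functor_comp[OF F \<delta>(1)[OF ob(2)] Gm(1)[OF Ff]]
        functor_comp[OF F f \<delta>(1)[OF ob(1)]] \<delta>(2)[OF ob(1)] \<delta>(2)[OF ob(2)] Gm(2)[OF Ff] by simp
  qed
  have GF: "naturally_isomorphic C (comp_functor G F) id_functor"
    unfolding naturally_isomorphic_def
    by (rule exI[of _ \<delta>])
      (use \<delta>_iso \<delta>_nat in \<open>simp add: comp_functor_def id_functor_def Gs arrow_def\<close>)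
  show ?thesis
    unfolding autoequivalence_def quasi_inverse_def using F linG FG GF by blast
qed

lemma autoequivalence_comp:
  assumes "autoequivalence C F" "autoequivalence C G"
  shows "autoequivalence C (comp_functor F G)"
proof (rule autoequivalenceI)
  have F: "linear_functor C F" and G: "linear_functor C G"
    using assms by (auto simp: autoequivalence_def)
  note ffF = autoequivalence_fully_faithful[OF assms(1)] and ffG = autoequivalence_fully_faithful[OF assms(2)]
  show FG: "linear_functor C (comp_functor F G)"
  proof (rule linear_functorI)
    fix x y z f g a
    show "fobj (comp_functor F G) x \<in> Obj C" if "x \<in> Obj C"
      using that functor_obj[OF F] functor_obj[OF G] by (simp add: comp_functor_def)
    show "fmap (comp_functor F G) x x (ident C x) = ident C (fobj (comp_functor F G) x)" if "x \<in> Obj C"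
      using that functor_obj[OF G] functor_ident[OF F] functor_ident[OF G] by (simp add: comp_functor_def)
    show "\<guillemotleft>fmap (comp_functor F G) x y f : fobj (comp_functor F G) x \<rightarrow> fobj (comp_functor F G) y\<guillemotright>"
      if "\<guillemotleft>f : x \<rightarrow> y\<guillemotright>"
      using functor_arr[OF F functor_arr[OF G that]] by (simp add: comp_functor_def)
    show "fmap (comp_functor F G) x y (f + g) = fmap (comp_functor F G) x y f + fmap (comp_functor F G) x y g"
      if "\<guillemotleft>f : x \<rightarrow> y\<guillemotright>" "\<guillemotleft>g : x \<rightarrow> y\<guillemotright>"
      using functor_add[OF G that] functor_add[OF F functor_arr[OF G that(1)] functor_arr[OF G that(2)]]
      by (simp add: comp_functor_def)
    show "fmap (comp_functor F G) x y (smul C a f) = smul C a (fmap (comp_functor F G) x y f)"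
      if "\<guillemotleft>f : x \<rightarrow> y\<guillemotright>"
      using functor_smul[OF G that] functor_smul[OF F functor_arr[OF G that]] by (simp add: comp_functor_def)
    show "fmap (comp_functor F G) x z (g \<cdot> f) = fmap (comp_functor F G) y z g \<cdot> fmap (comp_functor F G) x y f"
      if "\<guillemotleft>g : y \<rightarrow> z\<guillemotright>" "\<guillemotleft>f : x \<rightarrow> y\<guillemotright>"
      using functor_comp[OF G that] functor_comp[OF F functor_arr[OF G that(1)] functor_arr[OF G that(2)]]
      by (simp add: comp_functor_def)
  qed
  show "fully_faithful C (comp_functor F G)"
    using ffF ffG functor_obj[OF G] unfolding fully_faithful_def comp_functor_def
    by (auto intro!: bij_betw_trans[of "fmap G _ _" _ _ "fmap F _ _", unfolded comp_def])
  show "essentially_surjective C (comp_functor F G)"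
    unfolding essentially_surjective_def comp_functor_def
  proof
    fix z assume z: "z \<in> Obj C"
    obtain y a where y: "y \<in> Obj C" "is_iso C (fobj F y) z a"
      using autoequivalence_essentially_surjective[OF assms(1)] z
      by (auto simp: essentially_surjective_def isomorphic_def)
    obtain x b where x: "x \<in> Obj C" "is_iso C (fobj G x) y b"
      using autoequivalence_essentially_surjective[OF assms(2)] y
      by (auto simp: essentially_surjective_def isomorphic_def)
    have "is_iso C (fobj F (fobj G x)) z (a \<cdot> fmap F (fobj G x) y b)"
      using iso_comp[OF functor_iso[OF F x(2)] y(2)] functor_obj[OF F] functor_obj[OF G] x y z by simp
    then show "\<exists>x\<in>Obj C. isomorphic C (fobj \<lparr>fobj = \<lambda>x. fobj F (fobj G x),
        fmap = \<lambda>x y f. fmap F (fobj G x) (fobj G y) (fmap G x y f)\<rparr> x) z"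
      using x(1) by (auto simp: isomorphic_def)
  qed
qed

lemma autoequivalence_id: "autoequivalence C id_functor"
proof (rule autoequivalenceI)
  show "linear_functor C id_functor"
    by (auto simp: linear_functor_def id_functor_def)
  show "fully_faithful C id_functor"
    by (auto simp: fully_faithful_def id_functor_def bij_betw_def inj_on_def)
  show "essentially_surjective C id_functor"
    using iso_ident by (auto simp: essentially_surjective_def id_functor_def isomorphic_def)
qed

lemma autoequivalence_power: "autoequivalence C F \<Longrightarrow> autoequivalence C (functor_power F n)"
  by (induction n) (simp_all add: autoequivalence_id autoequivalence_comp)

end

lemma fobj_functor_power: "fobj (functor_power F n) x = (fobj F ^^ n) x"
  by (induction n) (simp_all add: id_functor_def comp_functor_def)

section \<open>Exact sequences in a triangulated category\<close>

context linear_category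
begin

lemma fully_faithful_reflects_iso:
  assumes F: "linear_functor C F" and ff: "fully_faithful C F" and ob: "x \<in> Obj C" "y \<in> Obj C"
    and iso: "isomorphic C (fobj F x) (fobj F y)"
  shows "isomorphic C x y"
proof -
  obtain k l where k: "\<guillemotleft>k : fobj F x \<rightarrow> fobj F y\<guillemotright>" and l: "\<guillemotleft>l : fobj F y \<rightarrow> fobj F x\<guillemotright>"
    and kl: "l \<cdot> k = ident C (fobj F x)" "k \<cdot> l = ident C (fobj F y)"
    using iso isoE functor_obj[OF F] ob unfolding isomorphic_def by metis
  obtain f where f: "\<guillemotleft>f : x \<rightarrow> y\<guillemotright>" "fmap F x y f = k" using full[OF ff ob k] by blast
  obtain g where g: "\<guillemotleft>g : y \<rightarrow> x\<guillemotright>" "fmap F y x g = l" using full[OF ff ob(2,1) l] by blast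
  have "g \<cdot> f = ident C x"
    using faithful[OF ff arr_comp[OF g(1) f(1)] arr_ident[OF ob(1)]] functor_comp[OF F g(1) f(1)]
      functor_ident[OF F ob(1)] f(2) g(2) kl by metis
  moreover have "f \<cdot> g = ident C y"
    using faithful[OF ff arr_comp[OF f(1) g(1)] arr_ident[OF ob(2)]] functor_comp[OF F f(1) g(1)]
      functor_ident[OF F ob(2)] f(2) g(2) kl by metis
  ultimately show ?thesis using isoI[OF f(1) g(1)] by (auto simp: isomorphic_def)
qed

lemma isomorphic_sym: "\<lbrakk>isomorphic C x y; x \<in> Obj C; y \<in> Obj C\<rbrakk> \<Longrightarrow> isomorphic C y x"
  unfolding isomorphic_def by (metis isoE)

lemma isomorphic_trans:
  "\<lbrakk>isomorphic C x y; isomorphic C y z; x \<in> Obj C; y \<in> Obj C; z \<in> Obj C\<rbrakk> \<Longrightarrow> isomorphic C x z"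
  unfolding isomorphic_def by (metis iso_comp)

lemma vanish_iso_tgt:
  assumes "hom C x y = {0}" "isomorphic C y y'" "x \<in> Obj C" "y \<in> Obj C" "y' \<in> Obj C"
  shows "hom C x y' = {0}"
proof (rule vanishI)
  fix f assume f: "\<guillemotleft>f : x \<rightarrow> y'\<guillemotright>"
  obtain k l where kl: "\<guillemotleft>k : y \<rightarrow> y'\<guillemotright>" "\<guillemotleft>l : y' \<rightarrow> y\<guillemotright>" "k \<cdot> l = ident C y'"
    using assms isoE unfolding isomorphic_def by metis
  have "l \<cdot> f = 0" using vanishD[OF assms(1) arr_comp[OF kl(2) f]] .
  then show "f = 0" using cancel_left[OF kl f] comp_zero[OF kl(1) assms(3)] by simp
qed (use assms in auto)

lemma vanish_iso_src:
  assumes "hom C x y = {0}" "isomorphic C x x'" "x \<in> Obj C" "y \<in> Obj C" "x' \<in> Obj C"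
  shows "hom C x' y = {0}"
proof (rule vanishI)
  fix f assume f: "\<guillemotleft>f : x' \<rightarrow> y\<guillemotright>"
  obtain k l where kl: "\<guillemotleft>k : x \<rightarrow> x'\<guillemotright>" "\<guillemotleft>l : x' \<rightarrow> x\<guillemotright>" "k \<cdot> l = ident C x'"
    using assms isoE unfolding isomorphic_def by metis
  have "f \<cdot> k = 0" using vanishD[OF assms(1) arr_comp[OF f kl(1)]] .
  then show "f = 0" using cancel_right[OF kl f] zero_comp[OF kl(2) assms(4)] by simp
qed (use assms in auto)

lemma isomorphism_of_retractions:
  assumes a: "\<guillemotleft>a : x \<rightarrow> y\<guillemotright>" and b: "\<guillemotleft>b : y \<rightarrow> x\<guillemotright>" and c: "\<guillemotleft>c : y \<rightarrow> x\<guillemotright>"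
    and "b \<cdot> a = ident C x" "a \<cdot> c = ident C y"
  shows "is_iso C x y a"
proof -
  have "b = c" using assoc[OF b a c] comp_ident[OF b] ident_comp[OF c] assms by metis
  then show ?thesis using isoI[OF a b] assms by simp
qed

text \<open>The inverse of \<open>1 + n\<close> with \<open>n\<^sup>2 = 0\<close> is \<open>1 - n\<close>.\<close>

lemma unipotent_iso:
  assumes e: "\<guillemotleft>e : x \<rightarrow> x\<guillemotright>" and sq: "(e - ident C x) \<cdot> (e - ident C x) = 0"
  obtains e' where "\<guillemotleft>e' : x \<rightarrow> x\<guillemotright>" "e' \<cdot> e = ident C x" "e \<cdot> e' = ident C x"
proof -
  have x: "x \<in> Obj C" using e arr_src by blast
  note i = arr_ident[OF x]
  define n where "n = e - ident C x"
  have n: "\<guillemotleft>n : x \<rightarrow> x\<guillemotright>" unfolding n_def using arr_diff[OF e i] .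
  have en: "e = ident C x + n" by (simp add: n_def)
  have nn: "n \<cdot> n = 0" using sq by (simp add: n_def)
  note d = arr_diff[OF i n]
  have "(ident C x - n) \<cdot> e = ident C x"
    unfolding en by (simp add: comp_add[OF d i n] diff_comp[OF i n i] diff_comp[OF i n n]
        comp_ident[OF i] comp_ident[OF n] ident_comp[OF n] nn)
  moreover have "e \<cdot> (ident C x - n) = ident C x"
    unfolding en by (simp add: add_comp[OF i n d] comp_diff[OF i i n] comp_diff[OF n i n]
        comp_ident[OF i] comp_ident[OF n] ident_comp[OF n] nn)
  ultimately show ?thesis using that d by blast
qed

end

context triangulated_category
begin

abbreviation \<Sigma> where "\<Sigma> \<equiv> fobj (shift T)"
abbreviation smap where "smap \<equiv> fmap (shift T)"

lemma shift_linear: "linear_functor T (shift T)"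
  using shift_autoequivalence by (simp add: autoequivalence_def)

lemma shift_ff: "fully_faithful T (shift T)"
  using autoequivalence_fully_faithful[OF shift_autoequivalence] .

lemmas shift_obj = functor_obj[OF shift_linear]
  and smap_arr = functor_arr[OF shift_linear]
  and smap_ident = functor_ident[OF shift_linear]
  and smap_comp = functor_comp[OF shift_linear]
  and smap_zero = functor_zero[OF shift_linear]
  and smap_full = full[OF shift_ff]
  and smap_faithful = faithful[OF shift_ff]

lemma smap_eq_0: "\<lbrakk>\<guillemotleft>f : x \<rightarrow> y\<guillemotright>; smap x y f = 0\<rbrakk> \<Longrightarrow> f = 0"
  using smap_faithful[of f x y 0] arr_zero smap_zero arr_src arr_tgt by metis

lemma shift_surj: "y \<in> Obj T \<Longrightarrow> \<exists>x\<in>Obj T. isomorphic T (\<Sigma> x) y"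
  using autoequivalence_essentially_surjective[OF shift_autoequivalence]
  by (simp add: essentially_surjective_def)

lemma dtriD:
  assumes "dtri T x y z f g h"
  shows "x \<in> Obj T" "y \<in> Obj T" "z \<in> Obj T" "\<guillemotleft>f : x \<rightarrow> y\<guillemotright>" "\<guillemotleft>g : y \<rightarrow> z\<guillemotright>" "\<guillemotleft>h : z \<rightarrow> \<Sigma> x\<guillemotright>"
  using dtri_typed[OF assms] shift_obj by (auto simp: arrow_def)

lemma rot: "dtri T x y z f g h \<Longrightarrow> dtri T y z (\<Sigma> x) g h (- smap x y f)"
  using dtri_rotate[of x y z f g h] dtri_typed[of x y z f g h] by blast

lemma unrot:
  assumes "dtri T y z (\<Sigma> x) g h k" "x \<in> Obj T"
  obtains f where "\<guillemotleft>f : x \<rightarrow> y\<guillemotright>" "k = - smap x y f" "dtri T x y z f g h"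
proof -
  note d = dtriD[OF assms(1)]
  obtain f where f: "\<guillemotleft>f : x \<rightarrow> y\<guillemotright>" "smap x y f = - k"
    using smap_full[OF assms(2) d(1) arr_neg[OF d(6)]] by blast
  have "dtri T x y z f g h"
    using dtri_rotate[of x y z f g h] assms d f by (simp add: arrow_def)
  then show ?thesis using that f by simp
qed

lemma zero_exists: "\<exists>z. zero_object T z"
  using direct_sums[of "[]"] by (auto simp: direct_sum_def zero_object_def)

lemma zero_shift: "zero_object T z \<Longrightarrow> zero_object T (\<Sigma> z)"
  using smap_ident[of z] smap_zero[of z z] shift_obj[of z] by (simp add: zero_object_def)

lemma dtri_zero_src: "\<lbrakk>x \<in> Obj T; zero_object T z\<rbrakk> \<Longrightarrow> dtri T z x x 0 (ident T x) 0"
proof -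
  assume x: "x \<in> Obj T" and z: "zero_object T z"
  have zo: "z \<in> Obj T" using z by (simp add: zero_object_def)
  obtain f where f: "\<guillemotleft>f : z \<rightarrow> x\<guillemotright>" "dtri T z x x f (ident T x) 0"
    using unrot[OF dtri_ident[OF x zero_shift[OF z]] zo] by metis
  then show ?thesis using zero_object_src[OF z f(1)] by simp
qed

lemma dtri_comp_zero:
  assumes t: "dtri T x y z f g h"
  shows "g \<cdot> f = 0"
proof -
  obtain o' where o': "zero_object T o'" using zero_exists by blast
  note d = dtriD[OF t]
  obtain c where "c \<in> hom T o' z" "c \<cdot> 0 = g \<cdot> f"
    using dtri_morphism[OF dtri_ident[OF d(1) o'] t, of "ident T x" f] arr_ident[OF d(1)] d by (auto simp: arrow_def)
  then show ?thesis using comp_zero[of c o' z x] d(1,3) o' by (simp add: arrow_def zero_object_def)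
qed

text \<open>
  Exactness of the sequences of Hom-spaces is proved by extending a square to a morphism of triangles,
  one of which has a zero object; here the target is \<open>0 \<rightarrow> t \<rightarrow> t \<rightarrow> 0\<close>. Rotation gives exactness at the
  other places.
\<close>

lemma factor_through_cone:
  assumes t: "dtri T x y z f g h" and b: "\<guillemotleft>b : y \<rightarrow> t\<guillemotright>" and bf: "b \<cdot> f = 0"
  obtains c where "\<guillemotleft>c : z \<rightarrow> t\<guillemotright>" "c \<cdot> g = b"
proof -
  obtain o' where o': "zero_object T o'" using zero_exists by blast
  note d = dtriD[OF t]
  have to: "t \<in> Obj T" and oo: "o' \<in> Obj T" using b o' by (auto simp: arrow_def zero_object_def)
  have "b \<cdot> f = 0 \<cdot> 0" using bf zero_comp[OF arr_zero[OF d(1) oo] to] by simp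
  then obtain c where "c \<in> hom T z t" "c \<cdot> g = ident T t \<cdot> b"
    using dtri_morphism[OF t dtri_zero_src[OF to o'], of 0 b] arr_zero[OF d(1) oo] b by (auto simp: arrow_def)
  then show ?thesis using that d(3) to ident_comp[OF b] by (simp add: arrow_def)
qed

lemma factor_through_cocone:
  assumes t: "dtri T x y z f g h" and b: "\<guillemotleft>b : t \<rightarrow> y\<guillemotright>" and gb: "g \<cdot> b = 0"
  obtains a where "\<guillemotleft>a : t \<rightarrow> x\<guillemotright>" "f \<cdot> a = b"
proof -
  obtain o' where o': "zero_object T o'" using zero_exists by blast
  note d = dtriD[OF t]
  have to: "t \<in> Obj T" and oo: "o' \<in> Obj T" using b o' by (auto simp: arrow_def zero_object_def)
  have eq: "0 \<cdot> 0 = g \<cdot> b" using gb zero_comp[OF arr_zero[OF to oo] d(3)] by simp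
  obtain c where "c \<in> hom T (\<Sigma> t) (\<Sigma> x)" "smap t y b \<cdot> (- smap t t (ident T t)) = (- smap x y f) \<cdot> c"
    using dtri_morphism[OF rot[OF dtri_ident[OF to o']] rot[OF t], of b 0] eq
      arr_zero[OF oo d(3)] b by (auto simp: arrow_def)
  then have c: "\<guillemotleft>c : \<Sigma> t \<rightarrow> \<Sigma> x\<guillemotright>" and e: "smap t y b = smap x y f \<cdot> c"
    using to d(1) shift_obj smap_arr[OF b] smap_arr[OF d(4)] smap_ident[OF to]
      comp_neg[OF smap_arr[OF b] arr_ident[OF shift_obj[OF to]]] comp_ident[OF smap_arr[OF b]]
      neg_comp[OF smap_arr[OF d(4)], of c "\<Sigma> t"] by (auto simp: arrow_def)
  obtain a where a: "\<guillemotleft>a : t \<rightarrow> x\<guillemotright>" "smap t x a = c" using smap_full[OF to d(1) c] by blast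
  have "f \<cdot> a = b"
    using smap_faithful[OF arr_comp[OF d(4) a(1)] b] smap_comp[OF d(4) a(1)] a(2) e by simp
  then show ?thesis using that a by blast
qed

lemma extend_along_first:
  assumes t: "dtri T x y z f g h" and q: "\<guillemotleft>q : x \<rightarrow> t\<guillemotright>" and qh: "smap x t q \<cdot> h = 0"
  obtains r where "\<guillemotleft>r : y \<rightarrow> t\<guillemotright>" "r \<cdot> f = q"
proof -
  note d = dtriD[OF t]
  have to: "t \<in> Obj T" using q arr_tgt by blast
  obtain c where c: "\<guillemotleft>c : \<Sigma> y \<rightarrow> \<Sigma> t\<guillemotright>" "c \<cdot> (- smap x y f) = smap x t q"
    using factor_through_cone[OF rot[OF rot[OF t]] smap_arr[OF q] qh] by blast
  obtain r where r: "\<guillemotleft>r : y \<rightarrow> t\<guillemotright>" "smap y t r = - c"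
    using smap_full[OF d(2) to arr_neg[OF c(1)]] by blast
  have "smap x t (r \<cdot> f) = smap x t q"
    using smap_comp[OF r(1) d(4)] neg_comp[OF c(1) smap_arr[OF d(4)]]
      comp_neg[OF c(1) smap_arr[OF d(4)]] r(2) c(2) by simp
  then show ?thesis using that[OF r(1)] smap_faithful[OF arr_comp[OF r(1) d(4)] q] by blast
qed

lemma kernel_of_first:
  assumes t: "dtri T x y z f g h" and m: "\<guillemotleft>m : t \<rightarrow> x\<guillemotright>" and fm: "f \<cdot> m = 0"
  obtains k where "\<guillemotleft>k : \<Sigma> t \<rightarrow> z\<guillemotright>" "h \<cdot> k = smap t x m"
proof -
  note d = dtriD[OF t]
  have to: "t \<in> Obj T" using m arr_src by blast
  have "(- smap x y f) \<cdot> smap t x m = 0"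
    using neg_comp[OF smap_arr[OF d(4)] smap_arr[OF m]] smap_comp[OF d(4) m] fm smap_zero[OF to d(2)] by simp
  then show ?thesis
    using factor_through_cocone[OF rot[OF rot[OF t]] smap_arr[OF m]] that by blast
qed

lemma lift_to_second:
  assumes t: "dtri T x y z f g h" and b: "\<guillemotleft>b : t \<rightarrow> z\<guillemotright>" and hb: "h \<cdot> b = 0"
  obtains a where "\<guillemotleft>a : t \<rightarrow> y\<guillemotright>" "g \<cdot> a = b"
  using factor_through_cocone[OF rot[OF t] b hb] .

lemma kernel_of_second:
  assumes t: "dtri T x y z f g h" and b: "\<guillemotleft>b : z \<rightarrow> t\<guillemotright>" and bg: "b \<cdot> g = 0"
  obtains c where "\<guillemotleft>c : \<Sigma> x \<rightarrow> t\<guillemotright>" "c \<cdot> h = b"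
  using factor_through_cone[OF rot[OF t] b bg] .

definition tri where "tri x y z \<longleftrightarrow> (\<exists>f g h. dtri T x y z f g h)"

lemma triI: "dtri T x y z f g h \<Longrightarrow> tri x y z"
  by (auto simp: tri_def)

lemma tri_obj: "tri x y z \<Longrightarrow> x \<in> Obj T" "tri x y z \<Longrightarrow> y \<in> Obj T" "tri x y z \<Longrightarrow> z \<in> Obj T"
  using dtriD unfolding tri_def by blast+

lemma tri_rot: "tri x y z \<Longrightarrow> tri y z (\<Sigma> x)"
  unfolding tri_def using rot by blast

lemma tri_unrot: "\<lbrakk>tri y z (\<Sigma> x); x \<in> Obj T\<rbrakk> \<Longrightarrow> tri x y z"
  unfolding tri_def using unrot by metis

lemma tri_shift: "tri x y z \<Longrightarrow> tri (\<Sigma> x) (\<Sigma> y) (\<Sigma> z)"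
  using tri_rot by blast

lemma tri_shift_power: "tri x y z \<Longrightarrow> tri ((\<Sigma> ^^ n) x) ((\<Sigma> ^^ n) y) ((\<Sigma> ^^ n) z)"
  by (induction n) (simp_all add: tri_shift)

lemma tri_vanish_from:
  assumes "tri x y z" "hom T t x = {0}" "hom T t z = {0}" "t \<in> Obj T"
  shows "hom T t y = {0}"
proof (rule vanishI)
  obtain f g h where d: "dtri T x y z f g h" using assms(1) by (auto simp: tri_def)
  fix b assume b: "\<guillemotleft>b : t \<rightarrow> y\<guillemotright>"
  have "g \<cdot> b = 0" using vanishD[OF assms(3) arr_comp[OF dtriD(5)[OF d] b]] .
  then obtain a where a: "\<guillemotleft>a : t \<rightarrow> x\<guillemotright>" "f \<cdot> a = b" using factor_through_cocone[OF d b] by blast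
  then show "b = 0" using vanishD[OF assms(2) a(1)] comp_zero[OF dtriD(4)[OF d] assms(4)] by simp
qed (use assms tri_obj in auto)

lemma tri_vanish_to:
  assumes "tri x y z" "hom T x t = {0}" "hom T z t = {0}" "t \<in> Obj T"
  shows "hom T y t = {0}"
proof (rule vanishI)
  obtain f g h where d: "dtri T x y z f g h" using assms(1) by (auto simp: tri_def)
  fix b assume b: "\<guillemotleft>b : y \<rightarrow> t\<guillemotright>"
  have "b \<cdot> f = 0" using vanishD[OF assms(2) arr_comp[OF b dtriD(4)[OF d]]] .
  then obtain c where c: "\<guillemotleft>c : z \<rightarrow> t\<guillemotright>" "c \<cdot> g = b" using factor_through_cone[OF d b] by blast
  then show "b = 0" using vanishD[OF assms(3) c(1)] zero_comp[OF dtriD(5)[OF d] assms(4)] by simp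
qed (use assms tri_obj in auto)

lemma replace_third:
  assumes t: "dtri T x y z f g h" and ob: "z' \<in> Obj T"
    and c: "\<guillemotleft>c : z \<rightarrow> z'\<guillemotright>" "\<guillemotleft>c' : z' \<rightarrow> z\<guillemotright>" "c' \<cdot> c = ident T z" "c \<cdot> c' = ident T z'"
  shows "dtri T x y z' f (c \<cdot> g) (h \<cdot> c')"
proof -
  note d = dtriD[OF t]
  have "is_iso T z z' c" using isoI c by blast
  then have "triangle_iso T (shift T) x y z f g h x y z' f (c \<cdot> g) (h \<cdot> c')"
    unfolding triangle_iso_def
    using iso_ident[OF d(1)] iso_ident[OF d(2)] comp_ident[OF d(4)] ident_comp[OF d(4)]
      smap_ident[OF d(1)] ident_comp[OF d(6)] cancel_right[OF c(2,1,3) d(6)]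
      comp_ident[OF arr_comp[OF c(1) d(5)]] by metis
  then show ?thesis
    using dtri_iso[OF t] d ob arr_comp[OF c(1) d(5)] arr_comp[OF d(6) c(2)] by (simp add: arrow_def)
qed

lemma replace_second:
  assumes t: "dtri T x y z f g h" and ob: "y' \<in> Obj T"
    and c: "\<guillemotleft>c : y \<rightarrow> y'\<guillemotright>" "\<guillemotleft>c' : y' \<rightarrow> y\<guillemotright>" "c' \<cdot> c = ident T y" "c \<cdot> c' = ident T y'"
  shows "dtri T x y' z (c \<cdot> f) (g \<cdot> c') h"
proof -
  note d = dtriD[OF t]
  have "is_iso T y y' c" using isoI c by blast
  then have "triangle_iso T (shift T) x y z f g h x y' z (c \<cdot> f) (g \<cdot> c') h"
    unfolding triangle_iso_def
    using iso_ident[OF d(1)] iso_ident[OF d(3)] ident_comp[OF d(5)]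
      smap_ident[OF d(1)] ident_comp[OF d(6)] comp_ident[OF d(6)] cancel_right[OF c(2,1,3) d(5)]
      comp_ident[OF arr_comp[OF c(1) d(4)]] by metis
  then show ?thesis
    using dtri_iso[OF t] d ob arr_comp[OF c(1) d(4)] arr_comp[OF d(5) c(2)] by (simp add: arrow_def)
qed

lemma complete_second:
  assumes g: "\<guillemotleft>g : y \<rightarrow> z\<guillemotright>"
  obtains x f h where "dtri T x y z f g h"
proof -
  have ob: "y \<in> Obj T" "z \<in> Obj T" using g arr_src arr_tgt by blast+
  obtain c h k where t: "dtri T y z c g h k" using dtri_complete[OF ob arr_hom[OF g]] by blast
  have co: "c \<in> Obj T" using dtriD[OF t] by blast
  obtain x where x: "x \<in> Obj T" "isomorphic T (\<Sigma> x) c" using shift_surj[OF co] by blast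
  obtain e e' where e: "\<guillemotleft>e : \<Sigma> x \<rightarrow> c\<guillemotright>" "\<guillemotleft>e' : c \<rightarrow> \<Sigma> x\<guillemotright>" "e' \<cdot> e = ident T (\<Sigma> x)" "e \<cdot> e' = ident T c"
    using x(2) isoE shift_obj[OF x(1)] co unfolding isomorphic_def by metis
  show ?thesis
    by (rule unrot[OF replace_third[OF t shift_obj[OF x(1)] e(2,1,4,3)] x(1)]) (rule that)
qed

lemma complete_third:
  assumes h: "\<guillemotleft>h : z \<rightarrow> \<Sigma> x\<guillemotright>" and x: "x \<in> Obj T"
  obtains y f g where "dtri T x y z f g h"
proof -
  obtain y g k where t: "dtri T y z (\<Sigma> x) g h k" using complete_second[OF h] by blast
  show ?thesis by (rule unrot[OF t x]) (rule that)
qed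

lemma zero_cone_iso:
  assumes t: "dtri T x y z f g h" and z: "zero_object T z"
  shows "is_iso T x y f"
proof -
  note d = dtriD[OF t]
  have gh: "g = 0" "h = 0" using zero_object_tgt[OF z d(5)] zero_object_src[OF z d(6)] by auto
  have "g \<cdot> ident T y = 0" using comp_ident[OF d(5)] gh by simp
  then obtain r where r: "\<guillemotleft>r : y \<rightarrow> x\<guillemotright>" "f \<cdot> r = ident T y"
    using factor_through_cocone[OF t arr_ident[OF d(2)]] by blast
  have "smap x x (ident T x) \<cdot> h = 0"
    using comp_zero[OF smap_arr[OF arr_ident[OF d(1)]] d(3)] gh by simp
  then obtain r' where r': "\<guillemotleft>r' : y \<rightarrow> x\<guillemotright>" "r' \<cdot> f = ident T x"
    using extend_along_first[OF t arr_ident[OF d(1)]] by blast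
  show ?thesis using isomorphism_of_retractions[OF d(4) r'(1) r(1) r'(2) r(2)] .
qed

text \<open>
  The difference \<open>e - 1\<close> vanishes after \<open>g\<close>, hence factors through \<open>h\<close>; as \<open>h\<close> kills it on the other
  side, its square is zero.
\<close>

lemma third_endo_invertible:
  assumes t: "dtri T x y z f g h" and e: "\<guillemotleft>e : z \<rightarrow> z\<guillemotright>" "e \<cdot> g = g" "h \<cdot> e = h"
  obtains e' where "\<guillemotleft>e' : z \<rightarrow> z\<guillemotright>" "e' \<cdot> e = ident T z" "e \<cdot> e' = ident T z"
proof -
  note d = dtriD[OF t]
  note i = arr_ident[OF d(3)]
  let ?n = "e - ident T z"
  have n: "\<guillemotleft>?n : z \<rightarrow> z\<guillemotright>" using arr_diff[OF e(1) i] .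
  have ng: "?n \<cdot> g = 0" by (simp add: diff_comp[OF e(1) i d(5)] e(2) ident_comp[OF d(5)])
  have hn: "h \<cdot> ?n = 0" by (simp add: comp_diff[OF d(6) e(1) i] e(3) comp_ident[OF d(6)])
  obtain k where k: "\<guillemotleft>k : \<Sigma> x \<rightarrow> z\<guillemotright>" "k \<cdot> h = ?n" using kernel_of_second[OF t n ng] by blast
  have "?n \<cdot> ?n = 0" using assoc[OF k(1) d(6) n] k(2) hn comp_zero[OF k(1) d(3)] by metis
  then show ?thesis using unipotent_iso[OF e(1)] that by blast
qed

lemma cone_unique:
  assumes t: "dtri T x y z f g h" and t': "dtri T x y z' f g' h'"
  shows "isomorphic T z z'"
proof -
  note d = dtriD[OF t] and d' = dtriD[OF t']
  have eq: "ident T y \<cdot> f = f \<cdot> ident T x" using comp_ident[OF d(4)] ident_comp[OF d(4)] by simp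
  obtain c where c0: "c \<in> hom T z z'" "c \<cdot> g = g' \<cdot> ident T y" "smap x x (ident T x) \<cdot> h = h' \<cdot> c"
    using dtri_morphism[OF t t' ident_hom[OF d(1)] ident_hom[OF d(2)] eq] by blast
  obtain c' where c0': "c' \<in> hom T z' z" "c' \<cdot> g' = g \<cdot> ident T y" "smap x x (ident T x) \<cdot> h' = h \<cdot> c'"
    using dtri_morphism[OF t' t ident_hom[OF d(1)] ident_hom[OF d(2)] eq] by blast
  have c: "\<guillemotleft>c : z \<rightarrow> z'\<guillemotright>" using c0(1) d(3) d'(3) by (simp add: arrow_def)
  have cg: "c \<cdot> g = g'" using c0(2) comp_ident[OF d'(5)] by simp
  have hc: "h' \<cdot> c = h" using c0(3) smap_ident[OF d(1)] ident_comp[OF d(6)] by simp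
  have c': "\<guillemotleft>c' : z' \<rightarrow> z\<guillemotright>" using c0'(1) d(3) d'(3) by (simp add: arrow_def)
  have cg': "c' \<cdot> g' = g" using c0'(2) comp_ident[OF d(5)] by simp
  have hc': "h \<cdot> c' = h'" using c0'(3) smap_ident[OF d(1)] ident_comp[OF d'(6)] by simp
  have "(c' \<cdot> c) \<cdot> g = g" using assoc[OF c' c d(5)] cg cg' by simp
  moreover have "h \<cdot> (c' \<cdot> c) = h" using assoc[OF d(6) c' c] hc hc' by simp
  ultimately obtain e where e: "\<guillemotleft>e : z \<rightarrow> z\<guillemotright>" "e \<cdot> (c' \<cdot> c) = ident T z"
    using third_endo_invertible[OF t arr_comp[OF c' c]] by blast
  have "(c \<cdot> c') \<cdot> g' = g'" using assoc[OF c c' d'(5)] cg cg' by simp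
  moreover have "h' \<cdot> (c \<cdot> c') = h'" using assoc[OF d'(6) c c'] hc hc' by simp
  ultimately obtain e' where e': "\<guillemotleft>e' : z' \<rightarrow> z'\<guillemotright>" "(c \<cdot> c') \<cdot> e' = ident T z'"
    using third_endo_invertible[OF t' arr_comp[OF c c']] by blast
  have "is_iso T z z' c"
    using isomorphism_of_retractions[OF c arr_comp[OF e(1) c'] arr_comp[OF c' e'(1)]]
      assoc[OF e(1) c' c] assoc[OF c c' e'(1)] e(2) e'(2) by simp
  then show ?thesis by (auto simp: isomorphic_def)
qed

lemma cocone_unique:
  assumes t: "dtri T x y z f g h" and t': "dtri T x' y z f' g h'"
  shows "isomorphic T x x'"
  using fully_faithful_reflects_iso[OF shift_linear shift_ff dtriD(1)[OF t] dtriD(1)[OF t']]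
    cone_unique[OF rot[OF t] rot[OF t']] by blast

lemma octahedral_cones:
  assumes "dtri T x y a f f1 f2" "dtri T y z b g g1 g2" "dtri T x z c (g \<cdot> f) k1 k2"
  shows "tri a c b"
  using octahedral[OF assms] triI by blast

text \<open>
  The octahedral axiom with \<open>g\<close> and \<open>g \<cdot> f\<close> completed on the left: \<open>a\<close> and \<open>c\<close> are the cocones of \<open>g \<cdot> f\<close> and
  \<open>g\<close>. The octahedron for the rotated triangles yields the claim up to one shift.
\<close>

lemma octahedral_cocones:
  assumes f: "dtri T x y b f f1 f2" and g: "dtri T c y z g1 g g2" and gf: "dtri T a x z k1 (g \<cdot> f) k2"
  shows "tri a c b"
proof -
  have "tri b (\<Sigma> a) (\<Sigma> c)" using octahedral_cones[OF f rot[OF g] rot[OF gf]] .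
  then show ?thesis using tri_unrot dtriD(1)[OF g] dtriD(1)[OF gf] by blast
qed

text \<open>
  Associativity of extensions: filtering the third term of an extension filters the extension itself.
  It is the octahedron on \<open>y' \<rightarrow> y \<rightarrow> \<Sigma>x\<close>.
\<close>

lemma star_assoc:
  assumes "tri x e y" "tri y' y z"
  obtains e' where "tri x e' y'" "tri e' e z"
proof -
  obtain f g h where t: "dtri T x e y f g h" using assms(1) by (auto simp: tri_def)
  obtain a b c where s: "dtri T y' y z a b c" using assms(2) by (auto simp: tri_def)
  note d = dtriD[OF t] and d' = dtriD[OF s]
  obtain e' k l where u: "dtri T x e' y' k l (h \<cdot> a)"
    using complete_third[OF arr_comp[OF d(6) d'(4)] d(1)] by blast
  have "tri z (\<Sigma> e') (\<Sigma> e)" using octahedral_cones[OF s rot[OF rot[OF t]] rot[OF rot[OF u]]] .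
  then have "tri e' e z" using tri_unrot d(2) dtriD(2)[OF u] by blast
  then show ?thesis using that triI[OF u] by blast
qed

text \<open>
  The form in which comparison maps enter: seen from the test object \<open>u\<close>, the map \<open>m\<close> is an isomorphism.
\<close>

definition bijective_from where
  "bijective_from u a b m \<longleftrightarrow> (\<forall>g. \<guillemotleft>g : u \<rightarrow> b\<guillemotright> \<longrightarrow> (\<exists>!f. \<guillemotleft>f : u \<rightarrow> a\<guillemotright> \<and> m \<cdot> f = g))"

lemma bijective_from_cone:
  assumes t: "dtri T s a b \<alpha> \<beta> \<gamma>" and "hom T u s = {0}" "hom T u (\<Sigma> s) = {0}" "u \<in> Obj T"
  shows "bijective_from u a b \<beta>"
  unfolding bijective_from_def
proof (intro allI impI)
  fix g assume g: "\<guillemotleft>g : u \<rightarrow> b\<guillemotright>"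
  note d = dtriD[OF t]
  have "\<gamma> \<cdot> g = 0" using vanishD[OF assms(3) arr_comp[OF d(6) g]] .
  then obtain f where f: "\<guillemotleft>f : u \<rightarrow> a\<guillemotright>" "\<beta> \<cdot> f = g" using lift_to_second[OF t g] by blast
  moreover have "f' = f" if f': "\<guillemotleft>f' : u \<rightarrow> a\<guillemotright>" "\<beta> \<cdot> f' = g" for f'
  proof -
    have "\<beta> \<cdot> (f' - f) = 0" using comp_diff[OF d(5) f'(1) f(1)] f f' by simp
    then obtain k where k: "\<guillemotleft>k : u \<rightarrow> s\<guillemotright>" "\<alpha> \<cdot> k = f' - f"
      using factor_through_cocone[OF t arr_diff[OF f'(1) f(1)]] by blast
    then show ?thesis using vanishD[OF assms(2) k(1)] comp_zero[OF d(4) assms(4)] by simp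
  qed
  ultimately show "\<exists>!f. \<guillemotleft>f : u \<rightarrow> a\<guillemotright> \<and> \<beta> \<cdot> f = g" by blast
qed

lemma extend_over_cone:
  assumes t: "dtri T s a b \<alpha> \<beta> \<gamma>" and s: "hom T s z = {0}" and p: "\<guillemotleft>p : a \<rightarrow> z\<guillemotright>"
  shows "\<exists>c. \<guillemotleft>c : b \<rightarrow> z\<guillemotright> \<and> c \<cdot> \<beta> = p"
  using factor_through_cone[OF t p] vanishD[OF s arr_comp[OF p dtriD(4)[OF t]]] by blast

lemma cone_cancel:
  assumes t: "dtri T s a b \<alpha> \<beta> \<gamma>" and s: "hom T (\<Sigma> s) z = {0}"
    and c: "\<guillemotleft>c : b \<rightarrow> z\<guillemotright>" "\<guillemotleft>c' : b \<rightarrow> z\<guillemotright>" "c \<cdot> \<beta> = c' \<cdot> \<beta>"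
  shows "c = c'"
proof -
  have "(c - c') \<cdot> \<beta> = 0" using diff_comp[OF c(1,2) dtriD(5)[OF t]] c(3) by simp
  then obtain k where k: "\<guillemotleft>k : \<Sigma> s \<rightarrow> z\<guillemotright>" "k \<cdot> \<gamma> = c - c'"
    using kernel_of_second[OF t arr_diff[OF c(1,2)]] by blast
  then show ?thesis
    using vanishD[OF s k(1)] zero_comp[OF dtriD(6)[OF t] arr_tgt[OF c(1)]] by simp
qed

lemma shift_power_obj: "x \<in> Obj T \<Longrightarrow> (\<Sigma> ^^ n) x \<in> Obj T"
  by (induction n) (simp_all add: shift_obj)

lemma vanish_shift:
  assumes ob: "x \<in> Obj T" "y \<in> Obj T"
  shows "hom T (\<Sigma> x) (\<Sigma> y) = {0} \<longleftrightarrow> hom T x y = {0}"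
proof
  assume h: "hom T (\<Sigma> x) (\<Sigma> y) = {0}"
  show "hom T x y = {0}"
    using vanishI[OF ob] smap_eq_0 vanishD[OF h smap_arr] by blast
next
  assume h: "hom T x y = {0}"
  show "hom T (\<Sigma> x) (\<Sigma> y) = {0}"
  proof (rule vanishI)
    fix g assume "\<guillemotleft>g : \<Sigma> x \<rightarrow> \<Sigma> y\<guillemotright>"
    then obtain f where "\<guillemotleft>f : x \<rightarrow> y\<guillemotright>" "smap x y f = g" using smap_full ob by blast
    then show "g = 0" using vanishD[OF h] smap_zero[OF ob] by metis
  qed (use ob shift_obj in auto)
qed

lemma vanish_shift_power:
  "\<lbrakk>x \<in> Obj T; y \<in> Obj T\<rbrakk> \<Longrightarrow> hom T ((\<Sigma> ^^ n) x) ((\<Sigma> ^^ n) y) = {0} \<longleftrightarrow> hom T x y = {0}"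
  by (induction n) (simp_all add: vanish_shift shift_power_obj)

end

section \<open>The extension closure of an orthogonal collection\<close>

text \<open>
  In a Hom-space of dimension one all nonzero elements are multiples of each other, so if one is
  invertible then so are the others.
\<close>

lemma (in linear_category) one_dim_schur:
  assumes dim: "dim (hom C x y) = (if isomorphic C x y then 1 else 0)"
    and fin: "\<exists>B. finite B \<and> hom C x y = span B"
    and f: "\<guillemotleft>f : x \<rightarrow> y\<guillemotright>" and nz: "f \<noteq> 0"
  shows "is_iso C x y f"
proof -
  have ob: "x \<in> Obj C" "y \<in> Obj C" using f arr_src arr_tgt by blast+
  obtain B where B: "B \<subseteq> hom C x y" "independent B" "hom C x y \<subseteq> span B" "card B = dim (hom C x y)"
    using basis_exists[of "hom C x y"] by metis
  have finB: "finite B"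
  proof -
    obtain B' where "finite B'" "hom C x y = span B'" using fin by blast
    then show ?thesis using independent_span_bound[of B' B] B by blast
  qed
  have "B \<noteq> {}" using B(3) arr_hom[OF f] nz by auto
  then have "card B \<noteq> 0" using finB by simp
  then have iso: "isomorphic C x y" and c1: "card B = 1" using B(4) dim by (auto split: if_splits)
  obtain b where b: "B = {b}" using c1 card_1_singletonE by blast
  obtain k where k: "is_iso C x y k" using iso by (auto simp: isomorphic_def)
  obtain l where l: "\<guillemotleft>k : x \<rightarrow> y\<guillemotright>" "\<guillemotleft>l : y \<rightarrow> x\<guillemotright>" "l \<cdot> k = ident C x" "k \<cdot> l = ident C y" using isoE[OF k ob] by metis
  obtain \<alpha> \<beta> where \<alpha>: "f = smul C \<alpha> b" and \<beta>: "k = smul C \<beta> b"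
    using B(3) arr_hom[OF f] arr_hom[OF l(1)] unfolding b span_singleton by blast
  have "\<alpha> \<noteq> 0" using \<alpha> nz by auto
  have "\<beta> \<noteq> 0"
  proof
    assume "\<beta> = 0"
    then have "k = 0" using \<beta> by simp
    then have "ident C x = 0" using l zero_comp[OF l(1)] comp_zero[OF l(2) ob(1)] by simp
    then have "f = 0" using comp_ident[OF f] comp_zero[OF f ob(1)] by simp
    then show False using nz by simp
  qed
  then have fk: "f = smul C (\<alpha> / \<beta>) k" using \<alpha> \<beta> by simp
  have g: "\<guillemotleft>smul C (\<beta> / \<alpha>) l : y \<rightarrow> x\<guillemotright>" using arr_smul[OF l(2)] .
  show ?thesis
    by (rule isoI[OF f g])
      (use \<open>\<alpha> \<noteq> 0\<close> \<open>\<beta> \<noteq> 0\<close> l arr_smul[OF l(1)] arr_smul[OF l(2)] in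
        \<open>simp_all add: fk smul_comp[OF l(2) arr_smul[OF l(1)]] comp_smul[OF l(2,1)]
          smul_comp[OF l(1) arr_smul[OF l(2)]] comp_smul[OF l(1,2)]\<close>)
qed

text \<open>
  The objects with a filtration of length \<open>n\<close> whose subquotients lie in \<open>S\<close>. Keeping track of the length
  gives induction over the extension closure, and a measure of minimality for approximations.
\<close>

primrec extensions ::
  "('k, 'o, 'm::zero, 'z) tri_cat_scheme \<Rightarrow> 'o set \<Rightarrow> nat \<Rightarrow> 'o set" where
  "extensions T S 0 = {x. zero_object T x}"
| "extensions T S (Suc n) = star T (extensions T S n) S"

context triangulated_category
begin

lemma star_iff: "d \<in> star T X Y \<longleftrightarrow> (\<exists>x\<in>X. \<exists>y\<in>Y. tri x d y)"
  unfolding star_def tri_def using dtriD(2) by blast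

lemma tri_iso_second:
  assumes "tri x y z" "isomorphic T y y'" "y' \<in> Obj T"
  shows "tri x y' z"
  using assms isoE tri_obj(2)[OF assms(1)] replace_second unfolding tri_def isomorphic_def by metis

lemma tri_zero_iso: "\<lbrakk>tri x y z; zero_object T z\<rbrakk> \<Longrightarrow> isomorphic T x y"
  using zero_cone_iso unfolding tri_def isomorphic_def by blast

end

text \<open>
  The part of orthogonality that makes the members of \<open>S\<close> behave like simple objects.
\<close>

locale schur_collection = triangulated_category T
  for T :: "('k::field, 'o, 'm::ab_group_add, 'z) tri_cat_scheme" (structure) +
  fixes S :: "'o set"
  assumes S_obj: "S \<subseteq> Obj T"
    and schur: "\<lbrakk>x \<in> S; y \<in> S; \<guillemotleft>f : x \<rightarrow> y\<guillemotright>; f \<noteq> 0\<rbrakk> \<Longrightarrow> is_iso T x y f"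
begin

abbreviation filt where "filt \<equiv> extensions T S"
abbreviation ext where "ext \<equiv> extension_closure T S"

lemma filt_obj: "filt n \<subseteq> Obj T"
  by (cases n) (auto simp: zero_object_def star_def)

lemma filt_iso: "\<lbrakk>x \<in> filt n; isomorphic T x y; y \<in> Obj T\<rbrakk> \<Longrightarrow> y \<in> filt n"
  using tri_iso_second zero_object_iso by (cases n) (simp_all add: star_iff, blast+)

lemma filt_star: "\<lbrakk>tri x e y; x \<in> (\<Union>n. filt n); y \<in> filt k\<rbrakk> \<Longrightarrow> e \<in> (\<Union>n. filt n)"
proof (induction k arbitrary: e y)
  case 0
  then show ?case using tri_zero_iso filt_iso tri_obj(2) by fastforce
next
  case (Suc k)
  then obtain y' z where yz: "y' \<in> filt k" "z \<in> S" "tri y' y z" by (auto simp: star_iff)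
  obtain e' where e': "tri x e' y'" "tri e' e z" using star_assoc[OF Suc.prems(1) yz(3)] by blast
  obtain n where "e' \<in> filt n" using Suc.IH[OF e'(1) Suc.prems(2) yz(1)] by blast
  then have "e \<in> filt (Suc n)" using e' yz by (auto simp: star_iff)
  then show ?case by blast
qed

lemma S_filt: "s \<in> S \<Longrightarrow> s \<in> filt (Suc 0)"
proof -
  assume s: "s \<in> S"
  obtain z where z: "zero_object T z" using zero_exists by blast
  have "tri z s s" using triI[OF dtri_zero_src[OF _ z]] s S_obj by blast
  then show "s \<in> filt (Suc 0)" using z s by (auto simp: star_iff)
qed

lemma extension_closed_filt: "extension_closed T (\<Union>n. filt n)"
  unfolding extension_closed_def
proof (intro conjI)
  show "strict_subcat T (\<Union>n. filt n)"
    unfolding strict_subcat_def using filt_obj filt_iso by blast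
  show "{x. zero_object T x} \<subseteq> (\<Union>n. filt n)"
  proof
    fix x assume "x \<in> {x. zero_object T x}"
    then have "x \<in> filt 0" by simp
    then show "x \<in> (\<Union>n. filt n)" by blast
  qed
  show "star T (\<Union>n. filt n) (\<Union>n. filt n) = (\<Union>n. filt n)"
  proof (intro equalityI subsetI)
    show "e \<in> (\<Union>n. filt n)" if "e \<in> star T (\<Union>n. filt n) (\<Union>n. filt n)" for e
      using that filt_star unfolding star_iff by blast
    fix e assume e: "e \<in> (\<Union>n. filt n)"
    obtain z where z: "zero_object T z" using zero_exists by blast
    have "e \<in> Obj T" using e filt_obj by blast
    then have "tri e e z" using dtri_ident[OF _ z] triI by blast
    moreover have "z \<in> filt 0" using z by simp
    ultimately show "e \<in> star T (\<Union>n. filt n) (\<Union>n. filt n)" using e unfolding star_iff by blast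
  qed
qed

text \<open>
  Finite filtrations compose by \<open>star_assoc\<close>, so they already exhaust the extension closure.
\<close>

lemma ext_eq: "ext = (\<Union>n. filt n)"
proof
  show "ext \<subseteq> (\<Union>n. filt n)"
    unfolding extension_closure_def using extension_closed_filt S_filt by blast
  have "filt n \<subseteq> Y" if Y: "extension_closed T Y" "S \<subseteq> Y" for Y n
  proof (induction n)
    case 0
    then show ?case using Y by (simp add: extension_closed_def)
  next
    case (Suc n)
    have "star T Y Y = Y" using Y by (simp add: extension_closed_def)
    then show ?case using Suc Y unfolding extensions.simps star_def by blast
  qed
  then show "(\<Union>n. filt n) \<subseteq> ext" unfolding extension_closure_def by blast
qed

lemma ext_obj: "ext \<subseteq> Obj T"
  using ext_eq filt_obj by blast

lemma S_ext: "S \<subseteq> ext"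
  using ext_eq S_filt by blast

lemma ext_star: "\<lbrakk>tri x e y; x \<in> ext; y \<in> ext\<rbrakk> \<Longrightarrow> e \<in> ext"
  using filt_star unfolding ext_eq by blast

lemma ext_induct [consumes 1, case_names zero extend]:
  assumes "e \<in> ext" and z: "\<And>z. zero_object T z \<Longrightarrow> P z"
    and "\<And>t e u. \<lbrakk>t \<in> ext; P t; u \<in> S; tri t e u\<rbrakk> \<Longrightarrow> P e"
  shows "P e"
proof -
  have "P e" if "e \<in> filt n" for n e
    using that
  proof (induction n arbitrary: e)
    case (Suc n)
    then obtain t u where "t \<in> filt n" "u \<in> S" "tri t e u" by (auto simp: star_iff)
    then show ?case using Suc.IH assms(3) ext_eq by blast
  qed (use z in auto)
  then show ?thesis using assms(1) ext_eq by blast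
qed

lemma ext_vanish_from:
  assumes e: "e \<in> ext" and x: "x \<in> Obj T" and S: "\<And>s. s \<in> S \<Longrightarrow> hom T x ((\<Sigma> ^^ n) s) = {0}"
  shows "hom T x ((\<Sigma> ^^ n) e) = {0}"
  using e
proof (induction rule: ext_induct)
  case (zero z)
  have "zero_object T ((\<Sigma> ^^ n) z)" using zero by (induction n) (auto simp: zero_shift)
  then show ?case using vanishI[OF x] zero_object_tgt by (auto simp: zero_object_def)
next
  case (extend t e u)
  then show ?case using tri_vanish_from[OF tri_shift_power] S x by blast
qed

lemma ext_vanish_to:
  assumes e: "e \<in> ext" and x: "x \<in> Obj T" and S: "\<And>s. s \<in> S \<Longrightarrow> hom T ((\<Sigma> ^^ n) s) x = {0}"
  shows "hom T ((\<Sigma> ^^ n) e) x = {0}"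
  using e
proof (induction rule: ext_induct)
  case (zero z)
  have "zero_object T ((\<Sigma> ^^ n) z)" using zero by (induction n) (auto simp: zero_shift)
  then show ?case using vanishI[OF _ x] zero_object_src by (auto simp: zero_object_def)
next
  case (extend t e u)
  then show ?case using tri_vanish_to[OF tri_shift_power] S x by blast
qed

text \<open>
  Maps out of a simple object are monomorphisms as far as the extension closure is concerned: a nonzero
  one has its cone there. Let \<open>u\<close> be the last subquotient of \<open>s\<close>. If \<open>s0 \<rightarrow> s \<rightarrow> u\<close> is nonzero, it is
  invertible by Schur's lemma and the cone is the rest \<open>t\<close> of the filtration. Otherwise the map factors
  through \<open>t\<close>, and its cone is an extension of \<open>u\<close> by the cone of the factor.
\<close>

lemma nonzero_from_simple_cone:
  assumes "s \<in> ext" "s0 \<in> S" "dtri T s0 s c \<phi> g h" "\<phi> \<noteq> 0"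
  shows "c \<in> ext"
  using assms
proof (induction arbitrary: \<phi> c g h rule: ext_induct)
  case (zero s)
  then show ?case using zero_object_tgt dtriD(4) by blast
next
  case (extend t s u)
  then obtain f1 f2 f3 where f: "dtri T t s u f1 f2 f3" by (auto simp: tri_def)
  note d = dtriD[OF f] and d' = dtriD[OF extend.prems(2)]
  obtain z where z: "zero_object T z" using zero_exists by blast
  have zext: "z \<in> filt 0" using z by simp
  show ?case
  proof (cases "f2 \<cdot> \<phi> = 0")
    case True
    obtain \<psi> where \<psi>: "\<guillemotleft>\<psi> : s0 \<rightarrow> t\<guillemotright>" "f1 \<cdot> \<psi> = \<phi>"
      using factor_through_cocone[OF f d'(4) True] by blast
    have "\<psi> \<noteq> 0" using \<psi> comp_zero[OF d(4) d'(1)] extend.prems(3) by blast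
    moreover obtain c' k l where k: "dtri T s0 t c' \<psi> k l"
      using dtri_complete[OF d'(1) d(1) arr_hom[OF \<psi>(1)]] by blast
    ultimately have "c' \<in> ext" using extend.IH[OF extend.prems(1)] by blast
    moreover have "tri c' c u" using octahedral_cones[OF k f] extend.prems(2) \<psi>(2) by blast
    ultimately show ?thesis using ext_star S_ext extend.hyps by blast
  next
    case False
    let ?p = "f2 \<cdot> \<phi>"
    have p: "\<guillemotleft>?p : s0 \<rightarrow> u\<guillemotright>" using arr_comp[OF d(5) d'(4)] .
    then obtain q where q: "\<guillemotleft>q : u \<rightarrow> s0\<guillemotright>" "q \<cdot> ?p = ident T s0" "?p \<cdot> q = ident T u"
      using isoE[OF schur[OF extend.prems(1) extend.hyps(2) p False] d'(1) d(3)] by metis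
    \<comment> \<open>The composite \<open>?p\<close> is invertible, so its cone is zero, and the octahedron on \<open>s0 \<rightarrow> s \<rightarrow> u\<close> identifies \<open>c\<close> with \<open>t\<close>.\<close>
    have "dtri T s0 u z ?p (0 \<cdot> q) 0"
      using replace_second[OF dtri_ident[OF d'(1) z] d(3) p q] comp_ident[OF p] by simp
    then have "tri c z (\<Sigma> t)" using octahedral_cones[OF extend.prems(2) rot[OF f]] by blast
    then have "tri t c z" using tri_unrot d(1) by blast
    then show ?thesis using ext_star extend.hyps(1) zext ext_eq by blast
  qed
qed

text \<open>
  Dually for maps into a simple object. The drop in length is what will contradict the choice of a left
  approximation of minimal length. The case distinction is on the restriction of \<open>\<phi>\<close> to \<open>t\<close>.
\<close>

lemma nonzero_to_simple_cocone:
  assumes "s \<in> filt n" "s0 \<in> S" "dtri T c s s0 i \<phi> h" "\<phi> \<noteq> 0"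
  shows "\<exists>m<n. c \<in> filt m"
  using assms
proof (induction n arbitrary: s \<phi> c i h)
  case 0
  then show ?case using zero_object_src dtriD(5) by fastforce
next
  case (Suc n)
  then obtain t u f1 f2 f3 where t: "t \<in> filt n" "u \<in> S" and f: "dtri T t s u f1 f2 f3"
    by (auto simp: star_iff tri_def)
  note d = dtriD[OF f] and d' = dtriD[OF Suc.prems(3)]
  show ?case
  proof (cases "\<phi> \<cdot> f1 = 0")
    case True
    obtain \<psi> where \<psi>: "\<guillemotleft>\<psi> : u \<rightarrow> s0\<guillemotright>" "\<psi> \<cdot> f2 = \<phi>"
      using factor_through_cone[OF f d'(5) True] by blast
    have "\<psi> \<noteq> 0" using \<psi> zero_comp[OF d(5) d'(3)] Suc.prems(4) by blast
    then obtain q where q: "\<guillemotleft>q : s0 \<rightarrow> u\<guillemotright>" "q \<cdot> \<psi> = ident T u" "\<psi> \<cdot> q = ident T s0"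
      using isoE[OF schur[OF t(2) Suc.prems(2) \<psi>(1)] d(3) d'(3)] by metis
    have "dtri T t s s0 f1 \<phi> (f3 \<cdot> q)" using replace_third[OF f d'(3) \<psi>(1) q] \<psi>(2) by simp
    then have "isomorphic T t c" using cocone_unique Suc.prems(3) by blast
    then show ?thesis using filt_iso[OF t(1)] d'(1) by blast
  next
    case False
    have p: "\<guillemotleft>\<phi> \<cdot> f1 : t \<rightarrow> s0\<guillemotright>" using arr_comp[OF d'(5) d(4)] .
    obtain c' k l where k: "dtri T c' t s0 k (\<phi> \<cdot> f1) l" using complete_second[OF p] by blast
    obtain m where m: "m < n" "c' \<in> filt m" using Suc.IH[OF t(1) Suc.prems(2) k False] by blast
    have "tri c' c u" using octahedral_cocones[OF f Suc.prems(3) k] .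
    then have "c \<in> filt (Suc m)" using m t by (auto simp: star_iff)
    then show ?thesis using m by blast
  qed
qed


section \<open>Approximations by the extension closure\<close>

text \<open>
  If \<open>\<alpha>\<close> killed a nonzero map \<open>\<phi>\<close> from a simple object, then \<open>\<alpha>\<close> would factor through the cone of \<open>\<phi>\<close>, which lies
  in the extension closure; the approximation property turns this into an endomorphism fixing \<open>\<alpha>\<close> but
  killing \<open>\<phi>\<close>, against minimality. The passage from simple objects to all \<open>t\<close> uses that maps
  \<open>\<Sigma>t \<rightarrow> d\<close> vanish.
\<close>

lemma min_right_approx_mono:
  assumes ap: "min_right_approx T ext s d \<alpha>" and d: "d \<in> Obj T"
    and ort: "\<And>u. u \<in> S \<Longrightarrow> hom T (\<Sigma> u) d = {0}"
    and t: "t \<in> ext" and m: "\<guillemotleft>m : t \<rightarrow> s\<guillemotright>" and \<alpha>m: "\<alpha> \<cdot> m = 0"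
  shows "m = 0"
proof -
  have s: "s \<in> ext" and \<alpha>: "\<guillemotleft>\<alpha> : s \<rightarrow> d\<guillemotright>"
    and fac: "\<And>x f. \<lbrakk>x \<in> ext; \<guillemotleft>f : x \<rightarrow> d\<guillemotright>\<rbrakk> \<Longrightarrow> \<exists>g. \<guillemotleft>g : x \<rightarrow> s\<guillemotright> \<and> \<alpha> \<cdot> g = f"
    and minimal: "\<And>g. \<lbrakk>\<guillemotleft>g : s \<rightarrow> s\<guillemotright>; \<alpha> \<cdot> g = \<alpha>\<rbrakk> \<Longrightarrow> is_iso T s s g"
    using ap ext_obj d unfolding min_right_approx_def right_approx_def right_minimal_def arrow_def by blast+
  have so: "s \<in> Obj T" using s ext_obj by blast
  have simple: "\<phi> = 0" if s0: "s0 \<in> S" and \<phi>: "\<guillemotleft>\<phi> : s0 \<rightarrow> s\<guillemotright>" and \<alpha>\<phi>: "\<alpha> \<cdot> \<phi> = 0" for s0 \<phi>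
  proof (rule ccontr)
    assume n: "\<phi> \<noteq> 0"
    have s0o: "s0 \<in> Obj T" using s0 S_obj by blast
    \<comment> \<open>The map \<open>k \<cdot> g\<close> below fixes \<open>\<alpha>\<close> although it kills \<open>\<phi>\<close>.\<close>
    obtain c g h where t: "dtri T s0 s c \<phi> g h" using dtri_complete[OF s0o so arr_hom[OF \<phi>]] by blast
    note dt = dtriD[OF t]
    have c: "c \<in> ext" using nonzero_from_simple_cone[OF s s0 t n] .
    obtain \<alpha>' where \<alpha>': "\<guillemotleft>\<alpha>' : c \<rightarrow> d\<guillemotright>" "\<alpha>' \<cdot> g = \<alpha>" using factor_through_cone[OF t \<alpha> \<alpha>\<phi>] by blast
    obtain k where k: "\<guillemotleft>k : c \<rightarrow> s\<guillemotright>" "\<alpha> \<cdot> k = \<alpha>'" using fac[OF c \<alpha>'(1)] by blast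
    have kg: "\<guillemotleft>k \<cdot> g : s \<rightarrow> s\<guillemotright>" using arr_comp[OF k(1) dt(5)] .
    have "\<alpha> \<cdot> (k \<cdot> g) = \<alpha>" using assoc[OF \<alpha> k(1) dt(5)] k \<alpha>' by simp
    then have "is_iso T s s (k \<cdot> g)" using minimal[OF kg] by blast
    then obtain j where j: "\<guillemotleft>j : s \<rightarrow> s\<guillemotright>" "j \<cdot> (k \<cdot> g) = ident T s" using isoE so by metis
    have "(k \<cdot> g) \<cdot> \<phi> = 0"
      using assoc[OF k(1) dt(5) \<phi>] dtri_comp_zero[OF t] comp_zero[OF k(1) s0o] by simp
    then show False using cancel_left[OF j(1) kg j(2) \<phi>] comp_zero[OF j(1) s0o] n by simp
  qed
  show ?thesis
    using t m \<alpha>m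
  proof (induction arbitrary: m rule: ext_induct)
    case (zero t)
    then show ?case using zero_object_src by blast
  next
    case (extend t e u)
    then obtain f1 f2 f3 where f: "dtri T t e u f1 f2 f3" by (auto simp: tri_def)
    note df = dtriD[OF f]
    have "\<alpha> \<cdot> (m \<cdot> f1) = 0"
      using assoc[OF \<alpha> extend.prems(1) df(4)] zero_comp[OF df(4) d] extend.prems(2) by simp
    then have "m \<cdot> f1 = 0" using extend.IH[OF arr_comp[OF extend.prems(1) df(4)]] by blast
    then obtain m' where m': "\<guillemotleft>m' : u \<rightarrow> s\<guillemotright>" "m' \<cdot> f2 = m"
      using factor_through_cone[OF f extend.prems(1)] by blast
    have "(\<alpha> \<cdot> m') \<cdot> f2 = 0" using assoc[OF \<alpha> m'(1) df(5)] m' extend.prems(2) by simp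
    then obtain k where k: "\<guillemotleft>k : \<Sigma> t \<rightarrow> d\<guillemotright>" "k \<cdot> f3 = \<alpha> \<cdot> m'"
      using kernel_of_second[OF f arr_comp[OF \<alpha> m'(1)]] by blast
    have "hom T (\<Sigma> t) d = {0}" using ext_vanish_to[OF extend.hyps(1) d, of 1] ort by simp
    then have "\<alpha> \<cdot> m' = 0" using vanishD k zero_comp[OF df(6) d] by metis
    then have "m' = 0" using simple[OF extend.hyps(2) m'(1)] by blast
    then show ?case using m' zero_comp[OF df(5) so] by simp
  qed
qed

text \<open>
  A version of Wakamatsu's lemma. A map \<open>q\<close> from \<open>s0\<close> to the cone defines an extension \<open>e\<close> of \<open>s0\<close> by \<open>s\<close> to
  which \<open>\<alpha>\<close> extends. The approximation property then splits \<open>s \<rightarrow> e\<close>, so \<open>q\<close> lifts to \<open>d\<close>, hence to \<open>s\<close>,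
  and is zero.
\<close>

lemma right_approx_cone_vanish:
  assumes ap: "right_approx T ext s d \<alpha>"
    and mono: "\<And>t m. \<lbrakk>t \<in> ext; \<guillemotleft>m : t \<rightarrow> s\<guillemotright>; \<alpha> \<cdot> m = 0\<rbrakk> \<Longrightarrow> m = 0"
    and t: "dtri T s d c \<alpha> \<beta> \<gamma>" and s0: "s0 \<in> S"
  shows "hom T s0 c = {0}"
proof (rule vanishI)
  note dt = dtriD[OF t]
  have s: "s \<in> ext" and fac: "\<And>x f. \<lbrakk>x \<in> ext; \<guillemotleft>f : x \<rightarrow> d\<guillemotright>\<rbrakk> \<Longrightarrow> \<exists>g. \<guillemotleft>g : x \<rightarrow> s\<guillemotright> \<and> \<alpha> \<cdot> g = f"
    using ap ext_obj dt(1) unfolding right_approx_def arrow_def by blast+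
  show s0o: "s0 \<in> Obj T" using s0 S_obj by blast
  fix q assume q: "\<guillemotleft>q : s0 \<rightarrow> c\<guillemotright>"
  have \<gamma>q: "\<guillemotleft>\<gamma> \<cdot> q : s0 \<rightarrow> \<Sigma> s\<guillemotright>" using arr_comp[OF dt(6) q] .
  \<comment> \<open>The extension classified by \<open>\<gamma> \<cdot> q\<close>; splitting it amounts to \<open>\<gamma> \<cdot> q = 0\<close>.\<close>
  obtain e u v where e: "dtri T s e s0 u v (\<gamma> \<cdot> q)" using complete_third[OF \<gamma>q dt(1)] by blast
  note de = dtriD[OF e]
  have ee: "e \<in> ext" using ext_star[OF triI[OF e] s] s0 S_ext by blast
  have "- (smap s d \<alpha> \<cdot> \<gamma>) = 0"
    using dtri_comp_zero[OF rot[OF rot[OF t]]] neg_comp[OF smap_arr[OF dt(4)] dt(6)] by simp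
  then have "smap s d \<alpha> \<cdot> (\<gamma> \<cdot> q) = 0"
    using assoc[OF smap_arr[OF dt(4)] dt(6) q] zero_comp[OF q shift_obj[OF dt(2)]] by simp
  then obtain \<alpha>' where \<alpha>': "\<guillemotleft>\<alpha>' : e \<rightarrow> d\<guillemotright>" "\<alpha>' \<cdot> u = \<alpha>" using extend_along_first[OF e dt(4)] by blast
  obtain g where g: "\<guillemotleft>g : e \<rightarrow> s\<guillemotright>" "\<alpha> \<cdot> g = \<alpha>'" using fac[OF ee \<alpha>'(1)] by blast
  have gu: "\<guillemotleft>g \<cdot> u : s \<rightarrow> s\<guillemotright>" using arr_comp[OF g(1) de(4)] .
  have "\<alpha> \<cdot> (g \<cdot> u - ident T s) = 0"
    using comp_diff[OF dt(4) gu arr_ident[OF dt(1)]] assoc[OF dt(4) g(1) de(4)] g(2) \<alpha>'(2) comp_ident[OF dt(4)]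
    by simp
  then have gu1: "g \<cdot> u = ident T s" using mono[OF s arr_diff[OF gu arr_ident[OF dt(1)]]] by simp
  have "- (smap s e u \<cdot> (\<gamma> \<cdot> q)) = 0"
    using dtri_comp_zero[OF rot[OF rot[OF e]]] neg_comp[OF smap_arr[OF de(4)] \<gamma>q] by simp
  then have "(smap e s g \<cdot> smap s e u) \<cdot> (\<gamma> \<cdot> q) = 0"
    using assoc[OF smap_arr[OF g(1)] smap_arr[OF de(4)] \<gamma>q] comp_zero[OF smap_arr[OF g(1)] s0o] by simp
  then have "\<gamma> \<cdot> q = 0"
    using smap_comp[OF g(1) de(4)] gu1 smap_ident[OF dt(1)] ident_comp[OF \<gamma>q] by simp
  then obtain p where p: "\<guillemotleft>p : s0 \<rightarrow> d\<guillemotright>" "\<beta> \<cdot> p = q" using lift_to_second[OF t q] by blast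
  obtain n where n: "\<guillemotleft>n : s0 \<rightarrow> s\<guillemotright>" "\<alpha> \<cdot> n = p" using fac[OF _ p(1)] s0 S_ext by blast
  show "q = 0"
    using assoc[OF dt(5) dt(4) n(1)] n(2) p(2) dtri_comp_zero[OF t] zero_comp[OF n(1) dt(3)] by simp
qed (use dtriD(3)[OF t] in auto)

text \<open>
  Among all left approximations take one, \<open>f\<close>, of minimal length. If \<open>\<phi> \<cdot> f = 0\<close> for a nonzero map \<open>\<phi>\<close> to a
  simple object, then \<open>f\<close> factors through the cocone of \<open>\<phi>\<close>, which is a shorter left approximation. The passage from simple objects to all \<open>t\<close> uses that maps
  \<open>\<Sigma>d \<rightarrow> u\<close> vanish.
\<close>

lemma left_approx_epi_exists:
  assumes ex: "left_approx T ext d x0 f0" and d: "d \<in> Obj T"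
    and ort: "\<And>u. u \<in> S \<Longrightarrow> hom T (\<Sigma> d) u = {0}"
  obtains s f where "left_approx T ext d s f"
    "\<And>t m. \<lbrakk>t \<in> ext; \<guillemotleft>m : s \<rightarrow> t\<guillemotright>; m \<cdot> f = 0\<rbrakk> \<Longrightarrow> m = 0"
proof -
  let ?P = "\<lambda>n. \<exists>s f. s \<in> filt n \<and> left_approx T ext d s f"
  have "\<exists>n. ?P n" using ex unfolding left_approx_def ext_eq by blast
  then obtain n where n: "?P n" and least: "\<And>m. m < n \<Longrightarrow> \<not> ?P m"
    using exists_least_iff[of ?P] by blast
  then obtain s f where sn: "s \<in> filt n" and ap: "left_approx T ext d s f" by blast
  have s: "s \<in> ext" and f: "\<guillemotleft>f : d \<rightarrow> s\<guillemotright>"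
    and fac: "\<And>x g. \<lbrakk>x \<in> ext; \<guillemotleft>g : d \<rightarrow> x\<guillemotright>\<rbrakk> \<Longrightarrow> \<exists>h. \<guillemotleft>h : s \<rightarrow> x\<guillemotright> \<and> h \<cdot> f = g"
    using ap ext_obj d unfolding left_approx_def arrow_def by blast+
  have so: "s \<in> Obj T" using s ext_obj by blast
  have simple: "\<phi> = 0" if s0: "s0 \<in> S" and \<phi>: "\<guillemotleft>\<phi> : s \<rightarrow> s0\<guillemotright>" and \<phi>f: "\<phi> \<cdot> f = 0" for s0 \<phi>
  proof (rule ccontr)
    assume nz: "\<phi> \<noteq> 0"
    obtain c i h where t: "dtri T c s s0 i \<phi> h" using complete_second[OF \<phi>] by blast
    note dt = dtriD[OF t]
    obtain m where m: "m < n" "c \<in> filt m" using nonzero_to_simple_cocone[OF sn s0 t nz] by blast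
    obtain f' where f': "\<guillemotleft>f' : d \<rightarrow> c\<guillemotright>" "i \<cdot> f' = f" using factor_through_cocone[OF t f \<phi>f] by blast
    have "left_approx T ext d c f'"
      unfolding left_approx_def
    proof (intro conjI ballI)
      show "c \<in> ext" using m ext_eq by blast
      show "f' \<in> hom T d c" using arr_hom f' by blast
      fix x g assume x: "x \<in> ext" and "g \<in> hom T d x"
      then have "\<guillemotleft>g : d \<rightarrow> x\<guillemotright>" using arrI ext_obj d by blast
      then obtain k where k: "\<guillemotleft>k : s \<rightarrow> x\<guillemotright>" "k \<cdot> f = g" using fac[OF x] by blast
      have "(k \<cdot> i) \<cdot> f' = g" using assoc[OF k(1) dt(4) f'(1)] f'(2) k(2) by simp
      then show "\<exists>k\<in>hom T c x. k \<cdot> f' = g" using arr_hom[OF arr_comp[OF k(1) dt(4)]] by blast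
    qed
    then show False using least[OF m(1)] m(2) by blast
  qed
  have "m = 0" if t: "t \<in> ext" and m: "\<guillemotleft>m : s \<rightarrow> t\<guillemotright>" and mf: "m \<cdot> f = 0" for t m
    using t m mf
  proof (induction arbitrary: m rule: ext_induct)
    case (zero t)
    then show ?case using zero_object_tgt by blast
  next
    case (extend t e u)
    then obtain f1 f2 f3 where tr: "dtri T t e u f1 f2 f3" by (auto simp: tri_def)
    note df = dtriD[OF tr]
    have "(f2 \<cdot> m) \<cdot> f = 0"
      using assoc[OF df(5) extend.prems(1) f] comp_zero[OF df(5) d] extend.prems(2) by simp
    then have "f2 \<cdot> m = 0" using simple[OF extend.hyps(2) arr_comp[OF df(5) extend.prems(1)]] by blast
    then obtain m' where m': "\<guillemotleft>m' : s \<rightarrow> t\<guillemotright>" "f1 \<cdot> m' = m"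
      using factor_through_cocone[OF tr extend.prems(1)] by blast
    have m'f: "\<guillemotleft>m' \<cdot> f : d \<rightarrow> t\<guillemotright>" using arr_comp[OF m'(1) f] .
    have "f1 \<cdot> (m' \<cdot> f) = 0" using assoc[OF df(4) m'(1) f] m' extend.prems(2) by simp
    then obtain k where k: "\<guillemotleft>k : \<Sigma> d \<rightarrow> u\<guillemotright>" "f3 \<cdot> k = smap d t (m' \<cdot> f)"
      using kernel_of_first[OF tr m'f] by blast
    have "smap d t (m' \<cdot> f) = 0"
      using vanishD[OF ort[OF extend.hyps(2)] k(1)] k(2) comp_zero[OF df(6) shift_obj[OF d]] by simp
    then have "m' \<cdot> f = 0" using smap_eq_0[OF m'f] by blast
    then have "m' = 0" using extend.IH[OF m'(1)] by blast
    then show ?case using m' comp_zero[OF df(4) so] by simp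
  qed
  then show ?thesis using that ap by blast
qed

text \<open>
  The dual of \<open>right_approx_cone_vanish\<close>, with the extension of \<open>s\<close> by \<open>s0\<close> obtained by pushing out along
  \<open>q\<close>.
\<close>

lemma left_approx_cocone_vanish:
  assumes ap: "left_approx T ext d s f"
    and epi: "\<And>t m. \<lbrakk>t \<in> ext; \<guillemotleft>m : s \<rightarrow> t\<guillemotright>; m \<cdot> f = 0\<rbrakk> \<Longrightarrow> m = 0"
    and t: "dtri T x d s a f h" and s0: "s0 \<in> S"
  shows "hom T x s0 = {0}"
proof (rule vanishI)
  note dt = dtriD[OF t]
  have s: "s \<in> ext" and fac: "\<And>x g. \<lbrakk>x \<in> ext; \<guillemotleft>g : d \<rightarrow> x\<guillemotright>\<rbrakk> \<Longrightarrow> \<exists>h. \<guillemotleft>h : s \<rightarrow> x\<guillemotright> \<and> h \<cdot> f = g"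
    using ap ext_obj dt(1) unfolding left_approx_def arrow_def by blast+
  show s0o: "s0 \<in> Obj T" using s0 S_obj by blast
  fix q assume q: "\<guillemotleft>q : x \<rightarrow> s0\<guillemotright>"
  define p where "p = smap x s0 q \<cdot> h"
  have p: "\<guillemotleft>p : s \<rightarrow> \<Sigma> s0\<guillemotright>" unfolding p_def using arr_comp[OF smap_arr[OF q] dt(6)] .
  \<comment> \<open>The extension classified by \<open>p\<close>; splitting it amounts to \<open>p = 0\<close>, which means that \<open>q\<close> extends to \<open>d\<close>.\<close>
  obtain e u v where e: "dtri T s0 e s u v p" using complete_third[OF p s0o] by blast
  note de = dtriD[OF e]
  have ee: "e \<in> ext" using ext_star[OF triI[OF e] _ s] s0 S_ext by blast
  have "p \<cdot> f = 0"
    unfolding p_def using assoc[OF smap_arr[OF q] dt(6) dt(5)] dtri_comp_zero[OF rot[OF t]]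
      comp_zero[OF smap_arr[OF q] dt(2)] by simp
  then obtain f' where f': "\<guillemotleft>f' : d \<rightarrow> e\<guillemotright>" "v \<cdot> f' = f" using lift_to_second[OF e dt(5)] by blast
  obtain g where g: "\<guillemotleft>g : s \<rightarrow> e\<guillemotright>" "g \<cdot> f = f'" using fac[OF ee f'(1)] by blast
  have vg: "\<guillemotleft>v \<cdot> g : s \<rightarrow> s\<guillemotright>" using arr_comp[OF de(5) g(1)] .
  have "(v \<cdot> g - ident T s) \<cdot> f = 0"
    using diff_comp[OF vg arr_ident[OF dt(3)] dt(5)] assoc[OF de(5) g(1) dt(5)] g(2) f'(2) ident_comp[OF dt(5)]
    by simp
  then have vg1: "v \<cdot> g = ident T s" using epi[OF s arr_diff[OF vg arr_ident[OF dt(3)]]] by simp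
  have "p = 0"
    using assoc[OF p de(5) g(1)] vg1 comp_ident[OF p] dtri_comp_zero[OF rot[OF e]]
      zero_comp[OF g(1) shift_obj[OF s0o]] by simp
  then obtain r where r: "\<guillemotleft>r : d \<rightarrow> s0\<guillemotright>" "r \<cdot> a = q" using extend_along_first[OF t q] by (auto simp: p_def)
  obtain n where n: "\<guillemotleft>n : s \<rightarrow> s0\<guillemotright>" "n \<cdot> f = r" using fac[OF _ r(1)] s0 S_ext by blast
  show "q = 0"
    using assoc[OF n(1) dt(5) dt(4)] n(2) r(2) dtri_comp_zero[OF t] comp_zero[OF n(1) dt(1)] by simp
qed (use dtriD(1)[OF t] in auto)

end

section \<open>Vanishing from Calabi--Yau duality\<close>

context linear_category
begin

text \<open>A nonzero vector extends to a basis, and its coordinate is a nonzero functional.\<close>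

lemma dual_space_trivial:
  assumes "\<And>\<phi> \<psi>. \<lbrakk>\<phi> \<in> dual_space C V; \<psi> \<in> dual_space C V\<rbrakk> \<Longrightarrow> \<phi> = \<psi>" and V: "subspace V"
  shows "V = {0}"
proof (rule ccontr)
  assume "V \<noteq> {0}"
  then obtain v where v: "v \<in> V" "v \<noteq> 0" using subspace_0[OF V] by blast
  have ind: "independent {v}" using v(2) by (simp add: dependent_single)
  define B where "B = extend_basis {v}"
  have B: "independent B" "span B = UNIV" "v \<in> B"
    using independent_extend_basis[OF ind] span_extend_basis[OF ind] extend_basis_superset[OF ind]
    by (auto simp: B_def)
  define \<phi> where "\<phi> = restrict (\<lambda>u. representation B u v) V"
  have "\<phi> \<in> dual_space C V"
    using V subspace_add[OF V] subspace_scale[OF V] representation_add[OF B(1)] representation_scale[OF B(1)] B(2)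
    by (simp add: dual_space_def \<phi>_def)
  moreover have "restrict (\<lambda>u. 0) V \<in> dual_space C V"
    using subspace_add[OF V] subspace_scale[OF V] by (simp add: dual_space_def)
  ultimately have "\<phi> v = restrict (\<lambda>u. 0) V v" using assms(1) by metis
  then show False using v representation_basis[OF B(1,3)] by (simp add: \<phi>_def)
qed

end

context triangulated_category
begin

text \<open>
  The same choice of a quasi-inverse of \<open>\<Sigma>\<close> as in \<^const>\<open>functor_int_power\<close>, so that its powers are the
  negative powers of \<open>\<Sigma>\<close> literally and not just up to isomorphism.
\<close>

definition inv_shift where "inv_shift = (SOME G. quasi_inverse T (shift T) G)"

abbreviation \<Omega> where "\<Omega> \<equiv> fobj inv_shift"

lemma inv_shift: "quasi_inverse T (shift T) inv_shift"
  using shift_autoequivalence someI_ex[of "quasi_inverse T (shift T)"]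
  by (simp add: inv_shift_def autoequivalence_def)

lemma inv_shift_linear: "linear_functor T inv_shift"
  using inv_shift by (simp add: quasi_inverse_def)

lemma inv_shift_obj: "x \<in> Obj T \<Longrightarrow> \<Omega> x \<in> Obj T"
  using functor_obj[OF inv_shift_linear] .

lemma inv_shift_power_obj: "x \<in> Obj T \<Longrightarrow> (\<Omega> ^^ n) x \<in> Obj T"
  by (induction n) (simp_all add: inv_shift_obj)

lemma shiftpow_pos: "shiftpow T (int n) = functor_power (shift T) n"
  by (simp add: functor_int_power_def)

lemma shiftpow_neg: "shiftpow T (- int n) = functor_power inv_shift n"
  by (cases "n = 0") (simp_all add: functor_int_power_def inv_shift_def)

lemma shift_power_iso:
  "\<lbrakk>isomorphic T x y; x \<in> Obj T; y \<in> Obj T\<rbrakk> \<Longrightarrow> isomorphic T ((\<Sigma> ^^ n) x) ((\<Sigma> ^^ n) y)"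
proof (induction n)
  case (Suc n)
  then show ?case
    using functor_iso[OF shift_linear] shift_power_obj unfolding isomorphic_def by fastforce
qed simp

lemma shift_inv_shift_power: "x \<in> Obj T \<Longrightarrow> isomorphic T ((\<Sigma> ^^ n) ((\<Omega> ^^ n) x)) x"
proof (induction n)
  case 0
  then show ?case using iso_ident by (auto simp: isomorphic_def)
next
  case (Suc n)
  define u where "u = (\<Omega> ^^ n) x"
  have u: "u \<in> Obj T" using inv_shift_power_obj[OF Suc.prems] by (simp add: u_def)
  have "naturally_isomorphic T (comp_functor (shift T) inv_shift) id_functor"
    using inv_shift by (simp add: quasi_inverse_def)
  then have "isomorphic T (\<Sigma> (\<Omega> u)) u" using nat_iso_idE u unfolding isomorphic_def by metis
  then have "isomorphic T ((\<Sigma> ^^ n) (\<Sigma> (\<Omega> u))) ((\<Sigma> ^^ n) u)"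
    using shift_power_iso u shift_obj inv_shift_obj by blast
  then have "isomorphic T ((\<Sigma> ^^ n) (\<Sigma> (\<Omega> u))) x"
    using isomorphic_trans[OF _ Suc.IH[OF Suc.prems]] Suc.prems u shift_obj inv_shift_obj shift_power_obj
    by (simp add: u_def)
  then show ?case by (simp add: u_def funpow_swap1)
qed

text \<open>
  Adjunction of \<open>\<Omega>\<^sup>n\<close> and \<open>\<Sigma>\<^sup>n\<close>. It allows all vanishing conditions to be stated with nonnegative powers of
  \<open>\<Sigma>\<close> only.
\<close>

lemma vanish_inv_shift_power:
  assumes x: "x \<in> Obj T" and y: "y \<in> Obj T"
  shows "hom T x ((\<Omega> ^^ n) y) = {0} \<longleftrightarrow> hom T ((\<Sigma> ^^ n) x) y = {0}"
proof -
  note i = shift_inv_shift_power[OF y, of n]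
  note ob = inv_shift_power_obj[OF y, of n] shift_power_obj[OF x, of n]
  note ob' = shift_power_obj[OF ob(1), of n]
  have "hom T ((\<Sigma> ^^ n) x) ((\<Sigma> ^^ n) ((\<Omega> ^^ n) y)) = {0} \<longleftrightarrow> hom T ((\<Sigma> ^^ n) x) y = {0}"
    using vanish_iso_tgt[OF _ i ob(2) ob' y] vanish_iso_tgt[OF _ isomorphic_sym[OF i ob' y] ob(2) y ob'] by blast
  then show ?thesis using vanish_shift_power[OF x ob(1)] by simp
qed

text \<open>
  Duality identifies \<open>Hom(x, y)\<close> with the dual of \<open>Hom(y, \<Omega>\<^sup>wx)\<close>, and a space with zero dual is zero.
\<close>

lemma calabi_yau_vanish:
  assumes cy: "calabi_yau T (- int w)" and ob: "x \<in> Obj T" "y \<in> Obj T" and xy: "hom T x y = {0}"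
  shows "hom T ((\<Sigma> ^^ w) y) x = {0}"
proof -
  obtain F where F: "serre_functor T F" "naturally_isomorphic T F (functor_power inv_shift w)"
    using cy by (auto simp: calabi_yau_def shiftpow_neg)
  obtain \<eta> where "bij_betw (\<eta> x y) (hom T x y) (dual_space T (hom T y (fobj F x)))"
    using F(1) ob unfolding serre_functor_def by blast
  then have d: "dual_space T (hom T y (fobj F x)) = {\<eta> x y 0}"
    using xy by (auto simp: bij_betw_def)
  have F_obj: "fobj F x \<in> Obj T"
    using F(1) functor_obj ob(1) by (auto simp: serre_functor_def autoequivalence_def)
  have "subspace (hom T y (fobj F x))" using subspace_hom ob(2) F_obj by blast
  then have "hom T y (fobj F x) = {0}"
    using dual_space_trivial d by (metis singletonD)
  moreover have "isomorphic T (fobj F x) ((\<Omega> ^^ w) x)"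
    using F(2) ob(1) by (auto simp: naturally_isomorphic_def isomorphic_def fobj_functor_power)
  ultimately have "hom T y ((\<Omega> ^^ w) x) = {0}"
    using vanish_iso_tgt ob F_obj inv_shift_power_obj by blast
  then show ?thesis using vanish_inv_shift_power[OF ob(2,1)] by blast
qed

end


locale cy_reduction = schur_collection T S
  for T :: "('k::field, 'o, 'm::ab_group_add) tri_cat" (structure) and S :: "'o set" +
  fixes w :: nat and ch :: "('o, 'm) shift_choice"
  assumes w: "1 \<le> w"
    and orth: "\<lbrakk>1 \<le> k; k < w; s \<in> S; t \<in> S\<rbrakk> \<Longrightarrow> hom T ((\<Sigma> ^^ k) s) t = {0}"
    and approximations: "functorially_finite T (extension_closure T S)"
    and choice: "valid_choice T w S ch"
    and cy: "calabi_yau T (- int w)"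
begin

abbreviation Z where "Z \<equiv> perp_subcat T w S"

lemma S_objD: "s \<in> S \<Longrightarrow> s \<in> Obj T"
  using S_obj by blast

lemma ext_objD: "e \<in> ext \<Longrightarrow> e \<in> Obj T"
  using ext_obj by blast

lemma Z_iff:
  "d \<in> Z \<longleftrightarrow> d \<in> Obj T \<and> (\<forall>i<w. \<forall>s\<in>S. hom T ((\<Sigma> ^^ i) s) d = {0} \<and> hom T ((\<Sigma> ^^ i) d) s = {0})"
proof -
  have "i \<in> {0..w - 1} \<longleftrightarrow> i < w" for i using w by auto
  moreover have "hom T d ((\<Omega> ^^ i) s) = {0} \<longleftrightarrow> hom T ((\<Sigma> ^^ i) d) s = {0}" if "d \<in> Obj T" "s \<in> S" for i s
    using vanish_inv_shift_power[OF that(1) S_objD[OF that(2)]] .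
  ultimately show ?thesis
    unfolding perp_subcat_def shiftpow_pos shiftpow_neg fobj_functor_power mem_Collect_eq Ball_def by metis
qed

lemma Z_obj: "d \<in> Z \<Longrightarrow> d \<in> Obj T"
  by (simp add: Z_iff)

text \<open>
  The missing case \<open>i = w\<close> is dual to the case \<open>i = 0\<close> of the other variance.
\<close>

lemma Z_vanish:
  assumes d: "d \<in> Z" and i: "i \<le> w" and s: "s \<in> S"
  shows "hom T ((\<Sigma> ^^ i) s) d = {0}" "hom T ((\<Sigma> ^^ i) d) s = {0}"
proof -
  note ob = Z_obj[OF d] S_objD[OF s]
  have 0: "hom T s d = {0}" "hom T d s = {0}" using d s w by (auto simp: Z_iff dest: spec[of _ 0])
  have "hom T ((\<Sigma> ^^ w) s) d = {0}" "hom T ((\<Sigma> ^^ w) d) s = {0}"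
    using calabi_yau_vanish[OF cy ob 0(2)] calabi_yau_vanish[OF cy ob(2,1) 0(1)] .
  then show "hom T ((\<Sigma> ^^ i) s) d = {0}" "hom T ((\<Sigma> ^^ i) d) s = {0}"
    using d s i by (cases "i = w"; simp add: Z_iff)+
qed

lemma calabi_yau_vanish_shifted:
  assumes ob: "x \<in> Obj T" "y \<in> Obj T" and i: "i \<le> w" and v: "hom T ((\<Sigma> ^^ (w - i)) x) y = {0}"
  shows "hom T ((\<Sigma> ^^ i) y) x = {0}"
proof -
  have "hom T ((\<Sigma> ^^ w) y) ((\<Sigma> ^^ (w - i)) x) = {0}"
    using calabi_yau_vanish[OF cy shift_power_obj[OF ob(1)] ob(2) v] .
  moreover have "(\<Sigma> ^^ w) y = (\<Sigma> ^^ (w - i)) ((\<Sigma> ^^ i) y)"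
    using i by (metis comp_apply funpow_add le_add_diff_inverse2)
  ultimately show ?thesis using vanish_shift_power shift_power_obj ob by simp
qed

text \<open>
  Either half of the vanishing conditions, in the full range \<open>0, \<dots>, w\<close>, is enough: shifts by \<open>i\<close> on one
  side are dual to shifts by \<open>w - i\<close> on the other.
\<close>

lemma Z_from:
  assumes d: "d \<in> Obj T" and "\<And>i s. \<lbrakk>i \<le> w; s \<in> S\<rbrakk> \<Longrightarrow> hom T ((\<Sigma> ^^ i) s) d = {0}"
  shows "d \<in> Z"
  unfolding Z_iff using assms calabi_yau_vanish_shifted[OF S_objD d] by simp

lemma Z_to:
  assumes d: "d \<in> Obj T" and "\<And>i s. \<lbrakk>i \<le> w; s \<in> S\<rbrakk> \<Longrightarrow> hom T ((\<Sigma> ^^ i) d) s = {0}"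
  shows "d \<in> Z"
  unfolding Z_iff using assms calabi_yau_vanish_shifted[OF d S_objD] by simp

lemma Z_vanish_ext:
  assumes d: "d \<in> Z" and i: "i \<le> w" and e: "e \<in> ext"
  shows "hom T ((\<Sigma> ^^ i) e) d = {0}" "hom T ((\<Sigma> ^^ i) d) e = {0}"
proof -
  show "hom T ((\<Sigma> ^^ i) e) d = {0}"
    using ext_vanish_to[OF e Z_obj[OF d]] Z_vanish(1)[OF d i] by blast
  show "hom T ((\<Sigma> ^^ i) d) e = {0}"
    using ext_vanish_from[OF e shift_power_obj[OF Z_obj[OF d]], where n = 0] Z_vanish(2)[OF d i] by simp
qed

lemma Z_vanish_ext0:
  assumes "d \<in> Z" "e \<in> ext"
  shows "hom T e d = {0}" "hom T d e = {0}"
  using Z_vanish_ext[OF assms(1) _ assms(2), of 0] by simp_all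

lemma Z_vanish_ext1:
  assumes "d \<in> Z" "e \<in> ext"
  shows "hom T (\<Sigma> e) d = {0}" "hom T (\<Sigma> d) e = {0}"
  using Z_vanish_ext[OF assms(1) _ assms(2), of 1] w by simp_all


section \<open>The reduced shift on objects\<close>

lemma chosen_triangle:
  "x \<in> Z \<Longrightarrow> dtri T (apx ch x) (\<Sigma> x) (ang ch x) (alp ch x) (bet ch x) (gam ch x)"
  and chosen_approx: "x \<in> Z \<Longrightarrow> min_right_approx T ext (apx ch x) (\<Sigma> x) (alp ch x)"
  using choice by (auto simp: valid_choice_def)

lemma apx_ext: "x \<in> Z \<Longrightarrow> apx ch x \<in> ext"
  using chosen_approx by (auto simp: min_right_approx_def right_approx_def)

lemma ang_obj: "x \<in> Z \<Longrightarrow> ang ch x \<in> Obj T"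
  and bet_arr: "x \<in> Z \<Longrightarrow> \<guillemotleft>bet ch x : \<Sigma> x \<rightarrow> ang ch x\<guillemotright>"
  using dtriD[OF chosen_triangle] by blast+

lemma ext_vanish_orth:
  assumes s: "s \<in> S" and e: "e \<in> ext" and k: "1 \<le> k" "k < w"
  shows "hom T ((\<Sigma> ^^ k) s) e = {0}" "hom T ((\<Sigma> ^^ k) e) s = {0}"
proof -
  show "hom T ((\<Sigma> ^^ k) s) e = {0}"
    using ext_vanish_from[OF e shift_power_obj[OF S_objD[OF s]], where n = 0] orth[OF k s] by simp
  show "hom T ((\<Sigma> ^^ k) e) s = {0}"
    using ext_vanish_to[OF e S_objD[OF s]] orth[OF k _ s] by blast
qed

text \<open>
  Only maps from \<open>\<Sigma>\<^sup>iS\<close> need to be excluded. For \<open>i = 0\<close> this is Wakamatsu's lemma. For \<open>i = 1\<close> such a map is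
  determined by a map \<open>s \<rightarrow> s\<^sub>x\<close> killed by the approximation, which is zero. For \<open>i \<ge> 2\<close> both neighbours \<open>\<Sigma>x\<close>
  and \<open>\<Sigma>s\<^sub>x\<close> of \<open>x\<langle>1\<rangle>\<close> in its triangle receive no maps.
\<close>

lemma ang_Z:
  assumes x: "x \<in> Z"
  shows "ang ch x \<in> Z"
proof (rule Z_from[OF ang_obj[OF x]])
  note t = chosen_triangle[OF x] and xo = Z_obj[OF x]
  note dt = dtriD[OF t]
  fix i s assume i: "i \<le> w" and s: "s \<in> S"
  note so = S_objD[OF s]
  have sS: "hom T (\<Sigma> u) (\<Sigma> x) = {0}" if "u \<in> S" for u
    using vanish_shift[OF S_objD[OF that] xo] Z_vanish(1)[OF x _ that, of 0] by simp
  have mono: "m = 0" if "t \<in> ext" "\<guillemotleft>m : t \<rightarrow> apx ch x\<guillemotright>" "alp ch x \<cdot> m = 0" for t m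
    using min_right_approx_mono[OF chosen_approx[OF x] dt(2) _ that] sS by blast
  have ra: "right_approx T ext (apx ch x) (\<Sigma> x) (alp ch x)"
    using chosen_approx[OF x] by (simp add: min_right_approx_def)
  consider "i = 0" | "i = 1" | k where "i = Suc k" "1 \<le> k" by (cases i; force)
  then show "hom T ((\<Sigma> ^^ i) s) (ang ch x) = {0}"
  proof cases
    case 1
    then show ?thesis using right_approx_cone_vanish[OF ra mono t s] by simp
  next
    case 2
    have "hom T (\<Sigma> s) (ang ch x) = {0}"
    proof (rule vanishI)
      fix q assume q: "\<guillemotleft>q : \<Sigma> s \<rightarrow> ang ch x\<guillemotright>"
      let ?\<alpha> = "alp ch x" and ?\<gamma> = "gam ch x"
      have \<gamma>q: "\<guillemotleft>?\<gamma> \<cdot> q : \<Sigma> s \<rightarrow> \<Sigma> (apx ch x)\<guillemotright>" using arr_comp[OF dt(6) q] .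
      obtain m where m: "\<guillemotleft>m : s \<rightarrow> apx ch x\<guillemotright>" "smap s (apx ch x) m = ?\<gamma> \<cdot> q"
        using smap_full[OF so dt(1) \<gamma>q] by blast
      have "- (smap (apx ch x) (\<Sigma> x) ?\<alpha> \<cdot> ?\<gamma>) = 0"
        using dtri_comp_zero[OF rot[OF rot[OF t]]] neg_comp[OF smap_arr[OF dt(4)] dt(6)] by simp
      then have "smap (apx ch x) (\<Sigma> x) ?\<alpha> \<cdot> (?\<gamma> \<cdot> q) = 0"
        using assoc[OF smap_arr[OF dt(4)] dt(6) q] zero_comp[OF q shift_obj[OF dt(2)]] by simp
      then have "smap s (\<Sigma> x) (?\<alpha> \<cdot> m) = 0" using smap_comp[OF dt(4) m(1)] m(2) by simp
      then have "m = 0" using mono[OF _ m(1)] smap_eq_0[OF arr_comp[OF dt(4) m(1)]] s S_ext by blast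
      then have "?\<gamma> \<cdot> q = 0" using m(2) smap_zero[OF so dt(1)] by simp
      then obtain p where p: "\<guillemotleft>p : \<Sigma> s \<rightarrow> \<Sigma> x\<guillemotright>" "bet ch x \<cdot> p = q" using lift_to_second[OF t q] by blast
      show "q = 0" using vanishD[OF sS[OF s] p(1)] p(2) comp_zero[OF dt(5) shift_obj[OF so]] by simp
    qed (use so shift_obj dt in auto)
    then show ?thesis using 2 by simp
  next
    case (3 k)
    have "hom T ((\<Sigma> ^^ k) s) x = {0}" using Z_vanish(1)[OF x _ s] 3 i by simp
    then have 1: "hom T ((\<Sigma> ^^ i) s) (\<Sigma> x) = {0}"
      using vanish_shift[OF shift_power_obj[OF so] xo] 3 by simp
    have "hom T ((\<Sigma> ^^ k) s) (apx ch x) = {0}" using ext_vanish_orth(1)[OF s apx_ext[OF x]] 3 i by simp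
    then have 2: "hom T ((\<Sigma> ^^ i) s) (\<Sigma> (apx ch x)) = {0}"
      using vanish_shift[OF shift_power_obj[OF so] dt(1)] 3 by simp
    show ?thesis using tri_vanish_from[OF tri_rot[OF triI[OF t]] 1 2 shift_power_obj[OF so]] .
  qed
qed

text \<open>
  Take the cocone \<open>x\<close> of a left approximation of \<open>\<Sigma>\<^sup>-\<^sup>1y\<close> of minimal length; that \<open>x \<in> Z\<close> is shown by the dual
  of the argument for \<open>ang_Z\<close>.
\<close>

lemma Z_is_cone:
  assumes y: "y \<in> Z"
  obtains x s a b c where "x \<in> Z" "s \<in> ext" "dtri T s (\<Sigma> x) y a b c"
proof -
  obtain d where d: "d \<in> Obj T" "isomorphic T (\<Sigma> d) y" using shift_surj Z_obj[OF y] by blast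
  note yo = Z_obj[OF y]
  have vd: "hom T ((\<Sigma> ^^ Suc i) d) u = {0}" if "i \<le> w" "u \<in> S" for i u
  proof -
    have "isomorphic T ((\<Sigma> ^^ i) y) ((\<Sigma> ^^ Suc i) d)"
      using shift_power_iso[OF isomorphic_sym[OF d(2) shift_obj[OF d(1)] yo] yo shift_obj[OF d(1)]]
      by (simp add: funpow_swap1)
    then show ?thesis
      using vanish_iso_src[OF Z_vanish(2)[OF y that]] shift_power_obj yo d(1) S_objD[OF that(2)] by blast
  qed
  have v1: "hom T (\<Sigma> d) u = {0}" if "u \<in> S" for u using vd[OF _ that, of 0] by simp
  obtain x0 f0 where "left_approx T ext d x0 f0"
    using approximations d(1) by (auto simp: functorially_finite_def)
  from left_approx_epi_exists[OF this d(1) v1]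
  obtain s f where ap: "left_approx T ext d s f"
    and epi: "\<And>t m. \<lbrakk>t \<in> ext; \<guillemotleft>m : s \<rightarrow> t\<guillemotright>; m \<cdot> f = 0\<rbrakk> \<Longrightarrow> m = 0" by metis
  have s: "s \<in> ext" and f: "\<guillemotleft>f : d \<rightarrow> s\<guillemotright>"
    using ap d(1) ext_objD by (auto simp: left_approx_def arrow_def)
  obtain x a h where t: "dtri T x d s a f h" using complete_second[OF f] by blast
  note dt = dtriD[OF t]
  note r = rot[OF rot[OF t]]
  have "x \<in> Z"
  proof (rule Z_to[OF dt(1)])
    fix i u assume i: "i \<le> w" and u: "u \<in> S"
    note uo = S_objD[OF u]
    consider "i = 0" | "i = 1" | k where "i = Suc k" "1 \<le> k" by (cases i; force)
    then show "hom T ((\<Sigma> ^^ i) x) u = {0}"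
    proof cases
      case 1
      then show ?thesis using left_approx_cocone_vanish[OF ap epi t u] by simp
    next
      case 2
      have "hom T (\<Sigma> x) u = {0}"
      proof (rule vanishI)
        fix p assume p: "\<guillemotleft>p : \<Sigma> x \<rightarrow> u\<guillemotright>"
        have "(p \<cdot> h) \<cdot> f = 0"
          using assoc[OF p dt(6) dt(5)] dtri_comp_zero[OF rot[OF t]] comp_zero[OF p d(1)] by simp
        then have "p \<cdot> h = 0" using epi[OF _ arr_comp[OF p dt(6)]] u S_ext by blast
        then obtain q where q: "\<guillemotleft>q : \<Sigma> d \<rightarrow> u\<guillemotright>" "q \<cdot> (- smap x d a) = p"
          using factor_through_cone[OF r p] by blast
        show "p = 0"
          using vanishD[OF v1[OF u] q(1)] q(2) zero_comp[OF arr_neg[OF smap_arr[OF dt(4)]] uo] by simp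
      qed (use shift_obj dt uo in auto)
      then show ?thesis using 2 by simp
    next
      case (3 k)
      have "hom T ((\<Sigma> ^^ k) s) u = {0}" using ext_vanish_orth(2)[OF u s] 3 i by simp
      moreover have "hom T ((\<Sigma> ^^ k) (\<Sigma> d)) u = {0}" using vd[OF _ u, of k] 3 i by (simp add: funpow_swap1)
      ultimately have "hom T ((\<Sigma> ^^ k) (\<Sigma> x)) u = {0}"
        using tri_vanish_to[OF tri_shift_power[OF triI[OF r]] _ _ uo] by blast
      then show ?thesis using 3 by (simp add: funpow_swap1)
    qed
  qed
  moreover obtain e e' where e: "\<guillemotleft>e : \<Sigma> d \<rightarrow> y\<guillemotright>" "\<guillemotleft>e' : y \<rightarrow> \<Sigma> d\<guillemotright>" "e' \<cdot> e = ident T (\<Sigma> d)" "e \<cdot> e' = ident T y"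
    using d isoE shift_obj yo unfolding isomorphic_def by metis
  ultimately show ?thesis using that s replace_third[OF r yo e] by blast
qed

end

context cy_reduction
begin

abbreviation R where "R \<equiv> reduction T w S ch"

lemma R_simps [simp]:
  "Obj R = Z" "hom R = hom T" "cmp R = cmp T" "ident R = ident T" "smul R = smul T"
  "shift R = reduced_shift T ch"
  by (simp_all add: reduction_def)

lemma arrow_R: "\<guillemotleft>f : x \<rightarrow> y\<guillemotright>\<^bsub>R\<^esub> \<longleftrightarrow> x \<in> Z \<and> y \<in> Z \<and> \<guillemotleft>f : x \<rightarrow> y\<guillemotright>"
  using Z_obj by (auto simp: arrow_def)

lemma is_iso_R [simp]: "is_iso R = is_iso T"
  by (intro ext) (simp add: is_iso_def)

lemma linear_category_reduction: "linear_category R"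
proof -
  have "vector_space (smul T)" by unfold_locales
  then show ?thesis
    unfolding linear_category_def linear_category_axioms_def R_simps
    using subspace_hom ident_hom cmp_hom cmp_ident ident_cmp cmp_assoc cmp_add_left cmp_add_right
      cmp_smul_left cmp_smul_right Z_obj by (intro conjI) metis+
qed

sublocale R: linear_category R
  by (rule linear_category_reduction)


section \<open>The reduced shift is an equivalence\<close>

abbreviation F where "F \<equiv> reduced_shift T ch"

lemma fobj_F [simp]: "fobj F x = ang ch x"
  by (simp add: reduced_shift_def)

text \<open>
  The universal property of \<open>\<Sigma>x \<rightarrow> x\<langle>1\<rangle>\<close> with respect to \<open>Z\<close>. Existence and uniqueness hold because neither
  \<open>s\<^sub>x\<close> nor \<open>\<Sigma>s\<^sub>x\<close> has maps to objects of \<open>Z\<close>.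
\<close>

lemma bet_extend:
  assumes x: "x \<in> Z" and z: "z \<in> Z" and p: "\<guillemotleft>p : \<Sigma> x \<rightarrow> z\<guillemotright>"
  obtains c where "\<guillemotleft>c : ang ch x \<rightarrow> z\<guillemotright>" "c \<cdot> bet ch x = p"
  using extend_over_cone[OF chosen_triangle[OF x] Z_vanish_ext0(1)[OF z apx_ext[OF x]] p] by blast

lemma bet_cancel:
  assumes x: "x \<in> Z" and z: "z \<in> Z" and "\<guillemotleft>c : ang ch x \<rightarrow> z\<guillemotright>" "\<guillemotleft>c' : ang ch x \<rightarrow> z\<guillemotright>"
    and "c \<cdot> bet ch x = c' \<cdot> bet ch x"
  shows "c = c'"
  using cone_cancel[OF chosen_triangle[OF x] Z_vanish_ext1(1)[OF z apx_ext[OF x]] assms(3-5)] .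

lemma fmap_F:
  assumes f: "\<guillemotleft>f : x \<rightarrow> y\<guillemotright>" and x: "x \<in> Z" and y: "y \<in> Z"
  shows "\<guillemotleft>fmap F x y f : ang ch x \<rightarrow> ang ch y\<guillemotright>"
    "fmap F x y f \<cdot> bet ch x = bet ch y \<cdot> smap x y f"
proof -
  let ?Q = "\<lambda>f1. f1 \<in> hom T (ang ch x) (ang ch y) \<and> f1 \<cdot> bet ch x = bet ch y \<cdot> smap x y f"
  have q: "?Q c \<longleftrightarrow> \<guillemotleft>c : ang ch x \<rightarrow> ang ch y\<guillemotright> \<and> c \<cdot> bet ch x = bet ch y \<cdot> smap x y f" for c
    using ang_obj[OF x] ang_obj[OF y] by (simp add: arrow_def)
  obtain c where c: "?Q c"
    using bet_extend[OF x ang_Z[OF y] arr_comp[OF bet_arr[OF y] smap_arr[OF f]]] q by metis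
  have "?Q (THE c. ?Q c)"
  proof (rule theI[of ?Q, OF c])
    fix c' assume "?Q c'"
    then show "c' = c" using bet_cancel[OF x ang_Z[OF y]] c q by metis
  qed
  then have "?Q (fmap F x y f)" by (simp add: reduced_shift_def)
  then show "\<guillemotleft>fmap F x y f : ang ch x \<rightarrow> ang ch y\<guillemotright>"
    "fmap F x y f \<cdot> bet ch x = bet ch y \<cdot> smap x y f" using q by blast+
qed

lemma fmap_F_unique:
  assumes f: "\<guillemotleft>f : x \<rightarrow> y\<guillemotright>" and x: "x \<in> Z" and y: "y \<in> Z"
    and "\<guillemotleft>c : ang ch x \<rightarrow> ang ch y\<guillemotright>" "c \<cdot> bet ch x = bet ch y \<cdot> smap x y f"
  shows "fmap F x y f = c"
  using bet_cancel[OF x ang_Z[OF y] fmap_F(1)[OF f x y] assms(4)] fmap_F(2)[OF f x y] assms(5) by simp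

lemma F_linear: "linear_functor R F"
proof (rule R.linear_functorI)
  fix x y z f g a
  show "fobj F x \<in> Obj R" if "x \<in> Obj R" using that ang_Z by simp
  show "fmap F x x (ident R x) = ident R (fobj F x)" if "x \<in> Obj R"
  proof -
    have x: "x \<in> Z" "x \<in> Obj T" using that Z_obj by auto
    show ?thesis
      using fmap_F_unique[OF arr_ident[OF x(2)] x(1,1) arr_ident[OF ang_obj[OF x(1)]]]
        smap_ident[OF x(2)] ident_comp[OF bet_arr[OF x(1)]] comp_ident[OF bet_arr[OF x(1)]] by simp
  qed
  show "\<guillemotleft>fmap F x y f : fobj F x \<rightarrow> fobj F y\<guillemotright>\<^bsub>R\<^esub>" if "\<guillemotleft>f : x \<rightarrow> y\<guillemotright>\<^bsub>R\<^esub>"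
    using that fmap_F(1) ang_Z by (simp add: arrow_R)
  show "fmap F x y (f + g) = fmap F x y f + fmap F x y g" if "\<guillemotleft>f : x \<rightarrow> y\<guillemotright>\<^bsub>R\<^esub>" "\<guillemotleft>g : x \<rightarrow> y\<guillemotright>\<^bsub>R\<^esub>"
  proof -
    have x: "x \<in> Z" and y: "y \<in> Z" and f: "\<guillemotleft>f : x \<rightarrow> y\<guillemotright>" and g: "\<guillemotleft>g : x \<rightarrow> y\<guillemotright>" using that by (auto simp: arrow_R)
    note Ff = fmap_F[OF f x y] and Fg = fmap_F[OF g x y]
    show ?thesis
      using add_comp[OF Ff(1) Fg(1) bet_arr[OF x]] comp_add[OF bet_arr[OF y] smap_arr[OF f] smap_arr[OF g]]
        functor_add[OF shift_linear f g] Ff(2) Fg(2)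
      by (intro fmap_F_unique[OF arr_add[OF f g] x y arr_add[OF Ff(1) Fg(1)]]) simp
  qed
  show "fmap F x y (smul R a f) = smul R a (fmap F x y f)" if "\<guillemotleft>f : x \<rightarrow> y\<guillemotright>\<^bsub>R\<^esub>"
  proof -
    have x: "x \<in> Z" and y: "y \<in> Z" and f: "\<guillemotleft>f : x \<rightarrow> y\<guillemotright>" using that by (auto simp: arrow_R)
    note Ff = fmap_F[OF f x y]
    have "fmap F x y (smul T a f) = smul T a (fmap F x y f)"
      by (intro fmap_F_unique[OF arr_smul[OF f] x y arr_smul[OF Ff(1)]])
        (simp add: smul_comp[OF Ff(1) bet_arr[OF x]] comp_smul[OF bet_arr[OF y] smap_arr[OF f]]
          functor_smul[OF shift_linear f] Ff(2))
    then show ?thesis by simp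
  qed
  show "fmap F x z (g \<cdot>\<^bsub>R\<^esub> f) = fmap F y z g \<cdot>\<^bsub>R\<^esub> fmap F x y f" if "\<guillemotleft>g : y \<rightarrow> z\<guillemotright>\<^bsub>R\<^esub>" "\<guillemotleft>f : x \<rightarrow> y\<guillemotright>\<^bsub>R\<^esub>"
  proof -
    have x: "x \<in> Z" and y: "y \<in> Z" and z: "z \<in> Z" and f: "\<guillemotleft>f : x \<rightarrow> y\<guillemotright>" and g: "\<guillemotleft>g : y \<rightarrow> z\<guillemotright>"
      using that by (auto simp: arrow_R)
    note Ff = fmap_F[OF f x y] and Fg = fmap_F[OF g y z]
    have "(fmap F y z g \<cdot> fmap F x y f) \<cdot> bet ch x = bet ch z \<cdot> smap x z (g \<cdot> f)"
      using assoc[OF Fg(1) Ff(1) bet_arr[OF x]] assoc[OF Fg(1) bet_arr[OF y] smap_arr[OF f]]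
        assoc[OF bet_arr[OF z] smap_arr[OF g] smap_arr[OF f]] smap_comp[OF g f] Ff(2) Fg(2) by simp
    then show ?thesis
      using fmap_F_unique[OF arr_comp[OF g f] x z arr_comp[OF Fg(1) Ff(1)]] by simp
  qed
qed

text \<open>
  Here the full vanishing range is used: for \<open>j = w - 1\<close> one needs \<open>Hom(\<Sigma>\<^sup>wz, s\<^sub>x) = 0\<close>.
\<close>

lemma bijective_from_bet:
  assumes x: "x \<in> Z" and z: "z \<in> Z" and j: "j < w"
  shows "bijective_from ((\<Sigma> ^^ Suc j) z) (\<Sigma> x) (ang ch x) (bet ch x)"
proof (rule bijective_from_cone[OF chosen_triangle[OF x]])
  note e = apx_ext[OF x]
  show "hom T ((\<Sigma> ^^ Suc j) z) (apx ch x) = {0}"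
    using Z_vanish_ext(2)[OF z _ e, of "Suc j"] j by simp
  show "hom T ((\<Sigma> ^^ Suc j) z) (\<Sigma> (apx ch x)) = {0}"
    using Z_vanish_ext(2)[OF z _ e, of j] j vanish_shift[OF shift_power_obj[OF Z_obj[OF z]] ext_objD[OF e]] by simp
  show "(\<Sigma> ^^ Suc j) z \<in> Obj T" using shift_power_obj Z_obj z by blast
qed

text \<open>
  Composition with \<open>\<Sigma>y \<rightarrow> y\<langle>1\<rangle>\<close> is bijective from \<open>Hom(\<Sigma>x, \<Sigma>y)\<close> to \<open>Hom(\<Sigma>x, y\<langle>1\<rangle>)\<close>, and the latter is
  \<open>Hom(x\<langle>1\<rangle>, y\<langle>1\<rangle>)\<close> by the universal property.
\<close>

lemma F_fully_faithful: "fully_faithful R F"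
proof (rule R.fully_faithfulI[OF F_linear])
  fix x y
  have bij: "bijective_from (\<Sigma> x) (\<Sigma> y) (ang ch y) (bet ch y)" if "x \<in> Z" "y \<in> Z"
    using bijective_from_bet[OF that(2,1), of 0] w by simp
  show "f = g" if "\<guillemotleft>f : x \<rightarrow> y\<guillemotright>\<^bsub>R\<^esub>" "\<guillemotleft>g : x \<rightarrow> y\<guillemotright>\<^bsub>R\<^esub>" and eq: "fmap F x y f = fmap F x y g" for f g
  proof -
    have x: "x \<in> Z" and y: "y \<in> Z" and f: "\<guillemotleft>f : x \<rightarrow> y\<guillemotright>" and g: "\<guillemotleft>g : x \<rightarrow> y\<guillemotright>" using that by (auto simp: arrow_R)
    have "bet ch y \<cdot> smap x y f = bet ch y \<cdot> smap x y g"
      using fmap_F(2)[OF f x y] fmap_F(2)[OF g x y] eq by metis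
    then have "smap x y f = smap x y g"
      using bij[OF x y] smap_arr[OF f] smap_arr[OF g] arr_comp[OF bet_arr[OF y] smap_arr[OF g]]
      unfolding bijective_from_def by metis
    then show ?thesis using smap_faithful f g by blast
  qed
  fix h assume "x \<in> Obj R" "y \<in> Obj R" "\<guillemotleft>h : fobj F x \<rightarrow> fobj F y\<guillemotright>\<^bsub>R\<^esub>"
  then have x: "x \<in> Z" and y: "y \<in> Z" and h: "\<guillemotleft>h : ang ch x \<rightarrow> ang ch y\<guillemotright>" by (auto simp: arrow_R)
  obtain k where k: "\<guillemotleft>k : \<Sigma> x \<rightarrow> \<Sigma> y\<guillemotright>" "bet ch y \<cdot> k = h \<cdot> bet ch x"
    using bij[OF x y] arr_comp[OF h bet_arr[OF x]] unfolding bijective_from_def by blast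
  obtain f where f: "\<guillemotleft>f : x \<rightarrow> y\<guillemotright>" "smap x y f = k" using smap_full[OF Z_obj[OF x] Z_obj[OF y] k(1)] by blast
  have "fmap F x y f = h" using fmap_F_unique[OF f(1) x y h] f(2) k(2) by simp
  then show "\<exists>f. \<guillemotleft>f : x \<rightarrow> y\<guillemotright>\<^bsub>R\<^esub> \<and> fmap F x y f = h" using f(1) x y by (auto simp: arrow_R)
qed

text \<open>
  Any triangle \<open>s \<rightarrow> \<Sigma>x \<rightarrow> y \<rightarrow> \<Sigma>s\<close> with \<open>s\<close> in the extension closure and \<open>y \<in> Z\<close> gives \<open>\<Sigma>x \<rightarrow> y\<close> the same
  universal property, so \<open>y\<close> is isomorphic to \<open>x\<langle>1\<rangle>\<close>.
\<close>

lemma F_essentially_surjective: "essentially_surjective R F"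
  unfolding essentially_surjective_def
proof
  fix y assume "y \<in> Obj R"
  then have y: "y \<in> Z" by simp
  obtain x s a b c where x: "x \<in> Z" and s: "s \<in> ext" and t: "dtri T s (\<Sigma> x) y a b c"
    using Z_is_cone[OF y] by metis
  note dt = dtriD[OF t] and \<beta> = bet_arr[OF x]
  obtain k where k: "\<guillemotleft>k : ang ch x \<rightarrow> y\<guillemotright>" "k \<cdot> bet ch x = b" using bet_extend[OF x y dt(5)] by metis
  obtain l where l: "\<guillemotleft>l : y \<rightarrow> ang ch x\<guillemotright>" "l \<cdot> b = bet ch x"
    using extend_over_cone[OF t Z_vanish_ext0(1)[OF ang_Z[OF x] s] \<beta>] by blast
  have "l \<cdot> k = ident T (ang ch x)"
    using bet_cancel[OF x ang_Z[OF x] arr_comp[OF l(1) k(1)] arr_ident[OF ang_obj[OF x]]]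
      assoc[OF l(1) k(1) \<beta>] k(2) l(2) ident_comp[OF \<beta>] by simp
  moreover have "k \<cdot> l = ident T y"
    using cone_cancel[OF t Z_vanish_ext1(1)[OF y s] arr_comp[OF k(1) l(1)] arr_ident[OF Z_obj[OF y]]]
      assoc[OF k(1) l(1) dt(5)] k(2) l(2) ident_comp[OF dt(5)] by simp
  ultimately have "is_iso T (ang ch x) y k" using isoI[OF k(1) l(1)] by blast
  then show "\<exists>x\<in>Obj R. isomorphic R (fobj F x) y" using x by (auto simp: isomorphic_def)
qed

lemma F_autoequivalence: "autoequivalence R F"
  using R.autoequivalenceI[OF F_linear F_fully_faithful F_essentially_surjective] .

end


section \<open>Comparing negative shifts\<close>

context triangulated_category
begin

lemma bijective_from_ident: "bijective_from u a a (ident T a)"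
  unfolding bijective_from_def using ident_comp by metis

lemma bijective_from_comp:
  assumes m: "\<guillemotleft>m : a \<rightarrow> b\<guillemotright>" and n: "\<guillemotleft>n : b \<rightarrow> c\<guillemotright>"
    and bm: "bijective_from u a b m" and bn: "bijective_from u b c n"
  shows "bijective_from u a c (n \<cdot> m)"
  unfolding bijective_from_def
proof (intro allI impI)
  fix g assume g: "\<guillemotleft>g : u \<rightarrow> c\<guillemotright>"
  obtain h where h: "\<guillemotleft>h : u \<rightarrow> b\<guillemotright>" "n \<cdot> h = g" and uh: "\<And>h'. \<lbrakk>\<guillemotleft>h' : u \<rightarrow> b\<guillemotright>; n \<cdot> h' = g\<rbrakk> \<Longrightarrow> h' = h"
    using bn g unfolding bijective_from_def by blast
  obtain f where f: "\<guillemotleft>f : u \<rightarrow> a\<guillemotright>" "m \<cdot> f = h" and uf: "\<And>f'. \<lbrakk>\<guillemotleft>f' : u \<rightarrow> a\<guillemotright>; m \<cdot> f' = h\<rbrakk> \<Longrightarrow> f' = f"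
    using bm h unfolding bijective_from_def by blast
  show "\<exists>!f. \<guillemotleft>f : u \<rightarrow> a\<guillemotright> \<and> (n \<cdot> m) \<cdot> f = g"
  proof (rule ex1I[of _ f])
    show "\<guillemotleft>f : u \<rightarrow> a\<guillemotright> \<and> (n \<cdot> m) \<cdot> f = g" using f h assoc[OF n m f(1)] by simp
    fix f' assume f': "\<guillemotleft>f' : u \<rightarrow> a\<guillemotright> \<and> (n \<cdot> m) \<cdot> f' = g"
    then have "n \<cdot> (m \<cdot> f') = g" using assoc[OF n m] by metis
    then have "m \<cdot> f' = h" using uh arr_comp[OF m] f' by blast
    then show "f' = f" using uf f' by blast
  qed
qed

lemma bijective_from_iso:
  assumes e: "is_iso T a b e" and ob: "a \<in> Obj T" "b \<in> Obj T"
  shows "bijective_from u a b e"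
proof -
  obtain k where k: "\<guillemotleft>e : a \<rightarrow> b\<guillemotright>" "\<guillemotleft>k : b \<rightarrow> a\<guillemotright>" "k \<cdot> e = ident T a" "e \<cdot> k = ident T b"
    using isoE[OF e ob] by metis
  show ?thesis
    unfolding bijective_from_def
    using cancel_left[OF k(2,1,3)] cancel_left[OF k(1,2,4)] arr_comp[OF k(2)] by metis
qed

text \<open>
  The transpose of \<open>k\<close> under the adjunction of \<open>\<Sigma>\<close> and its quasi-inverse is \<open>e \<cdot> \<Sigma>k\<close>; bijectivity can be
  tested on transposes.
\<close>

lemma bijective_from_unshift:
  assumes k: "\<guillemotleft>k : a \<rightarrow> b\<guillemotright>" and e: "is_iso T (\<Sigma> b) c e" and c: "c \<in> Obj T" and u: "u \<in> Obj T"
    and bij: "bijective_from (\<Sigma> u) (\<Sigma> a) c (e \<cdot> smap a b k)"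
  shows "bijective_from u a b k"
  unfolding bijective_from_def
proof (intro allI impI)
  have ob: "a \<in> Obj T" "b \<in> Obj T" using k arr_src arr_tgt by blast+
  obtain e' where e': "\<guillemotleft>e : \<Sigma> b \<rightarrow> c\<guillemotright>" "\<guillemotleft>e' : c \<rightarrow> \<Sigma> b\<guillemotright>" "e' \<cdot> e = ident T (\<Sigma> b)"
    using isoE[OF e shift_obj[OF ob(2)] c] by metis
  note sk = smap_arr[OF k]
  fix g assume g: "\<guillemotleft>g : u \<rightarrow> b\<guillemotright>"
  have eg: "\<guillemotleft>e \<cdot> smap u b g : \<Sigma> u \<rightarrow> c\<guillemotright>" using arr_comp[OF e'(1) smap_arr[OF g]] .
  have key: "(e \<cdot> smap a b k) \<cdot> smap u a f = e \<cdot> smap u b g \<longleftrightarrow> k \<cdot> f = g" if f: "\<guillemotleft>f : u \<rightarrow> a\<guillemotright>" for f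
  proof -
    have "(e \<cdot> smap a b k) \<cdot> smap u a f = e \<cdot> smap u b (k \<cdot> f)"
      using assoc[OF e'(1) sk smap_arr[OF f]] smap_comp[OF k f] by simp
    moreover have "e \<cdot> smap u b (k \<cdot> f) = e \<cdot> smap u b g \<longleftrightarrow> smap u b (k \<cdot> f) = smap u b g"
      using cancel_left[OF e'(2,1,3) smap_arr[OF g]] cancel_left[OF e'(2,1,3) smap_arr[OF arr_comp[OF k f]]]
      by metis
    ultimately show ?thesis using smap_faithful[OF arr_comp[OF k f] g] by metis
  qed
  obtain f0 where f0: "\<guillemotleft>f0 : \<Sigma> u \<rightarrow> \<Sigma> a\<guillemotright>" "(e \<cdot> smap a b k) \<cdot> f0 = e \<cdot> smap u b g"
    and uniq: "\<And>f1. \<lbrakk>\<guillemotleft>f1 : \<Sigma> u \<rightarrow> \<Sigma> a\<guillemotright>; (e \<cdot> smap a b k) \<cdot> f1 = e \<cdot> smap u b g\<rbrakk> \<Longrightarrow> f1 = f0"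
    using bij eg unfolding bijective_from_def by metis
  obtain f where f: "\<guillemotleft>f : u \<rightarrow> a\<guillemotright>" "smap u a f = f0" using smap_full[OF u ob(1) f0(1)] by blast
  show "\<exists>!f. \<guillemotleft>f : u \<rightarrow> a\<guillemotright> \<and> k \<cdot> f = g"
  proof (rule ex1I[of _ f])
    show "\<guillemotleft>f : u \<rightarrow> a\<guillemotright> \<and> k \<cdot> f = g" using f f0(2) key[OF f(1)] by metis
    fix f' assume f': "\<guillemotleft>f' : u \<rightarrow> a\<guillemotright> \<and> k \<cdot> f' = g"
    then have "smap u a f' = smap u a f" using uniq key smap_arr f(2) by blast
    then show "f' = f" using smap_faithful f' f(1) by blast
  qed
qed

lemma inv_shift_counit:
  obtains \<epsilon> where "\<And>x. x \<in> Obj T \<Longrightarrow> is_iso T (\<Sigma> (\<Omega> x)) x (\<epsilon> x)"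
    "\<And>x y f. \<guillemotleft>f : x \<rightarrow> y\<guillemotright> \<Longrightarrow> \<epsilon> y \<cdot> smap (\<Omega> x) (\<Omega> y) (fmap inv_shift x y f) = f \<cdot> \<epsilon> x"
  using nat_iso_idE[of "shift T" inv_shift] inv_shift unfolding quasi_inverse_def by metis

lemma bijective_from_inv_shift:
  assumes m: "\<guillemotleft>m : a \<rightarrow> b\<guillemotright>" and u: "u \<in> Obj T" and bij: "bijective_from (\<Sigma> u) a b m"
  shows "bijective_from u (\<Omega> a) (\<Omega> b) (fmap inv_shift a b m)"
proof -
  obtain \<epsilon> where iso: "\<And>x. x \<in> Obj T \<Longrightarrow> is_iso T (\<Sigma> (\<Omega> x)) x (\<epsilon> x)"
    and nat: "\<And>x y f. \<guillemotleft>f : x \<rightarrow> y\<guillemotright> \<Longrightarrow> \<epsilon> y \<cdot> smap (\<Omega> x) (\<Omega> y) (fmap inv_shift x y f) = f \<cdot> \<epsilon> x"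
    using inv_shift_counit by blast
  have ob: "a \<in> Obj T" "b \<in> Obj T" using m arr_src arr_tgt by blast+
  have soa: "\<Sigma> (\<Omega> a) \<in> Obj T" using shift_obj inv_shift_obj ob by blast
  have "bijective_from (\<Sigma> u) (\<Sigma> (\<Omega> a)) b (m \<cdot> \<epsilon> a)"
    using bijective_from_comp[OF iso_arr[OF iso[OF ob(1)] soa ob(1)] m
        bijective_from_iso[OF iso[OF ob(1)] soa ob(1)] bij] .
  then show ?thesis
    using bijective_from_unshift[OF functor_arr[OF inv_shift_linear m] iso[OF ob(2)] ob(2) u] nat[OF m] by simp
qed

end

context cy_reduction
begin

text \<open>
  The reduced shift \<open>\<langle>-1\<rangle>\<close>, as the same choice of a quasi-inverse as in \<^const>\<open>functor_int_power\<close>.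
\<close>

definition G where "G = (SOME G. quasi_inverse R F G)"

lemma G_quasi_inverse: "quasi_inverse R F G"
  using F_autoequivalence someI_ex[of "quasi_inverse R F"] by (simp add: G_def autoequivalence_def)

lemma G_autoequivalence: "autoequivalence R G"
  using G_quasi_inverse R.quasi_inverse_sym[OF F_linear G_quasi_inverse]
  unfolding autoequivalence_def quasi_inverse_def by blast

lemma G_linear: "linear_functor R G"
  using G_quasi_inverse by (simp add: quasi_inverse_def)

lemma G_power_linear: "linear_functor R (functor_power G n)"
  using R.autoequivalence_power[OF G_autoequivalence] by (simp add: autoequivalence_def)

lemma G_Z: "x \<in> Z \<Longrightarrow> fobj G x \<in> Z"
  using R.functor_obj[OF G_linear] by simp

lemma G_power_Z: "x \<in> Z \<Longrightarrow> fobj (functor_power G n) x \<in> Z"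
  using R.functor_obj[OF G_power_linear] by simp

lemma inv_shift_power_linear: "linear_functor T (functor_power inv_shift n)"
proof -
  have "autoequivalence T inv_shift"
    using quasi_inverse_sym[OF shift_linear inv_shift] inv_shift
    unfolding autoequivalence_def quasi_inverse_def by blast
  then show ?thesis using autoequivalence_power by (simp add: autoequivalence_def)
qed

text \<open>
  \<open>\<kappa> y\<close> is the transpose of the composite \<open>\<Sigma>(y\<langle>-1\<rangle>) \<rightarrow> y\<langle>-1\<rangle>\<langle>1\<rangle> \<cong> y\<close>. Each asserted property is the
  transpose of a property of that composite.
\<close>

lemma comparison_exists:
  obtains \<kappa> where "\<And>y. y \<in> Z \<Longrightarrow> \<guillemotleft>\<kappa> y : fobj G y \<rightarrow> \<Omega> y\<guillemotright>"
    "\<And>x y f. \<lbrakk>x \<in> Z; y \<in> Z; \<guillemotleft>f : x \<rightarrow> y\<guillemotright>\<rbrakk> \<Longrightarrow> \<kappa> y \<cdot> fmap G x y f = fmap inv_shift x y f \<cdot> \<kappa> x"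
    "\<And>y z j. \<lbrakk>y \<in> Z; z \<in> Z; j < w\<rbrakk> \<Longrightarrow> bijective_from ((\<Sigma> ^^ j) z) (fobj G y) (\<Omega> y) (\<kappa> y)"
proof -
  obtain \<epsilon> where iso: "\<And>x. x \<in> Obj T \<Longrightarrow> is_iso T (\<Sigma> (\<Omega> x)) x (\<epsilon> x)"
    and nat: "\<And>x y f. \<guillemotleft>f : x \<rightarrow> y\<guillemotright> \<Longrightarrow> \<epsilon> y \<cdot> smap (\<Omega> x) (\<Omega> y) (fmap inv_shift x y f) = f \<cdot> \<epsilon> x"
    using inv_shift_counit by blast
  have "naturally_isomorphic R (comp_functor F G) id_functor"
    using G_quasi_inverse by (simp add: quasi_inverse_def)
  then obtain \<delta> where iso': "\<And>x. x \<in> Z \<Longrightarrow> is_iso T (ang ch (fobj G x)) x (\<delta> x)"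
    and nat': "\<And>x y f. \<guillemotleft>f : x \<rightarrow> y\<guillemotright>\<^bsub>R\<^esub> \<Longrightarrow>
      \<delta> y \<cdot> fmap F (fobj G x) (fobj G y) (fmap G x y f) = f \<cdot> \<delta> x"
    using R.nat_iso_idE[of F G] unfolding R_simps is_iso_R fobj_F by metis
  have \<epsilon>: "\<guillemotleft>\<epsilon> x : \<Sigma> (\<Omega> x) \<rightarrow> x\<guillemotright>" if "x \<in> Obj T" for x
    using iso_arr[OF iso[OF that]] shift_obj inv_shift_obj that by blast
  have \<delta>: "\<guillemotleft>\<delta> x : ang ch (fobj G x) \<rightarrow> x\<guillemotright>" if "x \<in> Z" for x
    using iso_arr[OF iso'[OF that]] ang_obj G_Z Z_obj that by blast
  define \<beta> where "\<beta> = (\<lambda>y. \<delta> y \<cdot> bet ch (fobj G y))"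
  have \<beta>: "\<guillemotleft>\<beta> y : \<Sigma> (fobj G y) \<rightarrow> y\<guillemotright>" if "y \<in> Z" for y
    unfolding \<beta>_def using arr_comp[OF \<delta>[OF that] bet_arr[OF G_Z[OF that]]] .
  have "\<exists>\<kappa>. \<forall>y\<in>Z. \<guillemotleft>\<kappa> y : fobj G y \<rightarrow> \<Omega> y\<guillemotright> \<and> \<epsilon> y \<cdot> smap (fobj G y) (\<Omega> y) (\<kappa> y) = \<beta> y"
  proof (intro bchoice ballI)
    fix y assume y: "y \<in> Z"
    note yo = Z_obj[OF y] and Go = Z_obj[OF G_Z[OF y]]
    obtain e where e: "\<guillemotleft>\<epsilon> y : \<Sigma> (\<Omega> y) \<rightarrow> y\<guillemotright>" "\<guillemotleft>e : y \<rightarrow> \<Sigma> (\<Omega> y)\<guillemotright>" "\<epsilon> y \<cdot> e = ident T y"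
      using isoE[OF iso[OF yo] shift_obj[OF inv_shift_obj[OF yo]] yo] by metis
    obtain k where "\<guillemotleft>k : fobj G y \<rightarrow> \<Omega> y\<guillemotright>" "smap (fobj G y) (\<Omega> y) k = e \<cdot> \<beta> y"
      using smap_full[OF Go inv_shift_obj[OF yo] arr_comp[OF e(2) \<beta>[OF y]]] by blast
    then show "\<exists>k. \<guillemotleft>k : fobj G y \<rightarrow> \<Omega> y\<guillemotright> \<and> \<epsilon> y \<cdot> smap (fobj G y) (\<Omega> y) k = \<beta> y"
      using cancel_left[OF e \<beta>[OF y]] by auto
  qed
  then obtain \<kappa> where \<kappa>: "\<And>y. y \<in> Z \<Longrightarrow> \<guillemotleft>\<kappa> y : fobj G y \<rightarrow> \<Omega> y\<guillemotright>"
    and \<kappa>\<beta>: "\<And>y. y \<in> Z \<Longrightarrow> \<epsilon> y \<cdot> smap (fobj G y) (\<Omega> y) (\<kappa> y) = \<beta> y" by blast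
  have natural: "\<kappa> y \<cdot> fmap G x y f = fmap inv_shift x y f \<cdot> \<kappa> x"
    if x: "x \<in> Z" and y: "y \<in> Z" and f: "\<guillemotleft>f : x \<rightarrow> y\<guillemotright>" for x y f
  proof -
    note xo = Z_obj[OF x] and yo = Z_obj[OF y] and Gx = G_Z[OF x] and Gy = G_Z[OF y]
    have fR: "\<guillemotleft>f : x \<rightarrow> y\<guillemotright>\<^bsub>R\<^esub>" using x y f by (simp add: arrow_R)
    then have Gf: "\<guillemotleft>fmap G x y f : fobj G x \<rightarrow> fobj G y\<guillemotright>"
      using R.functor_arr[OF G_linear] by (simp add: arrow_R)
    have Hf: "\<guillemotleft>fmap inv_shift x y f : \<Omega> x \<rightarrow> \<Omega> y\<guillemotright>" using functor_arr[OF inv_shift_linear f] .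
    have "\<epsilon> y \<cdot> smap (fobj G x) (\<Omega> y) (\<kappa> y \<cdot> fmap G x y f) = \<beta> y \<cdot> smap (fobj G x) (fobj G y) (fmap G x y f)"
      using smap_comp[OF \<kappa>[OF y] Gf] assoc[OF \<epsilon>[OF yo] smap_arr[OF \<kappa>[OF y]] smap_arr[OF Gf]] \<kappa>\<beta>[OF y] by simp
    also have "\<dots> = \<delta> y \<cdot> (fmap F (fobj G x) (fobj G y) (fmap G x y f) \<cdot> bet ch (fobj G x))"
      unfolding \<beta>_def using assoc[OF \<delta>[OF y] bet_arr[OF Gy] smap_arr[OF Gf]] fmap_F(2)[OF Gf Gx Gy] by simp
    also have "\<dots> = f \<cdot> \<beta> x"
      unfolding \<beta>_def using assoc[OF \<delta>[OF y] fmap_F(1)[OF Gf Gx Gy] bet_arr[OF Gx]] nat'[OF fR]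
        assoc[OF f \<delta>[OF x] bet_arr[OF Gx]] by simp
    also have "\<dots> = \<epsilon> y \<cdot> smap (fobj G x) (\<Omega> y) (fmap inv_shift x y f \<cdot> \<kappa> x)"
      using smap_comp[OF Hf \<kappa>[OF x]] assoc[OF \<epsilon>[OF yo] smap_arr[OF Hf] smap_arr[OF \<kappa>[OF x]]] nat[OF f]
        assoc[OF f \<epsilon>[OF xo] smap_arr[OF \<kappa>[OF x]]] \<kappa>\<beta>[OF x] by simp
    finally have eq: "\<epsilon> y \<cdot> smap (fobj G x) (\<Omega> y) (\<kappa> y \<cdot> fmap G x y f)
      = \<epsilon> y \<cdot> smap (fobj G x) (\<Omega> y) (fmap inv_shift x y f \<cdot> \<kappa> x)" .
    note a1 = arr_comp[OF \<kappa>[OF y] Gf] and a2 = arr_comp[OF Hf \<kappa>[OF x]]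
    obtain e where e: "\<guillemotleft>e : y \<rightarrow> \<Sigma> (\<Omega> y)\<guillemotright>" "e \<cdot> \<epsilon> y = ident T (\<Sigma> (\<Omega> y))"
      using isoE[OF iso[OF yo] shift_obj[OF inv_shift_obj[OF yo]] yo] by metis
    have "smap (fobj G x) (\<Omega> y) (\<kappa> y \<cdot> fmap G x y f) = smap (fobj G x) (\<Omega> y) (fmap inv_shift x y f \<cdot> \<kappa> x)"
      using eq cancel_left[OF e(1) \<epsilon>[OF yo] e(2) smap_arr[OF a1]] cancel_left[OF e(1) \<epsilon>[OF yo] e(2) smap_arr[OF a2]]
      by metis
    then show ?thesis using smap_faithful[OF a1 a2] by blast
  qed
  have "bijective_from ((\<Sigma> ^^ j) z) (fobj G y) (\<Omega> y) (\<kappa> y)"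
    if y: "y \<in> Z" and z: "z \<in> Z" and j: "j < w" for y z j
  proof -
    note yo = Z_obj[OF y] and Gy = G_Z[OF y]
    have "bijective_from (\<Sigma> ((\<Sigma> ^^ j) z)) (\<Sigma> (fobj G y)) y (\<beta> y)"
      unfolding \<beta>_def
      using bijective_from_comp[OF bet_arr[OF Gy] \<delta>[OF y]] bijective_from_bet[OF Gy z j]
        bijective_from_iso[OF iso'[OF y] ang_obj[OF Gy] yo] by simp
    then show ?thesis
      using bijective_from_unshift[OF \<kappa>[OF y] iso[OF yo] yo shift_power_obj[OF Z_obj[OF z]]] \<kappa>\<beta>[OF y] by simp
  qed
  then show ?thesis using that \<kappa> natural by blast
qed

text \<open>
  The comparison for \<open>n + 1\<close> is \<open>G (G\<^sup>nx) \<rightarrow> \<Omega> (G\<^sup>nx) \<rightarrow> \<Omega> (\<Omega>\<^sup>nx)\<close>. Transposing its second map trades one \<open>\<Omega>\<close>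
  for one \<open>\<Sigma>\<close> on the test object; this is why bijectivity is claimed for all \<open>\<Sigma>\<^sup>jz\<close> with \<open>j + n \<le> w\<close>.
\<close>

lemma power_comparison_exists:
  "\<exists>\<tau>. (\<forall>x\<in>Z. \<guillemotleft>\<tau> x : fobj (functor_power G n) x \<rightarrow> fobj (functor_power inv_shift n) x\<guillemotright>) \<and>
    (\<forall>x\<in>Z. \<forall>y\<in>Z. \<forall>f. \<guillemotleft>f : x \<rightarrow> y\<guillemotright> \<longrightarrow>
      \<tau> y \<cdot> fmap (functor_power G n) x y f = fmap (functor_power inv_shift n) x y f \<cdot> \<tau> x) \<and>
    (\<forall>x\<in>Z. \<forall>z\<in>Z. \<forall>j. j + n \<le> w \<longrightarrow>
      bijective_from ((\<Sigma> ^^ j) z) (fobj (functor_power G n) x) (fobj (functor_power inv_shift n) x) (\<tau> x))"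
proof (induction n)
  case 0
  show ?case
    by (rule exI[of _ "ident T"])
      (simp add: id_functor_def arr_ident Z_obj bijective_from_ident comp_ident ident_comp)
next
  case (Suc n)
  let ?G = "functor_power G n" and ?H = "functor_power inv_shift n"
  obtain \<tau> where \<tau>: "\<And>x. x \<in> Z \<Longrightarrow> \<guillemotleft>\<tau> x : fobj ?G x \<rightarrow> fobj ?H x\<guillemotright>"
    and \<tau>_nat: "\<And>x y f. \<lbrakk>x \<in> Z; y \<in> Z; \<guillemotleft>f : x \<rightarrow> y\<guillemotright>\<rbrakk> \<Longrightarrow> \<tau> y \<cdot> fmap ?G x y f = fmap ?H x y f \<cdot> \<tau> x"
    and \<tau>_bij: "\<And>x z j. \<lbrakk>x \<in> Z; z \<in> Z; j + n \<le> w\<rbrakk> \<Longrightarrow>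
      bijective_from ((\<Sigma> ^^ j) z) (fobj ?G x) (fobj ?H x) (\<tau> x)"
    using Suc.IH by blast
  obtain \<kappa> where \<kappa>: "\<And>y. y \<in> Z \<Longrightarrow> \<guillemotleft>\<kappa> y : fobj G y \<rightarrow> \<Omega> y\<guillemotright>"
    and \<kappa>_nat: "\<And>x y f. \<lbrakk>x \<in> Z; y \<in> Z; \<guillemotleft>f : x \<rightarrow> y\<guillemotright>\<rbrakk> \<Longrightarrow> \<kappa> y \<cdot> fmap G x y f = fmap inv_shift x y f \<cdot> \<kappa> x"
    and \<kappa>_bij: "\<And>y z j. \<lbrakk>y \<in> Z; z \<in> Z; j < w\<rbrakk> \<Longrightarrow>
      bijective_from ((\<Sigma> ^^ j) z) (fobj G y) (\<Omega> y) (\<kappa> y)"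
    using comparison_exists by blast
  define \<tau>' where "\<tau>' = (\<lambda>x. fmap inv_shift (fobj ?G x) (fobj ?H x) (\<tau> x) \<cdot> \<kappa> (fobj ?G x))"
  have H\<tau>: "\<guillemotleft>fmap inv_shift (fobj ?G x) (fobj ?H x) (\<tau> x) : \<Omega> (fobj ?G x) \<rightarrow> \<Omega> (fobj ?H x)\<guillemotright>" if "x \<in> Z" for x
    using functor_arr[OF inv_shift_linear \<tau>[OF that]] .
  have \<tau>': "\<guillemotleft>\<tau>' x : fobj G (fobj ?G x) \<rightarrow> \<Omega> (fobj ?H x)\<guillemotright>" if "x \<in> Z" for x
    unfolding \<tau>'_def using arr_comp[OF H\<tau>[OF that] \<kappa>[OF G_power_Z[OF that]]] .
  have nat: "\<tau>' y \<cdot> fmap G (fobj ?G x) (fobj ?G y) (fmap ?G x y f)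
      = fmap inv_shift (fobj ?H x) (fobj ?H y) (fmap ?H x y f) \<cdot> \<tau>' x"
    if x: "x \<in> Z" and y: "y \<in> Z" and f: "\<guillemotleft>f : x \<rightarrow> y\<guillemotright>" for x y f
  proof -
    note Gx = G_power_Z[OF x, of n] and Gy = G_power_Z[OF y, of n]
    have fR: "\<guillemotleft>f : x \<rightarrow> y\<guillemotright>\<^bsub>R\<^esub>" using x y f by (simp add: arrow_R)
    have Gf: "\<guillemotleft>fmap ?G x y f : fobj ?G x \<rightarrow> fobj ?G y\<guillemotright>"
      using R.functor_arr[OF G_power_linear fR] by (simp add: arrow_R)
    then have GfR: "\<guillemotleft>fmap ?G x y f : fobj ?G x \<rightarrow> fobj ?G y\<guillemotright>\<^bsub>R\<^esub>" using Gx Gy by (simp add: arrow_R)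
    then have GGf: "\<guillemotleft>fmap G (fobj ?G x) (fobj ?G y) (fmap ?G x y f) : fobj G (fobj ?G x) \<rightarrow> fobj G (fobj ?G y)\<guillemotright>"
      using R.functor_arr[OF G_linear] by (simp add: arrow_R)
    have Hf: "\<guillemotleft>fmap ?H x y f : fobj ?H x \<rightarrow> fobj ?H y\<guillemotright>" using functor_arr[OF inv_shift_power_linear f] .
    note HGf = functor_arr[OF inv_shift_linear Gf] and HHf = functor_arr[OF inv_shift_linear Hf]
    have "\<tau>' y \<cdot> fmap G (fobj ?G x) (fobj ?G y) (fmap ?G x y f)
      = fmap inv_shift (fobj ?G y) (fobj ?H y) (\<tau> y) \<cdot>
        (fmap inv_shift (fobj ?G x) (fobj ?G y) (fmap ?G x y f) \<cdot> \<kappa> (fobj ?G x))"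
      unfolding \<tau>'_def using assoc[OF H\<tau>[OF y] \<kappa>[OF Gy] GGf] \<kappa>_nat[OF Gx Gy Gf] by simp
    also have "\<dots> = fmap inv_shift (fobj ?G x) (fobj ?H y) (\<tau> y \<cdot> fmap ?G x y f) \<cdot> \<kappa> (fobj ?G x)"
      using assoc[OF H\<tau>[OF y] HGf \<kappa>[OF Gx]] functor_comp[OF inv_shift_linear \<tau>[OF y] Gf] by simp
    also have "\<dots> = fmap inv_shift (fobj ?G x) (fobj ?H y) (fmap ?H x y f \<cdot> \<tau> x) \<cdot> \<kappa> (fobj ?G x)"
      using \<tau>_nat[OF x y f] by simp
    also have "\<dots> = fmap inv_shift (fobj ?H x) (fobj ?H y) (fmap ?H x y f) \<cdot> \<tau>' x"
      unfolding \<tau>'_def using assoc[OF HHf H\<tau>[OF x] \<kappa>[OF Gx]] functor_comp[OF inv_shift_linear Hf \<tau>[OF x]] by simp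
    finally show ?thesis .
  qed
  have bij: "bijective_from ((\<Sigma> ^^ j) z) (fobj G (fobj ?G x)) (\<Omega> (fobj ?H x)) (\<tau>' x)"
    if x: "x \<in> Z" and z: "z \<in> Z" and j: "j + Suc n \<le> w" for x z j
  proof -
    have "bijective_from (\<Sigma> ((\<Sigma> ^^ j) z)) (fobj ?G x) (fobj ?H x) (\<tau> x)"
      using \<tau>_bij[OF x z, of "Suc j"] j by simp
    then have "bijective_from ((\<Sigma> ^^ j) z) (\<Omega> (fobj ?G x)) (\<Omega> (fobj ?H x)) (fmap inv_shift (fobj ?G x) (fobj ?H x) (\<tau> x))"
      using bijective_from_inv_shift[OF \<tau>[OF x] shift_power_obj[OF Z_obj[OF z]]] by blast
    then show ?thesis
      unfolding \<tau>'_def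
      using bijective_from_comp[OF \<kappa>[OF G_power_Z[OF x]] H\<tau>[OF x] \<kappa>_bij[OF G_power_Z[OF x] z]] j by simp
  qed
  show ?case
    by (rule exI[of _ \<tau>']) (use \<tau>' nat bij in \<open>simp add: comp_functor_def\<close>)
qed


section \<open>The Serre functor of the reduction\<close>

text \<open>
  The Serre functor \<open>Q\<close> is merely isomorphic to \<open>\<Omega>\<^sup>w\<close>, so the comparison is composed with that isomorphism.
\<close>

lemma serre_comparison_exists:
  assumes Fs: "serre_functor T Q" and ni: "naturally_isomorphic T Q (functor_power inv_shift w)"
  obtains \<sigma> where "\<And>x. x \<in> Z \<Longrightarrow> \<guillemotleft>\<sigma> x : fobj (functor_power G w) x \<rightarrow> fobj Q x\<guillemotright>"
    "\<And>x y f. \<lbrakk>x \<in> Z; y \<in> Z; \<guillemotleft>f : x \<rightarrow> y\<guillemotright>\<rbrakk> \<Longrightarrow> \<sigma> y \<cdot> fmap (functor_power G w) x y f = fmap Q x y f \<cdot> \<sigma> x"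
    "\<And>x z. \<lbrakk>x \<in> Z; z \<in> Z\<rbrakk> \<Longrightarrow> bijective_from z (fobj (functor_power G w) x) (fobj Q x) (\<sigma> x)"
proof -
  let ?G = "functor_power G w" and ?H = "functor_power inv_shift w"
  have Q: "linear_functor T Q" using Fs by (simp add: serre_functor_def autoequivalence_def)
  obtain \<tau> where \<tau>: "\<And>x. x \<in> Z \<Longrightarrow> \<guillemotleft>\<tau> x : fobj ?G x \<rightarrow> fobj ?H x\<guillemotright>"
    and \<tau>_nat: "\<And>x y f. \<lbrakk>x \<in> Z; y \<in> Z; \<guillemotleft>f : x \<rightarrow> y\<guillemotright>\<rbrakk> \<Longrightarrow> \<tau> y \<cdot> fmap ?G x y f = fmap ?H x y f \<cdot> \<tau> x"
    and \<tau>_bij: "\<And>x z j. \<lbrakk>x \<in> Z; z \<in> Z; j + w \<le> w\<rbrakk> \<Longrightarrow>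
      bijective_from ((\<Sigma> ^^ j) z) (fobj ?G x) (fobj ?H x) (\<tau> x)"
    using power_comparison_exists[of w] by blast
  obtain \<theta> where iso: "\<And>x. x \<in> Obj T \<Longrightarrow> is_iso T (fobj Q x) (fobj ?H x) (\<theta> x)"
    and nat: "\<And>x y f. \<guillemotleft>f : x \<rightarrow> y\<guillemotright> \<Longrightarrow> \<theta> y \<cdot> fmap Q x y f = fmap ?H x y f \<cdot> \<theta> x"
    using ni unfolding naturally_isomorphic_def arrow_def by blast
  note Qo = functor_obj[OF Q] and Ho = functor_obj[OF inv_shift_power_linear]
  have "\<exists>\<theta>'. \<forall>x\<in>Obj T. \<guillemotleft>\<theta> x : fobj Q x \<rightarrow> fobj ?H x\<guillemotright> \<and> \<guillemotleft>\<theta>' x : fobj ?H x \<rightarrow> fobj Q x\<guillemotright> \<and>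
      \<theta>' x \<cdot> \<theta> x = ident T (fobj Q x) \<and> \<theta> x \<cdot> \<theta>' x = ident T (fobj ?H x) \<and>
      is_iso T (fobj ?H x) (fobj Q x) (\<theta>' x)"
  proof (intro bchoice ballI)
    fix x assume x: "x \<in> Obj T"
    show "\<exists>k. \<guillemotleft>\<theta> x : fobj Q x \<rightarrow> fobj ?H x\<guillemotright> \<and> \<guillemotleft>k : fobj ?H x \<rightarrow> fobj Q x\<guillemotright> \<and>
      k \<cdot> \<theta> x = ident T (fobj Q x) \<and> \<theta> x \<cdot> k = ident T (fobj ?H x) \<and> is_iso T (fobj ?H x) (fobj Q x) k"
      using isoE[OF iso[OF x] Qo[OF x] Ho[OF x]] by metis
  qed
  then obtain \<theta>' where \<theta>: "\<And>x. x \<in> Obj T \<Longrightarrow> \<guillemotleft>\<theta> x : fobj Q x \<rightarrow> fobj ?H x\<guillemotright>"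
    and \<theta>': "\<And>x. x \<in> Obj T \<Longrightarrow> \<guillemotleft>\<theta>' x : fobj ?H x \<rightarrow> fobj Q x\<guillemotright>"
    and inv: "\<And>x. x \<in> Obj T \<Longrightarrow> \<theta>' x \<cdot> \<theta> x = ident T (fobj Q x)"
      "\<And>x. x \<in> Obj T \<Longrightarrow> \<theta> x \<cdot> \<theta>' x = ident T (fobj ?H x)"
    and iso': "\<And>x. x \<in> Obj T \<Longrightarrow> is_iso T (fobj ?H x) (fobj Q x) (\<theta>' x)" by blast
  have nat': "\<theta>' y \<cdot> fmap ?H x y f = fmap Q x y f \<cdot> \<theta>' x" if f: "\<guillemotleft>f : x \<rightarrow> y\<guillemotright>" for x y f
  proof -
    have ob: "x \<in> Obj T" "y \<in> Obj T" using f arr_src arr_tgt by blast+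
    note Qf = functor_arr[OF Q f] and Hf = functor_arr[OF inv_shift_power_linear f]
    have "\<theta>' y \<cdot> fmap ?H x y f = \<theta>' y \<cdot> ((fmap ?H x y f \<cdot> \<theta> x) \<cdot> \<theta>' x)"
      using cancel_right[OF \<theta>[OF ob(1)] \<theta>'[OF ob(1)] inv(2)[OF ob(1)] Hf] by simp
    also have "\<dots> = \<theta>' y \<cdot> ((\<theta> y \<cdot> fmap Q x y f) \<cdot> \<theta>' x)" using nat[OF f] by simp
    also have "\<dots> = fmap Q x y f \<cdot> \<theta>' x"
      using assoc[OF \<theta>[OF ob(2)] Qf \<theta>'[OF ob(1)]]
        cancel_left[OF \<theta>'[OF ob(2)] \<theta>[OF ob(2)] inv(1)[OF ob(2)] arr_comp[OF Qf \<theta>'[OF ob(1)]]] by simp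
    finally show ?thesis .
  qed
  define \<sigma> where "\<sigma> = (\<lambda>x. \<theta>' x \<cdot> \<tau> x)"
  show ?thesis
  proof (rule that[of \<sigma>])
    show "\<guillemotleft>\<sigma> x : fobj ?G x \<rightarrow> fobj Q x\<guillemotright>" if "x \<in> Z" for x
      unfolding \<sigma>_def using arr_comp[OF \<theta>'[OF Z_obj[OF that]] \<tau>[OF that]] .
    show "\<sigma> y \<cdot> fmap ?G x y f = fmap Q x y f \<cdot> \<sigma> x" if x: "x \<in> Z" and y: "y \<in> Z" and f: "\<guillemotleft>f : x \<rightarrow> y\<guillemotright>" for x y f
    proof -
      note xo = Z_obj[OF x] and yo = Z_obj[OF y]
      have "\<guillemotleft>f : x \<rightarrow> y\<guillemotright>\<^bsub>R\<^esub>" using x y f by (simp add: arrow_R)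
      then have Gf: "\<guillemotleft>fmap ?G x y f : fobj ?G x \<rightarrow> fobj ?G y\<guillemotright>"
        using R.functor_arr[OF G_power_linear] by (simp add: arrow_R)
      show ?thesis
        unfolding \<sigma>_def
        using assoc[OF \<theta>'[OF yo] \<tau>[OF y] Gf] \<tau>_nat[OF x y f] nat'[OF f]
          assoc[OF \<theta>'[OF yo] functor_arr[OF inv_shift_power_linear f] \<tau>[OF x]]
          assoc[OF functor_arr[OF Q f] \<theta>'[OF xo] \<tau>[OF x]] by simp
    qed
    show "bijective_from z (fobj ?G x) (fobj Q x) (\<sigma> x)" if x: "x \<in> Z" and z: "z \<in> Z" for x z
      unfolding \<sigma>_def
      using bijective_from_comp[OF \<tau>[OF x] \<theta>'[OF Z_obj[OF x]]] \<tau>_bij[OF x z, of 0]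
        bijective_from_iso[OF iso'[OF Z_obj[OF x]] Ho[OF Z_obj[OF x]] Qo[OF Z_obj[OF x]]] by simp
  qed
qed

lemma dual_space_pullback:
  assumes V: "subspace V" and L: "bij_betw L V W"
    and add: "\<And>u v. \<lbrakk>u \<in> V; v \<in> V\<rbrakk> \<Longrightarrow> L (u + v) = L u + L v"
    and scale: "\<And>a v. v \<in> V \<Longrightarrow> L (smul T a v) = smul T a (L v)"
  shows "bij_betw (\<lambda>\<phi>. restrict (\<lambda>v. \<phi> (L v)) V) (dual_space T W) (dual_space T V)"
proof (rule bij_betw_imageI)
  have inv: "L (inv_into V L u) = u" "inv_into V L u \<in> V" if "u \<in> W" for u
    using that L bij_betw_inv_into_right[OF L] bij_betw_imp_surj_on[OF L] inv_into_into[of u L V] by auto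
  have inv': "inv_into V L (L v) = v" "L v \<in> W" if "v \<in> V" for v
    using that bij_betw_inv_into_left[OF L] bij_betw_apply[OF L] by auto
  show "inj_on (\<lambda>\<phi>. restrict (\<lambda>v. \<phi> (L v)) V) (dual_space T W)"
  proof (rule inj_onI)
    fix \<phi> \<psi> assume p: "\<phi> \<in> dual_space T W" "\<psi> \<in> dual_space T W"
      and eq: "restrict (\<lambda>v. \<phi> (L v)) V = restrict (\<lambda>v. \<psi> (L v)) V"
    have "\<phi> u = \<psi> u" if "u \<in> W" for u
      using fun_cong[OF eq, of "inv_into V L u"] inv[OF that] by simp
    then show "\<phi> = \<psi>" using p extensionalityI[of \<phi> W \<psi>] by (simp add: dual_space_def)
  qed
  show "(\<lambda>\<phi>. restrict (\<lambda>v. \<phi> (L v)) V) ` dual_space T W = dual_space T V"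
  proof (intro equalityI subsetI)
    fix \<psi> assume "\<psi> \<in> (\<lambda>\<phi>. restrict (\<lambda>v. \<phi> (L v)) V) ` dual_space T W"
    then obtain \<phi> where \<phi>: "\<phi> \<in> dual_space T W" and eq: "\<psi> = restrict (\<lambda>v. \<phi> (L v)) V" by blast
    show "\<psi> \<in> dual_space T V"
      unfolding eq dual_space_def
      using \<phi> V add scale inv'(2) subspace_add[OF V] subspace_scale[OF V] by (simp add: dual_space_def)
  next
    fix \<psi> assume \<psi>: "\<psi> \<in> dual_space T V"
    define \<phi> where "\<phi> = restrict (\<lambda>u. \<psi> (inv_into V L u)) W"
    have W_add: "u + v \<in> W \<and> inv_into V L (u + v) = inv_into V L u + inv_into V L v" if "u \<in> W" "v \<in> W" for u v
      using inv'[OF subspace_add[OF V inv(2)[OF that(1)] inv(2)[OF that(2)]]]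
        add[OF inv(2)[OF that(1)] inv(2)[OF that(2)]] inv(1)[OF that(1)] inv(1)[OF that(2)] by simp
    have W_scale: "smul T a u \<in> W \<and> inv_into V L (smul T a u) = smul T a (inv_into V L u)" if "u \<in> W" for u a
      using inv'[OF subspace_scale[OF V inv(2)[OF that]]] scale[OF inv(2)[OF that]] inv(1)[OF that] by simp
    have "\<phi> \<in> dual_space T W"
      using \<psi> W_add W_scale inv(2) by (simp add: dual_space_def \<phi>_def)
    moreover have "\<psi> = restrict (\<lambda>v. \<phi> (L v)) V"
    proof (rule extensionalityI[of _ V])
      show "\<psi> \<in> extensional V" using \<psi> by (simp add: dual_space_def)
    qed (use inv' in \<open>simp_all add: \<phi>_def\<close>)
    ultimately show "\<psi> \<in> (\<lambda>\<phi>. restrict (\<lambda>v. \<phi> (L v)) V) ` dual_space T W" by blast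
  qed
qed

text \<open>
  The functional attached to \<open>f : x \<rightarrow> y\<close> sends \<open>v : y \<rightarrow> x\<langle>-w\<rangle>\<close> to the value of the functional of the ambient
  category on \<open>\<sigma>\<^sub>x v : y \<rightarrow> Q x\<close>. Bijectivity of \<open>v \<mapsto> \<sigma>\<^sub>x v\<close> keeps the pairing perfect, and naturality of
  \<open>\<sigma>\<close> keeps it natural.
\<close>

lemma serre_functor_reduction: "serre_functor R (functor_power G w)"
proof -
  let ?G = "functor_power G w"
  obtain Q where Fs: "serre_functor T Q" and ni: "naturally_isomorphic T Q (functor_power inv_shift w)"
    using cy by (auto simp: calabi_yau_def shiftpow_neg)
  have Q: "linear_functor T Q" using Fs by (simp add: serre_functor_def autoequivalence_def)
  obtain \<eta> where
    \<eta>: "\<forall>x\<in>Obj T. \<forall>y\<in>Obj T.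
      bij_betw (\<eta> x y) (hom T x y) (dual_space T (hom T y (fobj Q x))) \<and>
      (\<forall>f\<in>hom T x y. \<forall>v\<in>hom T y (fobj Q x).
        (\<forall>g\<in>hom T x y. \<eta> x y (f + g) v = \<eta> x y f v + \<eta> x y g v) \<and>
        (\<forall>a. \<eta> x y (smul T a f) v = a * \<eta> x y f v))"
    and nat: "\<forall>x\<in>Obj T. \<forall>x'\<in>Obj T. \<forall>y\<in>Obj T. \<forall>y'\<in>Obj T.
      \<forall>a\<in>hom T x' x. \<forall>f\<in>hom T x y. \<forall>b\<in>hom T y y'. \<forall>v\<in>hom T y' (fobj Q x').
        \<eta> x' y' (b \<cdot> f \<cdot> a) v = \<eta> x y f (fmap Q x' x a \<cdot> v \<cdot> b)"
    using Fs unfolding serre_functor_def by (elim conjE exE)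
  have bij: "bij_betw (\<eta> x y) (hom T x y) (dual_space T (hom T y (fobj Q x)))"
    if "x \<in> Obj T" "y \<in> Obj T" for x y
    using \<eta> that by blast
  have lin: "\<eta> x y (f + g) v = \<eta> x y f v + \<eta> x y g v" "\<eta> x y (smul T a f) v = a * \<eta> x y f v"
    if "x \<in> Obj T" "y \<in> Obj T" "f \<in> hom T x y" "v \<in> hom T y (fobj Q x)" "g \<in> hom T x y" for x y f v g a
    using \<eta> that by simp_all
  obtain \<sigma> where \<sigma>: "\<And>x. x \<in> Z \<Longrightarrow> \<guillemotleft>\<sigma> x : fobj ?G x \<rightarrow> fobj Q x\<guillemotright>"
    and \<sigma>_nat: "\<And>x y f. \<lbrakk>x \<in> Z; y \<in> Z; \<guillemotleft>f : x \<rightarrow> y\<guillemotright>\<rbrakk> \<Longrightarrow> \<sigma> y \<cdot> fmap ?G x y f = fmap Q x y f \<cdot> \<sigma> x"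
    and \<sigma>_bij: "\<And>x z. \<lbrakk>x \<in> Z; z \<in> Z\<rbrakk> \<Longrightarrow> bijective_from z (fobj ?G x) (fobj Q x) (\<sigma> x)"
    using serre_comparison_exists[OF Fs ni] by blast
  note Gx = Z_obj[OF G_power_Z]
  define \<eta>' where "\<eta>' = (\<lambda>x y f. restrict (\<lambda>v. \<eta> x y f (\<sigma> x \<cdot> v)) (hom T y (fobj ?G x)))"
  have \<sigma>v: "\<sigma> x \<cdot> v \<in> hom T y (fobj Q x)" if "x \<in> Z" "y \<in> Z" "v \<in> hom T y (fobj ?G x)" for x y v
    using arr_hom[OF arr_comp[OF \<sigma>[OF that(1)] arrI[OF that(3) Z_obj[OF that(2)] Gx[OF that(1)]]]] .
  have bij': "bij_betw (\<eta>' x y) (hom T x y) (dual_space T (hom T y (fobj ?G x)))" if x: "x \<in> Z" and y: "y \<in> Z" for x y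
  proof -
    note xo = Z_obj[OF x] and yo = Z_obj[OF y] and Go = Gx[OF x, of w]
    have "bij_betw (\<lambda>v. \<sigma> x \<cdot> v) (hom T y (fobj ?G x)) (hom T y (fobj Q x))"
      unfolding bij_betw_def
    proof
      have uniq: "\<exists>!f. \<guillemotleft>f : y \<rightarrow> fobj ?G x\<guillemotright> \<and> \<sigma> x \<cdot> f = g" if "g \<in> hom T y (fobj Q x)" for g
        using \<sigma>_bij[OF x y] arrI[OF that yo functor_obj[OF Q xo]] unfolding bijective_from_def by blast
      show "inj_on (\<lambda>v. \<sigma> x \<cdot> v) (hom T y (fobj ?G x))"
        by (rule inj_onI) (metis uniq \<sigma>v[OF x y] arrI yo Go)
      show "(\<lambda>v. \<sigma> x \<cdot> v) ` hom T y (fobj ?G x) = hom T y (fobj Q x)"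
      proof (intro equalityI subsetI)
        show "g \<in> (\<lambda>v. \<sigma> x \<cdot> v) ` hom T y (fobj ?G x)" if "g \<in> hom T y (fobj Q x)" for g
          using uniq[OF that] arr_hom by blast
      qed (use \<sigma>v[OF x y] in auto)
    qed
    then have "bij_betw (\<lambda>\<phi>. restrict (\<lambda>v. \<phi> (\<sigma> x \<cdot> v)) (hom T y (fobj ?G x)))
        (dual_space T (hom T y (fobj Q x))) (dual_space T (hom T y (fobj ?G x)))"
      using cmp_add_right[OF yo Go functor_obj[OF Q xo] _ _ arr_hom[OF \<sigma>[OF x]]]
        cmp_smul_right[OF yo Go functor_obj[OF Q xo] _ arr_hom[OF \<sigma>[OF x]]]
      by (intro dual_space_pullback[OF subspace_hom[OF yo Go]])
    from bij_betw_trans[OF bij[OF xo yo] this] show ?thesis by (simp add: \<eta>'_def comp_def)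
  qed
  have nat': "\<eta>' x' y' (b \<cdot> f \<cdot> a) v = \<eta>' x y f (fmap ?G x' x a \<cdot> v \<cdot> b)"
    if Z: "x \<in> Z" "x' \<in> Z" "y \<in> Z" "y' \<in> Z" and h: "a \<in> hom T x' x" "f \<in> hom T x y" "b \<in> hom T y y'"
      "v \<in> hom T y' (fobj ?G x')" for x x' y y' a f b v
  proof -
    note ob = Z[THEN Z_obj] and Go = Gx[OF Z(2), of w]
    have a: "\<guillemotleft>a : x' \<rightarrow> x\<guillemotright>" and b: "\<guillemotleft>b : y \<rightarrow> y'\<guillemotright>" and v: "\<guillemotleft>v : y' \<rightarrow> fobj ?G x'\<guillemotright>"
      using h ob Go by (auto simp: arrow_def)
    have "\<guillemotleft>a : x' \<rightarrow> x\<guillemotright>\<^bsub>R\<^esub>" using a Z by (simp add: arrow_R)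
    then have Ga: "\<guillemotleft>fmap ?G x' x a : fobj ?G x' \<rightarrow> fobj ?G x\<guillemotright>"
      using R.functor_arr[OF G_power_linear] by (simp add: arrow_R)
    note Qa = functor_arr[OF Q a]
    have Gavb: "fmap ?G x' x a \<cdot> v \<cdot> b \<in> hom T y (fobj ?G x)"
      using arr_hom[OF arr_comp[OF arr_comp[OF Ga v] b]] .
    have "\<eta>' x' y' (b \<cdot> f \<cdot> a) v = \<eta> x y f (fmap Q x' x a \<cdot> (\<sigma> x' \<cdot> v) \<cdot> b)"
      using nat ob h \<sigma>v[OF Z(2,4) h(4)] by (simp add: \<eta>'_def)
    also have "fmap Q x' x a \<cdot> (\<sigma> x' \<cdot> v) \<cdot> b = \<sigma> x \<cdot> (fmap ?G x' x a \<cdot> v \<cdot> b)"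
      using assoc[OF Qa \<sigma>[OF Z(2)] v] \<sigma>_nat[OF Z(2,1) a] assoc[OF \<sigma>[OF Z(1)] Ga v]
        assoc[OF \<sigma>[OF Z(1)] arr_comp[OF Ga v] b] by simp
    finally show ?thesis using Gavb by (simp add: \<eta>'_def)
  qed
  have dual: "dual_space R = dual_space T"
    by (intro ext) (simp add: dual_space_def)
  show ?thesis
    unfolding serre_functor_def R_simps dual
    using R.autoequivalence_power[OF G_autoequivalence] bij' nat' lin \<sigma>v Z_obj
    by (intro conjI exI[of _ \<eta>'] ballI allI) (simp_all add: \<eta>'_def)
qed

lemma calabi_yau_reduction:
  assumes "hom_finite T"
  shows "calabi_yau R (- int w)"
proof -
  have "shiftpow R (- int w) = functor_power G w"
    using w by (simp add: functor_int_power_def G_def)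
  moreover have "naturally_isomorphic R (functor_power G w) (functor_power G w)"
    unfolding naturally_isomorphic_def
  proof (intro exI[of _ "\<lambda>x. ident T (fobj (functor_power G w) x)"] conjI ballI)
    show "is_iso R (fobj (functor_power G w) x) (fobj (functor_power G w) x) (ident T (fobj (functor_power G w) x))"
      if "x \<in> Obj R" for x
      using that iso_ident[OF Z_obj[OF G_power_Z]] by simp
    fix x y f assume "x \<in> Obj R" "y \<in> Obj R" "f \<in> hom R x y"
    then have "\<guillemotleft>f : x \<rightarrow> y\<guillemotright>\<^bsub>R\<^esub>" by (simp add: arrow_def)
    then have "\<guillemotleft>fmap (functor_power G w) x y f : fobj (functor_power G w) x \<rightarrow> fobj (functor_power G w) y\<guillemotright>"
      using R.functor_arr[OF G_power_linear] by (simp add: arrow_R)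
    then show "ident T (fobj (functor_power G w) y) \<cdot>\<^bsub>R\<^esub> fmap (functor_power G w) x y f =
        fmap (functor_power G w) x y f \<cdot>\<^bsub>R\<^esub> ident T (fobj (functor_power G w) x)"
      using comp_ident ident_comp by simp
  qed
  moreover have "hom_finite R"
    using assms Z_obj by (simp add: hom_finite_def)
  ultimately show ?thesis
    unfolding calabi_yau_def
    using linear_category_reduction F_autoequivalence serre_functor_reduction by auto
qed

end

theorem theorem3:
  fixes D :: "('k::alg_closed_field, 'o, 'm::ab_group_add) tri_cat"
    and w :: nat and S :: "'o set" and ch :: "('o, 'm) shift_choice"
  assumes "triangulated_category D"
    and "hom_finite D"
    and "krull_schmidt D"
    and "w \<ge> 1"
    and "orthogonal_collection D w S"
    and "functorially_finite D (extension_closure D S)"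
    and "valid_choice D w S ch"
    and "calabi_yau D (- int w)"
  shows "calabi_yau (reduction D w S ch) (- int w)"
proof -
  interpret triangulated_category D by fact
  have S: "S \<subseteq> Obj D" using assms(5) by (simp add: orthogonal_collection_def strict_subcat_def)
  interpret cy_reduction D S w ch
  proof unfold_locales
    show "S \<subseteq> Obj D" by fact
    show "is_iso D x y f" if "x \<in> S" "y \<in> S" "\<guillemotleft>f : x \<rightarrow> y\<guillemotright>\<^bsub>D\<^esub>" "f \<noteq> 0" for x y f
    proof (rule one_dim_schur)
      show "dim (hom D x y) = (if isomorphic D x y then 1 else 0)"
        using assms(5) that by (simp add: orthogonal_collection_def)
      show "\<exists>B. finite B \<and> hom D x y = span B" using assms(2) S that by (auto simp: hom_finite_def)
    qed (use that in auto)
    show "hom D ((fobj (shift D) ^^ k) s) t = {0}" if "1 \<le> k" "k < w" "s \<in> S" "t \<in> S" for k s t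
      using assms(5) that by (simp add: orthogonal_collection_def shiftpow_pos fobj_functor_power)
  qed (use assms in simp_all)
  show ?thesis using calabi_yau_reduction assms(2) by blast
qed

end
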